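(* Let $\mathbf s=\{s_j\}_{j\ge1}$ be a strictly increasing sequence with $s_1>0$ and $\lim_{j\to\infty}s_j=\infty$. Let $b=\{b_j\}_{j\ge1}$ be strictly positive numbers with $b_j=g(s_j)$, $j\ge1$, where $g:[0,\infty)\to[0,\infty)$ is an increasing strictly concave function, and let $$W_{j,k}=\frac{s_j\wedge s_k}{b_jb_k},\qquad j,k\in\mathbb N.$$ Let $f=Wh$, where $h\in\ell_1^+$, and for $\alpha>0$ let $\widetilde Z_\alpha=\{\widetilde Z_{\alpha,j}\}_{j\in\mathbb N}$ be an $\alpha$-permanental sequence with kernel $\widetilde W_{j,k}=W_{j,k}+f_k$, $j,k\in\mathbb N$. Then $$\limsup_{j\to\infty}\frac{\widetilde Z_{\alpha,j}}{W_{j,j}\,\mathcal K_{\mathbf s}(j)}=1\quad\text{a.s.},\qquad\forall\,\alpha>0,$$ where $\mathcal K_{\mathbf s}(j)=\log\big(\sum_{i=1}^{j-1}1\wedge\log(s_{i+1}/s_i)\big)$. If $\limsup_{j\to\infty}s_j/s_{j-1}<\infty$, then $$\limsup_{j\to\infty}\frac{\widetilde Z_{\alpha,j}}{W_{j,j}\log\log s_j}=1\quad\text{a.s.},\qquad\forall\,\alpha>0.$$ If $\liminf_{j\to\infty}s_j/s_{j-1}>1$, then $$\limsup_{j\to\infty}\frac{\widetilde Z_{\alpha,j}}{W_{j,j}\log j}=1\quad\text{a.s.},\qquad\forall\,\alpha>0.$$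
   Context: $\mathbb N=\{1,2,\dots\}$; $\ell_1^+$ is the set of non-negative summable sequences; $a\wedge b=\min(a,b)$; $(Wh)_j=\sum_{k}W_{j,k}h_k$. "Increasing function" includes non-decreasing functions, and a concave function $g$ is called strictly concave when $\lim_{x\to\infty}g(x)/x=0$. (Equivalently, the condition on $b$ is that $b$ is a non-zero finite potential, $b=Vh'$ with $V_{j,k}=s_j\wedge s_k$ and $h'\in\ell_1^+$.) Permanental sequences: for $\alpha>0$ and a matrix $K=\{K_{j,k}\}_{j,k\in\mathbb N}$, an $\alpha$-permanental sequence with kernel $K$ is a sequence $\{Z_j\}_{j\in\mathbb N}$ of non-negative random variables such that for all $n$, all distinct $i_1,\dots,i_n\in\mathbb N$ and all $t_1,\dots,t_n>0$, $E\exp(-\sum_{m=1}^n t_mZ_{i_m})=\det(I+K'T)^{-\alpha}$, where $K'=\{K_{i_p,i_q}\}_{p,q=1}^n$ and $T=\mathrm{diag}(t_1,\dots,t_n)$. For every $\alpha>0$ an $\alpha$-permanental sequence with kernel $\widetilde W$ exists, because $W$ is the strictly positive potential density of a symmetric transient Markov chain on $\mathbb N$ and $f$ is a finite excessive function for it. *)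

theory Defs
  imports "HOL-Probability.Probability" "Jordan_Normal_Form.Determinant"
begin

(* Sequences indexed by {1,2,...} are functions on nat; the value at 0 is never constrained
   and never enters a sum or a limit. *)

(* No separate positivity requirement on the determinant is needed for powr: it is continuous in t,
   tends to 1 as t tends to 0, and cannot vanish because the left-hand side is positive while
   0 powr a = 0. *)
definition permanental_sequence ::
  "'w measure \<Rightarrow> real \<Rightarrow> (nat \<Rightarrow> nat \<Rightarrow> real) \<Rightarrow> (nat \<Rightarrow> 'w \<Rightarrow> real) \<Rightarrow> bool" where
  "permanental_sequence M \<alpha> K Z \<longleftrightarrow>
     (\<forall>j\<ge>1. Z j \<in> borel_measurable M \<and> (\<forall>\<omega>\<in>space M. 0 \<le> Z j \<omega>)) \<and>
     (\<forall>n (i :: nat \<Rightarrow> nat) (t :: nat \<Rightarrow> real).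
        inj_on i {..<n} \<and> (\<forall>m<n. 1 \<le> i m) \<and> (\<forall>m<n. 0 < t m) \<longrightarrow>
        integral\<^sup>L M (\<lambda>\<omega>. exp (- (\<Sum>m<n. t m * Z (i m) \<omega>))) =
          Determinant.det
            (1\<^sub>m n + Matrix.mat n n (\<lambda>(p, q). K (i p) (i q)) * mat_diag n t) powr (- \<alpha>))"

(* "Strictly concave" in the sense of sublinear growth, not strict inequality in the
   concavity condition. *)
definition sublinear_concave :: "(real \<Rightarrow> real) \<Rightarrow> bool" where
  "sublinear_concave g \<longleftrightarrow> concave_on {0..} g \<and> ((\<lambda>x. g x / x) \<longlongrightarrow> 0) at_top"

definition W_kernel :: "(nat \<Rightarrow> real) \<Rightarrow> (nat \<Rightarrow> real) \<Rightarrow> nat \<Rightarrow> nat \<Rightarrow> real" where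
  "W_kernel s b j k = min (s j) (s k) / (b j * b k)"

definition kernel_apply :: "(nat \<Rightarrow> nat \<Rightarrow> real) \<Rightarrow> (nat \<Rightarrow> real) \<Rightarrow> nat \<Rightarrow> real" where
  "kernel_apply W h j = (\<Sum>\<^sub>\<infinity>k\<in>{1..}. W j k * h k)"

definition K_seq :: "(nat \<Rightarrow> real) \<Rightarrow> nat \<Rightarrow> real" where
  "K_seq s j = ln (\<Sum>i\<in>{1..<j}. min 1 (ln (s (i + 1) / s i)))"

end

theory Submission
  imports Defs
begin

text \<open>Put \<open>Y j = (b j)\<^sup>2 * Z j\<close>. Up to conjugation by a diagonal matrix its kernel is
  \<open>min (s j) (s k) + b j * \<phi> k\<close> with \<open>\<phi> = b f\<close>. Both \<open>b\<close> and \<open>\<phi>\<close> are increasing concave functions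
  of \<open>s\<close>, and \<open>b j * \<phi> j / s j\<close> tends to 0.

  Upper bound: the one- and two-point Laplace transforms yield exponential tails for \<open>Y j\<close> at scale \<open>s j\<close>
  and for \<open>Y j - Y i\<close> at scale \<open>sqrt (s i * (s j - s i))\<close>. Chaining controls the maximum over a block
  on which the sum \<open>\<tau> j\<close> of \<open>min 1 (ln (s (i + 1) / s i))\<close> over \<open>1 \<le> i < j\<close> varies by a small constant, and the first
  Borel-Cantelli lemma applies to the blocks.

  Lower bound: the inverse of a kernel of the form above, restricted to finitely many indices, is an M-matrix.
  Therefore the joint Laplace transform is a mixture of products of Laplace transforms of gamma laws of
  shape at least \<open>\<alpha>\<close>, and the probability that finitely many \<open>Y j\<close> are all small is at most a product
  of gamma probabilities. Along a subsequence on which \<open>s\<close> grows geometrically with a large ratio the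
  gamma tails are at least of order \<open>1 / k\<close>, so the infinite product vanishes.\<close>

subsection \<open>Gamma laws\<close>

text \<open>The kernel need not be symmetric and \<open>\<alpha>\<close> is arbitrary, so neither
  squares of Gaussian variables nor Gaussian comparison theorems are at hand: all that is known is
  the Laplace transform of finite marginals at positive arguments. The tails need exponential
  moments of either sign, the lower bound needs probabilities of joint events. Once a transform is
  recognised as a countable mixture, with nonnegative weights, of products of gamma transforms,
  Stone-Weierstrass carries the identity over to test functions that vanish beyond some point, and
  Fatou's lemma to exponential moments. Nonnegativity of the weights is the crux; it comes from
  negative binomial series and from the signs of an M-matrix. \<open>\<tau>\<close> counts nearly
  independent trials: \<open>s\<close> must grow by a factor before \<open>Y\<close> decouples, so a
  short step contributes the logarithm of its ratio, while a jump of any size yields one new index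
  and counts at most 1. About \<open>\<tau> j\<close> trials with tails
  \<open>exp (- x / s j)\<close> peak near \<open>s j * ln (\<tau> j)\<close>. Sublinearity of
  \<open>g\<close> keeps the perturbation from changing the constant 1.\<close>

definition gamma_law :: "real \<Rightarrow> real measure" where
  "gamma_law a =
     density lborel (\<lambda>y. ennreal (indicator {0<..} y * (y powr (a - 1) * exp (- y)) / Gamma a))"

lemma sets_gamma_law [simp, measurable_cong]: "sets (gamma_law a) = sets borel"
  by (simp add: gamma_law_def)

lemma space_gamma_law [simp]: "space (gamma_law a) = UNIV"
  by (simp add: gamma_law_def)

lemma nn_integral_gamma_law:
  assumes "f \<in> borel_measurable borel"
  shows "(\<integral>\<^sup>+y. f y \<partial>gamma_law a) =
    (\<integral>\<^sup>+y. ennreal (indicator {0<..} y * (y powr (a - 1) * exp (- y)) / Gamma a) * f y \<partial>lborel)"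
  using assms unfolding gamma_law_def by (subst nn_integral_density) auto

text \<open>The substitution \<open>y \<mapsto> c * y\<close> with \<open>c = 1 / (1 + t)\<close>
  reduces everything to Euler's integral. Negative \<open>t\<close> above \<open>- 1\<close> are
  included because they give the exponential moments later on.\<close>

lemma nn_integral_gamma_law_exp:
  fixes a t :: real
  assumes a: "0 < a" and t: "- 1 < t"
  shows "(\<integral>\<^sup>+y. ennreal (exp (- t * y)) \<partial>gamma_law a) = ennreal ((1 + t) powr - a)"
proof -
  have G: "0 < Gamma a" using a by (rule Gamma_real_pos)
  define c where "c = 1 / (1 + t)"
  have c: "0 < c" "c \<noteq> 0" and ct: "c * (1 + t) = 1" using t by (auto simp: c_def)
  have 1: "(\<integral>\<^sup>+y. ennreal (indicator {0<..} y * (y powr (a - 1) * exp (- y)) / Gamma a) *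
      ennreal (exp (- t * y)) \<partial>lborel) =
      (\<integral>\<^sup>+y. ennreal (indicator {0<..} y * (y powr (a - 1) * exp (- ((1 + t) * y))) / Gamma a) \<partial>lborel)"
    by (intro nn_integral_cong)
      (use G in \<open>auto simp: ennreal_mult' [symmetric] indicator_def exp_add [symmetric] algebra_simps\<close>)
  also have "\<dots> = ennreal \<bar>c\<bar> * (\<integral>\<^sup>+y. ennreal (indicator {0<..} (0 + c * y) *
      ((0 + c * y) powr (a - 1) * exp (- ((1 + t) * (0 + c * y)))) / Gamma a) \<partial>lborel)"
    by (rule nn_integral_real_affine) (use c in auto)
  also have "\<dots> = ennreal \<bar>c\<bar> * (\<integral>\<^sup>+y. ennreal (c powr (a - 1) / Gamma a) *
      ennreal (indicator {0..} y * (y powr (a - 1) / exp y)) \<partial>lborel)"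
  proof -
    have e: "(1 + t) * (c * y) = y" for y using ct by (metis mult.assoc mult.commute mult_1)
    \<comment> \<open>The indicators of \<open>{0<..}\<close> and \<open>{0..}\<close> differ only
      at 0, a null set.\<close>
    have "AE y in lborel. y \<noteq> (0::real)" by (rule AE_lborel_singleton)
    then have "AE y in lborel. ennreal (indicator {0<..} (0 + c * y) *
      ((0 + c * y) powr (a - 1) * exp (- ((1 + t) * (0 + c * y)))) / Gamma a) =
      ennreal (c powr (a - 1) / Gamma a) * ennreal (indicator {0..} y * (y powr (a - 1) / exp y))"
      by eventually_elim
        (use c G e in \<open>auto simp: indicator_def powr_mult ennreal_mult [symmetric] exp_minus field_simps zero_less_mult_iff exp_add[symmetric] distrib_left[symmetric] ct mult.assoc\<close>)
    then show ?thesis by (subst nn_integral_cong_AE) auto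
  qed
  also have "\<dots> = ennreal \<bar>c\<bar> * (ennreal (c powr (a - 1) / Gamma a) * ennreal (Gamma a))"
    by (subst nn_integral_cmult, simp)
      (use nn_integral_has_integral_lebesgue[OF _ Gamma_integral_real[OF a]] in simp)
  also have "\<dots> = ennreal (c * c powr (a - 1))"
    using c G by (simp add: ennreal_mult' [symmetric])
  also have "c * c powr (a - 1) = (1 + t) powr - a"
    using c t by (simp add: c_def powr_mult_base powr_divide powr_minus_divide)
  finally show ?thesis
    by (subst nn_integral_gamma_law) (simp_all)
qed

lemma prob_space_gamma_law: "0 < a \<Longrightarrow> prob_space (gamma_law a)"
  using nn_integral_gamma_law_exp[of a 0] by (intro prob_spaceI) simp

lemma AE_gamma_law_pos: "AE y in gamma_law a. 0 < y"
  unfolding gamma_law_def by (subst AE_density) (auto intro!: AE_I2 simp: indicator_def)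

lemma integral_gamma_law_exp:
  fixes a t :: real
  assumes a: "0 < a" and t: "- 1 < t"
  shows "(LINT y|gamma_law a. exp (- t * y)) = (1 + t) powr - a"
  using nn_integral_gamma_law_exp[OF assms] by (intro integral_eq_nn_integral[THEN trans]) auto

text \<open>Raising the shape by an integer is a size bias: the density picks up the factor
  \<open>y ^ n\<close> and a new normalisation. This turns the comparison of shapes into a
  correlation inequality.\<close>

lemma nn_integral_gamma_law_shift:
  fixes a :: real
  assumes a: "0 < a" and f: "f \<in> borel_measurable borel"
  shows "(\<integral>\<^sup>+y. f y \<partial>gamma_law (a + real n)) =
    ennreal (Gamma a / Gamma (a + real n)) * (\<integral>\<^sup>+y. ennreal (y ^ n) * f y \<partial>gamma_law a)"
proof -
  have G: "0 < Gamma a" "0 < Gamma (a + real n)" using a by (auto intro!: Gamma_real_pos)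
  have p: "y powr (a + real n - 1) = y powr (a - 1) * y ^ n" if "y > 0" for y :: real
    using that by (simp add: powr_realpow[symmetric] powr_add[symmetric] algebra_simps)
  show ?thesis
    unfolding nn_integral_gamma_law[OF f]
    apply (subst nn_integral_gamma_law)
    subgoal using f by measurable
    apply (subst nn_integral_cmult[symmetric])
    subgoal using f by measurable
    apply (intro nn_integral_cong)
    subgoal for y
    proof (cases "0 < y")
      case True
      have "y powr (a + real n - 1) * exp (- y) / Gamma (a + real n) =
          Gamma a / Gamma (a + real n) * (y powr (a - 1) * exp (- y) / Gamma a * y ^ n)"
        using True G by (simp add: p)
      then have "ennreal (y powr (a + real n - 1) * exp (- y) / Gamma (a + real n)) =
          ennreal (Gamma a / Gamma (a + real n)) *
            (ennreal (y powr (a - 1) * exp (- y) / Gamma a) * ennreal (y ^ n))"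
        using True G by (simp only: ennreal_mult[symmetric] divide_nonneg_pos mult_nonneg_nonneg
          powr_ge_zero exp_ge_zero zero_le_power less_imp_le)
      then show ?thesis using True by (simp add: mult.assoc)
    qed simp
    done
qed

text \<open>Chebyshev's association inequality: under \<open>gamma_law a\<close> the increasing
  weight \<open>y ^ n\<close> and the decreasing \<open>f\<close> are negatively correlated, and the
  law of shape \<open>a + n\<close> is the one weighted by \<open>y ^ n\<close>.\<close>

lemma gamma_law_stochastic_order:
  fixes f :: "real \<Rightarrow> real"
  assumes a: "0 < a" and f: "f \<in> borel_measurable borel" and f0: "\<And>y. 0 \<le> f y"
    and fB: "\<And>y. f y \<le> B" and anti: "\<And>x y. 0 < x \<Longrightarrow> x \<le> y \<Longrightarrow> f y \<le> f x"
  shows "(LINT y|gamma_law (a + real n). f y) \<le> (LINT y|gamma_law a. f y)"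
proof -
  interpret G: prob_space "gamma_law a" by (rule prob_space_gamma_law[OF a])
  interpret G': prob_space "gamma_law (a + real n)" using a by (intro prob_space_gamma_law) simp
  define m where "m = Gamma (a + real n) / Gamma a"
  have m: "0 < m" using a by (auto simp: m_def intro!: divide_pos_pos Gamma_real_pos)
  have inv: "Gamma a / Gamma (a + real n) = 1 / m" by (simp add: m_def)
  have em: "(\<integral>\<^sup>+y. ennreal (y ^ n) \<partial>gamma_law a) = ennreal m"
  proof -
    have "1 = ennreal (1 / m) * (\<integral>\<^sup>+y. ennreal (y ^ n) \<partial>gamma_law a)"
      using nn_integral_gamma_law_shift[OF a, of "\<lambda>_. 1" n] G'.emeasure_space_1 inv by simp
    then have "ennreal m * 1 = ennreal m * (ennreal (1 / m) * (\<integral>\<^sup>+y. ennreal (y ^ n) \<partial>gamma_law a))" by simp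
    also have "\<dots> = (\<integral>\<^sup>+y. ennreal (y ^ n) \<partial>gamma_law a)"
      using m by (simp add: mult.assoc[symmetric] ennreal_mult'[symmetric])
    finally show ?thesis by simp
  qed
  have pos: "AE y in gamma_law a. 0 \<le> y ^ n" using AE_gamma_law_pos by eventually_elim simp
  have im: "integrable (gamma_law a) (\<lambda>y. y ^ n)" and Em: "(LINT y|gamma_law a. y ^ n) = m"
    using nn_integral_eq_integrable[of "\<lambda>y. y ^ n" "gamma_law a" m] em pos m by auto
  have if1: "integrable (gamma_law a) f"
    by (rule G.integrable_const_bound[where B = B]) (use f f0 fB in auto)
  have ifm: "integrable (gamma_law a) (\<lambda>y. y ^ n * f y)"
  proof (rule Bochner_Integration.integrable_bound[OF integrable_mult_right[OF im, of B]])
    show "(\<lambda>y. y ^ n * f y) \<in> borel_measurable (gamma_law a)" using f by measurable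
    show "AE y in gamma_law a. norm (y ^ n * f y) \<le> norm (B * y ^ n)"
    proof (intro AE_I2)
      fix y
      have "\<bar>f y\<bar> \<le> \<bar>B\<bar>" using f0[of y] fB[of y] by simp
      then show "norm (y ^ n * f y) \<le> norm (B * y ^ n)"
        by (simp add: abs_mult mult.commute[of "\<bar>B\<bar>"] mult_left_mono)
    qed
  qed
  have "(\<integral>\<^sup>+y. f y \<partial>gamma_law (a + real n)) = ennreal (1 / m) * (\<integral>\<^sup>+y. ennreal (y ^ n) * f y \<partial>gamma_law a)"
    using nn_integral_gamma_law_shift[OF a, of f n] f inv by simp
  also have "(\<integral>\<^sup>+y. ennreal (y ^ n) * f y \<partial>gamma_law a) = (\<integral>\<^sup>+y. ennreal (y ^ n * f y) \<partial>gamma_law a)"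
    by (intro nn_integral_cong) (simp add: ennreal_mult'' f0)
  also have "\<dots> = ennreal (LINT y|gamma_law a. y ^ n * f y)"
    by (rule nn_integral_eq_integral[OF ifm]) (use pos f0 in auto)
  finally have s: "(LINT y|gamma_law (a + real n). f y) = (LINT y|gamma_law a. y ^ n * f y) / m"
  proof (intro integral_eq_nn_integral[THEN trans])
    have "0 \<le> (LINT y|gamma_law a. y ^ n * f y)"
      by (rule integral_nonneg_AE) (use pos f0 in auto)
    then show "enn2real (\<integral>\<^sup>+y. ennreal (f y) \<partial>gamma_law (a + real n)) = (LINT y|gamma_law a. y ^ n * f y) / m"
      if "(\<integral>\<^sup>+y. ennreal (f y) \<partial>gamma_law (a + real n)) = ennreal (1 / m) * ennreal (LINT y|gamma_law a. y ^ n * f y)"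
      using m that by (simp add: ennreal_mult'[symmetric])
  qed (use f f0 in auto)
  show ?thesis
  proof (cases "n = 0")
    case False
    \<comment> \<open>\<open>c\<close> is where \<open>y ^ n\<close> crosses its mean
      \<open>m\<close>. Both factors of \<open>(f c - f y) * (y ^ n - m)\<close> change sign there,
      so the product is nonnegative.\<close>
    define c where "c = root n m"
    have c: "0 < c" "c ^ n = m" using m False by (auto simp: c_def)
    have "0 \<le> (LINT y|gamma_law a. (f c - f y) * (y ^ n - m))"
    proof (rule integral_nonneg_AE)
      show "AE y in gamma_law a. 0 \<le> (f c - f y) * (y ^ n - m)"
        using AE_gamma_law_pos
      proof eventually_elim
        case (elim y)
        show ?case
        proof (cases "y \<le> c")
          case True
          then have "f c \<le> f y" "y ^ n \<le> m" using anti[OF elim] elim c(2) by (auto intro: power_mono simp flip: c(2))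
          then show ?thesis by (simp add: mult_nonpos_nonpos)
        next
          case False
          then have "f y \<le> f c" "m \<le> y ^ n" using anti[OF c(1), of y] c by (auto intro: power_mono simp flip: c(2))
          then show ?thesis by simp
        qed
      qed
    qed
    also have "\<dots> = f c * (m - m) - (LINT y|gamma_law a. y ^ n * f y) + m * (LINT y|gamma_law a. f y)"
      using im ifm if1 Em G.prob_space by (simp add: algebra_simps)
    finally show ?thesis using m s by (simp add: divide_le_eq mult.commute)
  qed simp
qed

text \<open>Only the part of the integral over \<open>{x..x+1}\<close> is kept. There
  \<open>y powr (a - 1) \<ge> 1 / y\<close> because \<open>y \<ge> 1\<close> and
  \<open>a > 0\<close>, which treats small and large shapes alike at the price of a polynomial
  factor.\<close>

lemma gamma_law_tail:
  assumes a: "0 < a" and x: "1 \<le> x"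
  shows "exp (- x - 1) / ((x + 1) * Gamma a) \<le> measure (gamma_law a) {x..}"
proof -
  interpret G: prob_space "gamma_law a" by (rule prob_space_gamma_law[OF a])
  have g: "0 < Gamma a" using a by (rule Gamma_real_pos)
  have "ennreal (exp (- x - 1) / ((x + 1) * Gamma a)) =
     (\<integral>\<^sup>+y. ennreal (exp (- x - 1) / ((x + 1) * Gamma a)) * indicator {x..x+1} y \<partial>lborel)"
    by (subst nn_integral_cmult_indicator) auto
  also have "\<dots> \<le> (\<integral>\<^sup>+y. ennreal (indicator {0<..} y * (y powr (a - 1) * exp (- y)) / Gamma a) * indicator {x..} y \<partial>lborel)"
  proof (intro nn_integral_mono)
    fix y
    show "ennreal (exp (- x - 1) / ((x + 1) * Gamma a)) * indicator {x..x+1} y \<le>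
      ennreal (indicator {0<..} y * (y powr (a - 1) * exp (- y)) / Gamma a) * indicator {x..} y"
    proof (cases "y \<in> {x..x+1}")
      case True
      then have y: "1 \<le> y" "x \<le> y" "y \<le> x + 1" using x by auto
      have "1 / (x + 1) \<le> 1 / y" using y by (simp add: frac_le)
      also have "1 / y = y powr (- 1)" using y by (simp add: powr_minus_divide)
      also have "\<dots> \<le> y powr (a - 1)" using y a by (intro powr_mono) auto
      finally have "1 / (x + 1) * exp (- x - 1) \<le> y powr (a - 1) * exp (- y)"
        using y by (intro mult_mono) auto
      then have "1 / (x + 1) * exp (- x - 1) / Gamma a \<le> y powr (a - 1) * exp (- y) / Gamma a"
        using g by (intro divide_right_mono) auto
      then show ?thesis using True y by (auto simp: field_simps intro!: ennreal_leI)
    qed auto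
  qed
  also have "\<dots> = emeasure (gamma_law a) {x..}"
    unfolding gamma_law_def by (subst emeasure_density) auto
  finally show ?thesis by (simp add: G.emeasure_eq_measure)
qed

text \<open>The slack \<open>\<delta> * X\<close> in the exponent pays for the polynomial factor of
  \<open>gamma_law_tail\<close>, so that logarithmic \<open>X\<close> will produce harmonic terms.
  The second disjunct covers thresholds below 1, which are outside the range of that lemma.\<close>

lemma gamma_law_tail_exp:
  assumes \<alpha>: "0 < \<alpha>" and \<delta>: "0 < \<delta>" "\<delta> \<le> 1"
  shows "\<exists>c>0. \<forall>X\<ge>2. c * exp (- X) \<le> measure (gamma_law \<alpha>) {(1 - \<delta>) * X..} \<or> (1 - \<delta>) * X < 1"
proof -
  define c where "c = exp (- 1) / ((1 / \<delta> + 1) * Gamma \<alpha>)"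
  have G: "0 < Gamma \<alpha>" by (rule Gamma_real_pos[OF \<alpha>])
  have d1: "0 < 1 / \<delta> + 1" using \<delta> by (simp add: add_pos_pos)
  have "c * exp (- X) \<le> measure (gamma_law \<alpha>) {(1 - \<delta>) * X..}" if X: "2 \<le> X" "1 \<le> (1 - \<delta>) * X" for X
  proof -
    define y where "y = (1 - \<delta>) * X"
    \<comment> \<open>The distance from the threshold \<open>y\<close> to \<open>X\<close>; the
      factor \<open>exp w\<close> gained in the exponent dominates \<open>y + 1\<close> up to
      \<open>1 / \<delta> + 1\<close>.\<close>
    define w where "w = \<delta> * X"
    have w: "0 \<le> w" "X = w / \<delta>" "y = X - w" using \<delta> X by (auto simp: w_def y_def algebra_simps)
    have "y + 1 \<le> w / \<delta> + 1" using w by simp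
    also have "\<dots> \<le> exp w / \<delta> + exp w"
    proof -
      have "w \<le> exp w" using exp_ge_add_one_self[of w] by linarith
      then show ?thesis using \<delta> w by (intro add_mono divide_right_mono) auto
    qed
    also have "\<dots> = (1 / \<delta> + 1) * exp w" by (simp add: algebra_simps)
    finally have y1: "y + 1 \<le> (1 / \<delta> + 1) * exp w" .
    have "c * exp (- X) = exp (- y - 1) / (((1 / \<delta> + 1) * exp w) * Gamma \<alpha>)"
    proof -
      have "- y - 1 = - 1 + - X + w" using w(3) by simp
      then have "exp (- y - 1) = exp (- 1) * exp (- X) * exp w" by (simp only: exp_add)
      then show ?thesis by (simp add: c_def)
    qed
    also have "\<dots> \<le> exp (- y - 1) / ((y + 1) * Gamma \<alpha>)"
      using y1 G X \<delta> d1 by (intro divide_left_mono mult_right_mono mult_pos_pos) (auto simp: y_def)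
    also have "\<dots> \<le> measure (gamma_law \<alpha>) {y..}"
      by (rule gamma_law_tail[OF \<alpha>]) (use X in \<open>simp add: y_def\<close>)
    finally show ?thesis by (simp add: y_def)
  qed
  moreover have "0 < c" using G d1 by (simp add: c_def)
  ultimately show ?thesis by (intro exI[of _ c]) (auto simp: not_less)
qed

subsection \<open>Mixtures of products of gamma laws\<close>

text \<open>Weierstrass approximation in the variable \<open>x = exp (- y)\<close>. Dividing by
  \<open>x\<close> before approximating, possible because \<open>f\<close> vanishes for large
  \<open>y\<close>, removes the constant term: every exponent is at least 1, so only strictly
  positive Laplace arguments occur.\<close>

lemma exponential_polynomial_approximation:
  fixes f :: "real \<Rightarrow> real"
  assumes f: "continuous_on UNIV f" and R: "\<And>y. R \<le> y \<Longrightarrow> f y = 0" and e: "0 < e"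
  shows "\<exists>N a. \<forall>y\<ge>0. \<bar>f y - (\<Sum>c\<le>N. a c * exp (- (real c + 1) * y))\<bar> < e"
proof -
  define G where "G = (\<lambda>x. if x \<le> 0 then 0 else f (- ln x) / x)"
  have R0: "G x = 0" if "x \<le> exp (- R)" for x
  proof (cases "x \<le> 0")
    case False
    then have "ln x \<le> - R" using that by (metis ln_exp ln_le_cancel_iff exp_gt_zero not_le)
    then show ?thesis using R[of "- ln x"] by (simp add: G_def)
  qed (simp add: G_def)
  have "continuous_on ({..exp (- R)} \<union> {exp (- R)..}) G"
  proof (rule continuous_on_closed_Un)
    show "continuous_on {..exp (- R)} G"
      by (rule continuous_on_eq[OF continuous_on_const[of _ 0]]) (simp add: R0)
    have "continuous_on {exp (- R)..} (\<lambda>x. f (- ln x) / x)"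
      by (intro continuous_intros continuous_on_compose2[OF f])
        (auto dest: less_le_trans[OF exp_gt_zero])
    then show "continuous_on {exp (- R)..} G"
      by (rule continuous_on_eq) (auto simp: G_def dest: less_le_trans[OF exp_gt_zero])
  qed auto
  then have "continuous_on {0..1} G"
    by (rule continuous_on_subset) (auto simp: not_le intro: less_imp_le)
  then obtain p where p: "real_polynomial_function p" "\<And>x. x \<in> {0..1} \<Longrightarrow> \<bar>G x - p x\<bar> < e"
    using Stone_Weierstrass_real_polynomial_function[of "{0..1}" G e] e by auto
  from p(1) obtain a N where pa: "p = (\<lambda>x. \<Sum>i\<le>N. a i * x ^ i)"
    unfolding real_polynomial_function_iff_sum by blast
  show ?thesis
  proof (intro exI allI impI)
    fix y :: real assume y: "0 \<le> y"
    define x where "x = exp (- y)"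
    have x: "0 < x" "x \<le> 1" using y by (auto simp: x_def)
    have "(\<Sum>c\<le>N. a c * exp (- (real c + 1) * y)) = x * p x"
      unfolding pa sum_distrib_left
      by (intro sum.cong)
        (auto simp: x_def exp_of_nat_mult[symmetric] exp_add[symmetric] algebra_simps)
    moreover have "f y = x * G x" using x by (simp add: G_def x_def)
    ultimately have "\<bar>f y - (\<Sum>c\<le>N. a c * exp (- (real c + 1) * y))\<bar> = x * \<bar>G x - p x\<bar>"
      using x by (simp add: right_diff_distrib[symmetric] abs_mult)
    also have "\<dots> \<le> 1 * \<bar>G x - p x\<bar>" using x by (intro mult_right_mono) auto
    also have "\<dots> < e" using p(2)[of x] x by simp
    finally show "\<bar>f y - (\<Sum>c\<le>N. a c * exp (- (real c + 1) * y))\<bar> < e" .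
  qed
qed

text \<open>Both sides are multilinear in the test functions and agree on exponentials, hence on
  exponential polynomials; uniform approximation and dominated convergence do the rest. All subsets
  of the mixing space are measurable, so measurability in \<open>k\<close> is automatic.\<close>

lemma laplace_mixture_product:
  fixes Y :: "nat \<Rightarrow> 'w \<Rightarrow> real" and V :: "'k measure" and \<mu> :: "'k \<Rightarrow> nat \<Rightarrow> real measure"
    and f :: "nat \<Rightarrow> real \<Rightarrow> real"
  assumes M: "prob_space M" and V: "finite_measure V" and V_sets: "sets V = UNIV"
    and Y: "\<And>i. i < n \<Longrightarrow> Y i \<in> borel_measurable M"
    and Y0: "\<And>i \<omega>. i < n \<Longrightarrow> \<omega> \<in> space M \<Longrightarrow> 0 \<le> Y i \<omega>"
    and \<mu>: "\<And>k i. prob_space (\<mu> k i)" and \<mu>_sets [measurable_cong]: "\<And>k i. sets (\<mu> k i) = sets borel"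
    and \<mu>0: "\<And>k i. AE y in \<mu> k i. 0 \<le> y"
    and laplace: "\<And>t. (\<And>i. i < n \<Longrightarrow> 0 < t i) \<Longrightarrow>
      (LINT \<omega>|M. exp (- (\<Sum>i<n. t i * Y i \<omega>))) =
      (LINT k|V. (\<Prod>i<n. LINT y|\<mu> k i. exp (- t i * y)))"
    and f: "\<And>i. i < n \<Longrightarrow> continuous_on UNIV (f i)"
    and R: "\<And>i y. i < n \<Longrightarrow> R \<le> y \<Longrightarrow> f i y = 0"
  shows "(LINT \<omega>|M. (\<Prod>i<n. f i (Y i \<omega>))) = (LINT k|V. (\<Prod>i<n. LINT y|\<mu> k i. f i y))"
proof -
  interpret M: prob_space M by fact
  interpret V: finite_measure V by fact
  interpret \<mu>: prob_space "\<mu> k i" for k i by fact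
  have Vm: "g \<in> borel_measurable V" for g :: "'k \<Rightarrow> real"
    by (simp add: measurable_def V_sets)
  have ex: "\<forall>i m. \<exists>Na. i < n \<longrightarrow> (\<forall>y\<ge>0. \<bar>f i y - (\<Sum>c\<le>fst Na. snd Na c * exp (- (real c + 1) * y))\<bar> < 1 / real (Suc m))"
  proof (intro allI)
    fix i m
    show "\<exists>Na. i < n \<longrightarrow> (\<forall>y\<ge>0. \<bar>f i y - (\<Sum>c\<le>fst Na. snd Na c * exp (- (real c + 1) * y))\<bar> < 1 / real (Suc m))"
    proof (cases "i < n")
      case True
      have "0 < 1 / real (Suc m)" by simp
      from exponential_polynomial_approximation[OF f[OF True] R[OF True] this] obtain N a where
        "\<forall>y\<ge>0. \<bar>f i y - (\<Sum>c\<le>N. a c * exp (- (real c + 1) * y))\<bar> < 1 / real (Suc m)" by blast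
      then show ?thesis by (intro exI[of _ "(N, a)"]) simp
    qed simp
  qed
  define Na where "Na i m = (SOME Na. i < n \<longrightarrow>
      (\<forall>y\<ge>0. \<bar>f i y - (\<Sum>c\<le>fst Na. snd Na c * exp (- (real c + 1) * y))\<bar> < 1 / real (Suc m)))" for i m
  have Na: "\<bar>f i y - (\<Sum>c\<le>fst (Na i m). snd (Na i m) c * exp (- (real c + 1) * y))\<bar> < 1 / real (Suc m)"
    if "i < n" "0 \<le> y" for i m y
    using someI_ex[OF ex[rule_format, of i m]] that unfolding Na_def by blast
  define p where "p i m y = (\<Sum>c\<le>fst (Na i m). snd (Na i m) c * exp (- (real c + 1) * y))" for i m y
  have p: "\<bar>f i y - p i m y\<bar> < 1 / real (Suc m)" if "i < n" "0 \<le> y" for i m y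
    using Na[OF that] by (simp add: p_def)
  have p_lim: "(\<lambda>m. p i m y) \<longlonglongrightarrow> f i y" if "i < n" "0 \<le> y" for i y
  proof (rule LIM_zero_cancel)
    show "(\<lambda>m. p i m y - f i y) \<longlonglongrightarrow> 0"
      by (rule Lim_null_comparison[OF _ LIMSEQ_inverse_real_of_nat])
        (use p[OF that] in \<open>auto intro!: always_eventually less_imp_le simp: abs_minus_commute inverse_eq_divide\<close>)
  qed
  have "\<exists>B. \<forall>y\<ge>0. \<bar>f i y\<bar> \<le> B" if "i < n" for i
  proof -
    have "bounded (f i ` {0..max 0 R})"
      by (intro compact_imp_bounded compact_continuous_image continuous_on_subset[OF f[OF that]]) auto
    then obtain B where B: "\<And>y. y \<in> {0..max 0 R} \<Longrightarrow> \<bar>f i y\<bar> \<le> B" unfolding bounded_iff by (metis image_eqI real_norm_def)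
    have "\<bar>f i y\<bar> \<le> B" if "0 \<le> y" for y
      using B[of y] B[of 0] R[OF \<open>i < n\<close>, of y] that by (cases "y \<le> max 0 R") auto
    then show ?thesis by blast
  qed
  then obtain B where B: "\<And>i y. i < n \<Longrightarrow> 0 \<le> y \<Longrightarrow> \<bar>f i y\<bar> \<le> B i" by metis
  \<comment> \<open>The approximation error is at most 1 for every \<open>m\<close>, which gives one
    dominating constant for all limits below.\<close>
  have pB: "\<bar>p i m y\<bar> \<le> B i + 1" if "i < n" "0 \<le> y" for i m y
  proof -
    have "1 / real (Suc m) \<le> 1" by simp
    then show ?thesis using p[OF that, of m] B[OF that] by linarith
  qed
  have B0: "0 \<le> B i" if "i < n" for i using B[OF that, of 0] by simp
  have fm [measurable]: "f i \<in> borel_measurable borel" if "i < n" for i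
    using f[OF that] by (rule borel_measurable_continuous_onI)
  have pm [measurable]: "p i m \<in> borel_measurable borel" for i m
    unfolding p_def by measurable
  have eq: "(LINT \<omega>|M. (\<Prod>i<n. p i m (Y i \<omega>))) = (LINT k|V. (\<Prod>i<n. LINT y|\<mu> k i. p i m y))" for m
  proof -
    define P where "P = PiE {..<n} (\<lambda>i. {..fst (Na i m)})"
    define A where "A \<kappa> = (\<Prod>i<n. snd (Na i m) (\<kappa> i))" for \<kappa> :: "nat \<Rightarrow> nat"
    have exp1: "AE y in \<mu> k i. exp (- (real c + 1) * y) \<le> 1" for k i c
      using \<mu>0[of k i] by eventually_elim (simp add: mult_nonpos_nonneg)
    have iexp: "integrable (\<mu> k i) (\<lambda>y. exp (- (real c + 1) * y))" for k i c
      by (rule \<mu>.integrable_const_bound[where B = 1])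
        (use exp1[of c k i] in auto)
    have bexp: "\<bar>LINT y|\<mu> k i. exp (- (real c + 1) * y)\<bar> \<le> 1" for k i c
    proof -
      have "(LINT y|\<mu> k i. exp (- (real c + 1) * y)) \<le> (LINT y|\<mu> k i. 1)"
        by (rule integral_mono_AE[OF iexp]) (use exp1[of c k i] in auto)
      moreover have "0 \<le> (LINT y|\<mu> k i. exp (- (real c + 1) * y))" by (rule integral_nonneg_AE) simp
      ultimately show ?thesis by (simp add: \<mu>.prob_space)
    qed
    have E: "exp (- (\<Sum>i<n. u i * z i)) = (\<Prod>i<n. exp (- u i * z i))" for u z :: "nat \<Rightarrow> real"
      by (simp add: exp_sum[symmetric] sum_negf)
    \<comment> \<open>Distributivity over choice functions \<open>\<kappa>\<close>: a product of
      exponential sums becomes a sum of joint exponentials, to which \<open>laplace\<close>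
      applies.\<close>
    have pw: "(\<Prod>i<n. \<Sum>c\<le>fst (Na i m). snd (Na i m) c * w i c) =
        (\<Sum>\<kappa>\<in>P. A \<kappa> * (\<Prod>i<n. w i (\<kappa> i)))" for w :: "nat \<Rightarrow> nat \<Rightarrow> real"
      unfolding P_def A_def by (subst prod_sum_PiE) (simp_all add: prod.distrib)
    have "(LINT \<omega>|M. (\<Prod>i<n. p i m (Y i \<omega>))) =
        (LINT \<omega>|M. (\<Sum>\<kappa>\<in>P. A \<kappa> * exp (- (\<Sum>i<n. (real (\<kappa> i) + 1) * Y i \<omega>))))"
      unfolding p_def E pw ..
    also have "\<dots> = (\<Sum>\<kappa>\<in>P. A \<kappa> * (LINT \<omega>|M. exp (- (\<Sum>i<n. (real (\<kappa> i) + 1) * Y i \<omega>))))"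
    proof (subst Bochner_Integration.integral_sum)
      fix \<kappa>
      have "(\<lambda>\<omega>. \<Sum>i<n. (real (\<kappa> i) + 1) * Y i \<omega>) \<in> borel_measurable M"
        using Y by (intro borel_measurable_sum borel_measurable_times) auto
      then show "integrable M (\<lambda>\<omega>. A \<kappa> * exp (- (\<Sum>i<n. (real (\<kappa> i) + 1) * Y i \<omega>)))"
        by (intro integrable_mult_right M.integrable_const_bound[where B = 1])
          (auto intro!: AE_I2 sum_nonneg mult_nonneg_nonneg Y0)
    qed simp
    also have "\<dots> = (\<Sum>\<kappa>\<in>P. A \<kappa> * (LINT k|V. (\<Prod>i<n. LINT y|\<mu> k i. exp (- (real (\<kappa> i) + 1) * y))))"
      by (intro sum.cong refl arg_cong2[where f = "(*)"] laplace) simp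
    also have "\<dots> = (LINT k|V. (\<Sum>\<kappa>\<in>P. A \<kappa> * (\<Prod>i<n. LINT y|\<mu> k i. exp (- (real (\<kappa> i) + 1) * y))))"
    proof (subst Bochner_Integration.integral_sum)
      fix \<kappa>
      show "integrable V (\<lambda>k. A \<kappa> * (\<Prod>i<n. LINT y|\<mu> k i. exp (- (real (\<kappa> i) + 1) * y)))"
        by (intro integrable_mult_right V.integrable_const_bound[where B = 1] Vm)
          (unfold real_norm_def abs_prod, intro AE_I2 prod_le_1 conjI abs_ge_zero bexp)
    qed simp
    also have "\<dots> = (LINT k|V. (\<Prod>i<n. LINT y|\<mu> k i. p i m y))"
    proof -
      have "(LINT y|\<mu> k i. p i m y) =
          (\<Sum>c\<le>fst (Na i m). snd (Na i m) c * (LINT y|\<mu> k i. exp (- (real c + 1) * y)))" for k i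
        unfolding p_def by (subst Bochner_Integration.integral_sum) (use iexp in auto)
      then show ?thesis by (simp only: pw)
    qed
    finally show ?thesis .
  qed
  have fin: "\<bar>\<Prod>i<n. x i\<bar> \<le> (\<Prod>i<n. B i + 1)" if "\<And>i. i < n \<Longrightarrow> \<bar>x i\<bar> \<le> B i + 1" for x
    unfolding abs_prod by (intro prod_mono) (auto simp: that)
  have L: "(\<lambda>m. LINT \<omega>|M. (\<Prod>i<n. p i m (Y i \<omega>))) \<longlonglongrightarrow> (LINT \<omega>|M. (\<Prod>i<n. f i (Y i \<omega>)))"
  proof (rule integral_dominated_convergence[where w = "\<lambda>_. \<Prod>i<n. B i + 1"])
    show "(\<lambda>\<omega>. \<Prod>i<n. f i (Y i \<omega>)) \<in> borel_measurable M"
      by (intro borel_measurable_prod measurable_compose[OF Y fm]) auto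
    show "(\<lambda>\<omega>. \<Prod>i<n. p i m (Y i \<omega>)) \<in> borel_measurable M" for m
      by (intro borel_measurable_prod measurable_compose[OF Y pm]) auto
    show "AE \<omega> in M. (\<lambda>m. \<Prod>i<n. p i m (Y i \<omega>)) \<longlonglongrightarrow> (\<Prod>i<n. f i (Y i \<omega>))"
      by (intro AE_I2 tendsto_prod p_lim Y0) auto
    show "AE \<omega> in M. norm (\<Prod>i<n. p i m (Y i \<omega>)) \<le> (\<Prod>i<n. B i + 1)" for m
      unfolding real_norm_def by (intro AE_I2 fin pB Y0)
  qed simp
  have \<mu>_lim: "(\<lambda>m. LINT y|\<mu> k i. p i m y) \<longlonglongrightarrow> (LINT y|\<mu> k i. f i y)" if "i < n" for k i
  proof (rule integral_dominated_convergence[where w = "\<lambda>_. B i + 1"])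
    show "AE y in \<mu> k i. (\<lambda>m. p i m y) \<longlonglongrightarrow> f i y"
      using \<mu>0[of k i] by eventually_elim (rule p_lim[OF that])
    show "AE y in \<mu> k i. norm (p i m y) \<le> B i + 1" for m
      using \<mu>0[of k i] by eventually_elim (simp add: pB[OF that])
  qed (use fm[OF that] in auto)
  have \<mu>B: "\<bar>LINT y|\<mu> k i. p i m y\<bar> \<le> B i + 1" if "i < n" for k i m
  proof -
    have ae: "AE y in \<mu> k i. \<bar>p i m y\<bar> \<le> B i + 1"
      using \<mu>0[of k i] by eventually_elim (rule pB[OF that])
    then have i: "integrable (\<mu> k i) (p i m)" by (intro \<mu>.integrable_const_bound) auto
    have "\<bar>LINT y|\<mu> k i. p i m y\<bar> \<le> (LINT y|\<mu> k i. \<bar>p i m y\<bar>)" by (rule integral_abs_bound)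
    also have "\<dots> \<le> (LINT y|\<mu> k i. B i + 1)"
      by (rule integral_mono_AE[OF integrable_abs[OF i] _ ae]) simp
    finally show ?thesis by (simp add: \<mu>.prob_space)
  qed
  have R: "(\<lambda>m. LINT k|V. (\<Prod>i<n. LINT y|\<mu> k i. p i m y)) \<longlonglongrightarrow> (LINT k|V. (\<Prod>i<n. LINT y|\<mu> k i. f i y))"
  proof (rule integral_dominated_convergence[where w = "\<lambda>_. \<Prod>i<n. B i + 1"])
    show "AE k in V. (\<lambda>m. \<Prod>i<n. LINT y|\<mu> k i. p i m y) \<longlonglongrightarrow> (\<Prod>i<n. LINT y|\<mu> k i. f i y)"
      by (intro AE_I2 tendsto_prod \<mu>_lim) auto
    show "AE k in V. norm (\<Prod>i<n. LINT y|\<mu> k i. p i m y) \<le> (\<Prod>i<n. B i + 1)" for m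
      unfolding real_norm_def by (intro AE_I2 fin \<mu>B)
  qed (simp_all add: Vm)
  show ?thesis using LIMSEQ_unique[OF L] R eq by simp
qed

text \<open>The binomial series with its upper index negated. In this form the coefficients are
  visibly nonnegative for \<open>\<beta> > 0\<close>, the sign on which all mixtures below
  rest.\<close>

lemma negative_binomial_sums:
  fixes z \<beta> :: real
  assumes "\<bar>z\<bar> < 1"
  shows "(\<lambda>m. (\<beta> + real m - 1 gchoose m) * z ^ m) sums (1 - z) powr - \<beta>"
proof -
  have "(- \<beta> gchoose m) * (- z) ^ m = (\<beta> + real m - 1 gchoose m) * z ^ m" for m
  proof -
    have "(- 1) ^ m * (- 1) ^ m = (1 :: real)" by (simp add: power_mult_distrib[symmetric])
    then show ?thesis
      by (subst gbinomial_negated_upper, subst power_minus[of z])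
        (metis (no_types, lifting) add.commute diff_minus_eq_add mult.assoc mult.commute mult_1)
  qed
  then show ?thesis using gen_binomial_real[of "- z" "- \<beta>"] assms by simp
qed

lemma gchoose_neg_binomial_nonneg: "0 < (\<beta> :: real) \<Longrightarrow> 0 \<le> \<beta> + real m - 1 gchoose m"
  by (auto simp: gbinomial_prod_rev intro!: divide_nonneg_pos prod_nonneg)

text \<open>\<open>(d i / (d i + t i)) powr (\<alpha> + N)\<close> is the Laplace transform of a
  gamma variable of shape \<open>\<alpha> + N\<close> and rate 1 divided by \<open>d i\<close>; this
  explains the argument \<open>y / d i\<close>. The weights \<open>c\<close> form a finite measure
  on the naturals, which serves as mixing law.\<close>

lemma gamma_mixture_product:
  fixes Y :: "nat \<Rightarrow> 'w \<Rightarrow> real" and c :: "nat \<Rightarrow> ennreal" and N :: "nat \<Rightarrow> nat \<Rightarrow> nat"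
    and f :: "nat \<Rightarrow> real \<Rightarrow> real"
  assumes M: "prob_space M" and Y: "\<And>i. i < n \<Longrightarrow> Y i \<in> borel_measurable M"
    and Y0: "\<And>i \<omega>. i < n \<Longrightarrow> \<omega> \<in> space M \<Longrightarrow> 0 \<le> Y i \<omega>"
    and \<alpha>: "0 < \<alpha>" and d: "\<And>i. i < n \<Longrightarrow> 0 < d i"
    and c: "(\<integral>\<^sup>+k. c k \<partial>count_space UNIV) < \<infinity>"
    and laplace: "\<And>t. (\<And>i. i < n \<Longrightarrow> 0 < t i) \<Longrightarrow>
      ennreal (LINT \<omega>|M. exp (- (\<Sum>i<n. t i * Y i \<omega>))) =
      (\<integral>\<^sup>+k. c k * ennreal (\<Prod>i<n. (d i / (d i + t i)) powr (\<alpha> + real (N k i))) \<partial>count_space UNIV)"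
    and f: "\<And>i. i < n \<Longrightarrow> continuous_on UNIV (f i)" and f0: "\<And>i y. i < n \<Longrightarrow> 0 \<le> f i y"
    and R: "\<And>i y. i < n \<Longrightarrow> R \<le> y \<Longrightarrow> f i y = 0"
  shows "ennreal (LINT \<omega>|M. (\<Prod>i<n. f i (Y i \<omega>))) =
    (\<integral>\<^sup>+k. c k * ennreal (\<Prod>i<n. LINT y|gamma_law (\<alpha> + real (N k i)). f i (y / d i)) \<partial>count_space UNIV)"
proof -
  interpret M: prob_space M by fact
  define V where "V = density (count_space UNIV) c"
  \<comment> \<open>The default 1 keeps \<open>\<mu> k i\<close> on the half-line for every
    \<open>i\<close>, since \<open>d i\<close> is positive only for \<open>i < n\<close>.\<close>
  define \<mu> where "\<mu> k i = distr (gamma_law (\<alpha> + real (N k i))) borel (\<lambda>y. y / (if i < n then d i else 1))" for k i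
  have \<alpha>N: "0 < \<alpha> + real m" for m using \<alpha> by simp
  have V: "finite_measure V"
    using c by (intro finite_measureI) (simp add: V_def emeasure_density)
  have V_sets: "sets V = UNIV" by (simp add: V_def)
  have intV: "ennreal (LINT k|V. g k) = (\<integral>\<^sup>+k. c k * ennreal (g k) \<partial>count_space UNIV)"
    if "\<And>k. 0 \<le> g k" "\<And>k. g k \<le> B" for g B
  proof -
    interpret V: finite_measure V by fact
    have "integrable V g"
      by (rule V.integrable_const_bound[where B = B]) (use that in \<open>auto simp: measurable_def V_sets\<close>)
    then have "ennreal (LINT k|V. g k) = (\<integral>\<^sup>+k. ennreal (g k) \<partial>V)"
      using that by (simp add: nn_integral_eq_integral)
    also have "\<dots> = (\<integral>\<^sup>+k. c k * ennreal (g k) \<partial>count_space UNIV)"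
      unfolding V_def by (subst nn_integral_density) auto
    finally show ?thesis .
  qed
  have \<mu>_int: "(LINT y|\<mu> k i. g y) = (LINT y|gamma_law (\<alpha> + real (N k i)). g (y / d i))"
    if "i < n" "g \<in> borel_measurable borel" for k i and g :: "real \<Rightarrow> real"
    unfolding \<mu>_def using that by (subst integral_distr) auto
  have exp_int: "(LINT y|\<mu> k i. exp (- t i * y)) = (d i / (d i + t i)) powr (\<alpha> + real (N k i))"
    if "i < n" "0 < t i" for k i and t :: "nat \<Rightarrow> real"
  proof -
    have "(LINT y|\<mu> k i. exp (- t i * y)) = (LINT y|gamma_law (\<alpha> + real (N k i)). exp (- (t i / d i) * y))"
      using that by (subst \<mu>_int) (auto simp: mult.commute)
    also have "\<dots> = (1 + t i / d i) powr - (\<alpha> + real (N k i))"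
      using that d[OF that(1)] by (intro integral_gamma_law_exp \<alpha>N) (simp add: less_trans[of _ 0])
    also have "\<dots> = (inverse (1 + t i / d i)) powr (\<alpha> + real (N k i))"
      by (simp only: powr_minus inverse_powr)
    also have "inverse (1 + t i / d i) = d i / (d i + t i)"
      using that d[OF that(1)] by (simp add: field_simps)
    finally show ?thesis .
  qed
  have "(LINT \<omega>|M. (\<Prod>i<n. f i (Y i \<omega>))) = (LINT k|V. (\<Prod>i<n. LINT y|\<mu> k i. f i y))"
  proof (rule laplace_mixture_product[OF M V V_sets Y Y0, where R = R])
    show "prob_space (\<mu> k i)" for k i
      unfolding \<mu>_def by (rule prob_space.prob_space_distr[OF prob_space_gamma_law[OF \<alpha>N]]) simp
    show "AE y in \<mu> k i. 0 \<le> y" for k i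
    proof -
      have "AE y in gamma_law (\<alpha> + real (N k i)). 0 \<le> y / (if i < n then d i else 1)"
        using AE_gamma_law_pos by eventually_elim (use d[of i] in \<open>auto intro: divide_nonneg_pos\<close>)
      then show ?thesis unfolding \<mu>_def by (subst AE_distr_iff) auto
    qed
    show "(LINT \<omega>|M. exp (- (\<Sum>i<n. t i * Y i \<omega>))) = (LINT k|V. (\<Prod>i<n. LINT y|\<mu> k i. exp (- t i * y)))"
      if t: "\<And>i. i < n \<Longrightarrow> 0 < t i" for t
    proof -
      have 1: "(\<Prod>i<n. LINT y|\<mu> k i. exp (- t i * y)) = (\<Prod>i<n. (d i / (d i + t i)) powr (\<alpha> + real (N k i)))" for k
        using exp_int t by (intro prod.cong) auto
      have "ennreal (LINT k|V. (\<Prod>i<n. LINT y|\<mu> k i. exp (- t i * y))) =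
          (\<integral>\<^sup>+k. c k * ennreal (\<Prod>i<n. (d i / (d i + t i)) powr (\<alpha> + real (N k i))) \<partial>count_space UNIV)"
        unfolding 1
      proof (rule intV[of _ 1])
        have "(d i / (d i + t i)) powr (\<alpha> + real (N k i)) \<le> 1" if "i < n" for i k
          using t[OF that] d[OF that] \<alpha>N[of "N k i"] by (intro powr_le1) (auto simp: divide_le_eq_1)
        then show "(\<Prod>i<n. (d i / (d i + t i)) powr (\<alpha> + real (N k i))) \<le> 1" for k
          by (intro prod_le_1) auto
      qed (auto intro: prod_nonneg)
      also have "\<dots> = ennreal (LINT \<omega>|M. exp (- (\<Sum>i<n. t i * Y i \<omega>)))" using laplace[OF t] by simp
      finally show ?thesis
        by (subst (asm) ennreal_inj) (auto intro!: integral_nonneg_AE AE_I2 prod_nonneg)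
    qed
  qed (use f R in \<open>auto simp: \<mu>_def\<close>)
  moreover have "(\<Prod>i<n. LINT y|\<mu> k i. f i y) = (\<Prod>i<n. LINT y|gamma_law (\<alpha> + real (N k i)). f i (y / d i))" for k
    by (intro prod.cong refl \<mu>_int borel_measurable_continuous_onI f) auto
  ultimately have eq: "(LINT \<omega>|M. (\<Prod>i<n. f i (Y i \<omega>))) =
      (LINT k|V. (\<Prod>i<n. LINT y|gamma_law (\<alpha> + real (N k i)). f i (y / d i)))" by simp
  have "\<exists>B. \<forall>y\<ge>0. f i y \<le> B" if "i < n" for i
  proof -
    have "bounded (f i ` {0..max 0 R})"
      by (intro compact_imp_bounded compact_continuous_image continuous_on_subset[OF f[OF that]]) auto
    then obtain B where B: "\<And>y. y \<in> {0..max 0 R} \<Longrightarrow> \<bar>f i y\<bar> \<le> B"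
      unfolding bounded_iff by (metis image_eqI real_norm_def)
    have "f i y \<le> B" if "0 \<le> y" for y
      using B[of y] B[of 0] R[OF \<open>i < n\<close>, of y] that by (cases "y \<le> max 0 R") auto
    then show ?thesis by blast
  qed
  then obtain B where B: "\<And>i y. i < n \<Longrightarrow> 0 \<le> y \<Longrightarrow> f i y \<le> B i" by metis
  have "(LINT y|gamma_law (\<alpha> + real (N k i)). f i (y / d i)) \<le> B i" if "i < n" for k i
  proof -
    interpret G: prob_space "gamma_law (\<alpha> + real (N k i))" by (rule prob_space_gamma_law[OF \<alpha>N])
    have ae: "AE y in gamma_law (\<alpha> + real (N k i)). f i (y / d i) \<le> B i"
      using AE_gamma_law_pos by eventually_elim (use d[OF that] in \<open>auto intro!: B[OF that]\<close>)
    have "integrable (gamma_law (\<alpha> + real (N k i))) (\<lambda>y. f i (y / d i))"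
      by (rule G.integrable_const_bound[where B = "B i"])
        (use ae f0[OF that] borel_measurable_continuous_onI[OF f[OF that]] in auto)
    then have "(LINT y|gamma_law (\<alpha> + real (N k i)). f i (y / d i)) \<le> (LINT y|gamma_law (\<alpha> + real (N k i)). B i)"
      using ae by (intro integral_mono_AE) auto
    then show ?thesis using G.prob_space by simp
  qed
  then have "(\<Prod>i<n. LINT y|gamma_law (\<alpha> + real (N k i)). f i (y / d i)) \<le> (\<Prod>i<n. B i)" for k
    using f0 by (intro prod_mono conjI integral_nonneg_AE AE_I2) auto
  then show ?thesis unfolding eq
    using f0 by (intro intV) (auto intro!: prod_nonneg integral_nonneg_AE AE_I2)
qed

text \<open>Exponentials of positive multiples of \<open>Y\<close> are not admissible test
  functions, so they are cut off first; Fatou's lemma then removes the cutoff. An inequality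
  results, which is all that Markov's inequality asks for.\<close>

lemma gamma_mixture_exp_moment:
  fixes Y :: "nat \<Rightarrow> 'w \<Rightarrow> real" and c :: "nat \<Rightarrow> ennreal" and N :: "nat \<Rightarrow> nat \<Rightarrow> nat"
  assumes M: "prob_space M" and Y: "\<And>i. i < n \<Longrightarrow> Y i \<in> borel_measurable M"
    and Y0: "\<And>i \<omega>. i < n \<Longrightarrow> \<omega> \<in> space M \<Longrightarrow> 0 \<le> Y i \<omega>"
    and \<alpha>: "0 < \<alpha>" and d: "\<And>i. i < n \<Longrightarrow> 0 < d i"
    and c: "(\<integral>\<^sup>+k. c k \<partial>count_space UNIV) < \<infinity>"
    and laplace: "\<And>t. (\<And>i. i < n \<Longrightarrow> 0 < t i) \<Longrightarrow>
      ennreal (LINT \<omega>|M. exp (- (\<Sum>i<n. t i * Y i \<omega>))) =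
      (\<integral>\<^sup>+k. c k * ennreal (\<Prod>i<n. (d i / (d i + t i)) powr (\<alpha> + real (N k i))) \<partial>count_space UNIV)"
    and \<theta>: "\<And>i. i < n \<Longrightarrow> \<theta> i < d i"
  shows "(\<integral>\<^sup>+\<omega>. ennreal (exp (\<Sum>i<n. \<theta> i * Y i \<omega>)) \<partial>M) \<le>
    (\<integral>\<^sup>+k. c k * ennreal (\<Prod>i<n. (1 - \<theta> i / d i) powr - (\<alpha> + real (N k i))) \<partial>count_space UNIV)"
    (is "_ \<le> ?B")
proof -
  interpret M: prob_space M by fact
  have \<alpha>N: "0 < \<alpha> + real m" for m using \<alpha> by simp
  \<comment> \<open>A continuous cutoff: equal to the exponential up to \<open>m - 1\<close>, zero
    beyond \<open>m\<close>, and below the exponential everywhere.\<close>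
  define f where "f m i y = exp (\<theta> i * y) * max 0 (min 1 (real m - y))" for m i y
  have fm [measurable]: "f m i \<in> borel_measurable borel" for m i unfolding f_def by measurable
  have f0: "0 \<le> f m i y" for m i y by (simp add: f_def)
  have f_le: "f m i y \<le> exp (\<theta> i * y)" for m i y
    unfolding f_def using mult_left_mono[of "max 0 (min 1 (real m - y))" 1 "exp (\<theta> i * y)"] by simp
  have bound: "(\<integral>\<^sup>+\<omega>. ennreal (\<Prod>i<n. f m i (Y i \<omega>)) \<partial>M) \<le> ?B" for m
  proof -
    have B: "f m i y \<le> exp (\<bar>\<theta> i\<bar> * real m)" if "0 \<le> y" for i y
    proof (cases "y \<le> real m")
      case True
      have "\<theta> i * y \<le> \<bar>\<theta> i\<bar> * real m"
        using True that by (intro mult_mono) auto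
      then show ?thesis using f_le[of m i y] by (meson exp_le_cancel_iff order_trans)
    qed (simp add: f_def)
    have "integrable M (\<lambda>\<omega>. \<Prod>i<n. f m i (Y i \<omega>))"
    proof (rule M.integrable_const_bound[where B = "\<Prod>i<n. exp (\<bar>\<theta> i\<bar> * real m)"])
      show "AE \<omega> in M. norm (\<Prod>i<n. f m i (Y i \<omega>)) \<le> (\<Prod>i<n. exp (\<bar>\<theta> i\<bar> * real m))"
        unfolding real_norm_def abs_prod
        by (intro AE_I2 prod_mono) (auto simp: abs_of_nonneg f0 B Y0)
    qed (intro borel_measurable_prod measurable_compose[OF Y fm]; simp)
    then have "(\<integral>\<^sup>+\<omega>. ennreal (\<Prod>i<n. f m i (Y i \<omega>)) \<partial>M) = ennreal (LINT \<omega>|M. (\<Prod>i<n. f m i (Y i \<omega>)))"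
      by (intro nn_integral_eq_integral) (auto intro!: prod_nonneg f0)
    also have "\<dots> = (\<integral>\<^sup>+k. c k * ennreal (\<Prod>i<n. LINT y|gamma_law (\<alpha> + real (N k i)). f m i (y / d i)) \<partial>count_space UNIV)"
      by (rule gamma_mixture_product[OF M Y Y0 \<alpha> d c laplace, where R = "real m"])
        (auto simp: f_def intro!: continuous_intros)
    also have "\<dots> \<le> ?B"
    proof (intro nn_integral_mono mult_left_mono ennreal_leI prod_mono conjI)
      fix k i assume "i \<in> {..<n}"
      then have i: "i < n" by simp
      interpret G: prob_space "gamma_law (\<alpha> + real (N k i))" by (rule prob_space_gamma_law[OF \<alpha>N])
      show "0 \<le> (LINT y|gamma_law (\<alpha> + real (N k i)). f m i (y / d i))"
        by (intro integral_nonneg_AE AE_I2 f0)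
      have "(\<integral>\<^sup>+y. ennreal (exp (- (- \<theta> i / d i) * y)) \<partial>gamma_law (\<alpha> + real (N k i))) =
          ennreal ((1 + (- \<theta> i / d i)) powr - (\<alpha> + real (N k i)))"
        using \<theta>[OF i] d[OF i] by (intro nn_integral_gamma_law_exp \<alpha>N) (simp add: divide_less_eq)
      then have "has_bochner_integral (gamma_law (\<alpha> + real (N k i))) (\<lambda>y. exp (- (- \<theta> i / d i) * y))
          ((1 + (- \<theta> i / d i)) powr - (\<alpha> + real (N k i)))"
        by (intro has_bochner_integral_nn_integral) auto
      then have I: "integrable (gamma_law (\<alpha> + real (N k i))) (\<lambda>y. exp (\<theta> i * (y / d i)))"
        "(LINT y|gamma_law (\<alpha> + real (N k i)). exp (\<theta> i * (y / d i))) = (1 - \<theta> i / d i) powr - (\<alpha> + real (N k i))"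
        by (auto simp: has_bochner_integral_iff)
      have "(LINT y|gamma_law (\<alpha> + real (N k i)). f m i (y / d i)) \<le>
          (LINT y|gamma_law (\<alpha> + real (N k i)). exp (\<theta> i * (y / d i)))"
        by (intro integral_mono Bochner_Integration.integrable_bound[OF I(1)] I(1) AE_I2 f_le)
          (use f_le[of m i "y / d i" for y] f0 in auto)
      then show "(LINT y|gamma_law (\<alpha> + real (N k i)). f m i (y / d i)) \<le> (1 - \<theta> i / d i) powr - (\<alpha> + real (N k i))"
        using I(2) by simp
    qed simp
    finally show ?thesis .
  qed
  have "(\<integral>\<^sup>+\<omega>. ennreal (exp (\<Sum>i<n. \<theta> i * Y i \<omega>)) \<partial>M) =
      (\<integral>\<^sup>+\<omega>. liminf (\<lambda>m. ennreal (\<Prod>i<n. f m i (Y i \<omega>))) \<partial>M)"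
  proof (intro nn_integral_cong)
    fix \<omega>
    have ev: "eventually (\<lambda>m. f m i (Y i \<omega>) = exp (\<theta> i * Y i \<omega>)) sequentially" for i
      using eventually_ge_at_top[of "nat \<lceil>Y i \<omega> + 1\<rceil>"]
    proof eventually_elim
      case (elim m)
      then have "Y i \<omega> + 1 \<le> real m" by linarith
      then show ?case by (simp add: f_def)
    qed
    have "eventually (\<lambda>m. \<forall>i\<in>{..<n}. f m i (Y i \<omega>) = exp (\<theta> i * Y i \<omega>)) sequentially"
      using ev by (subst eventually_ball_finite_distrib) auto
    then have "eventually (\<lambda>m. ennreal (\<Prod>i<n. f m i (Y i \<omega>)) = ennreal (exp (\<Sum>i<n. \<theta> i * Y i \<omega>))) sequentially"
      by eventually_elim (simp add: exp_sum)
    then have "(\<lambda>m. ennreal (\<Prod>i<n. f m i (Y i \<omega>))) \<longlonglongrightarrow> ennreal (exp (\<Sum>i<n. \<theta> i * Y i \<omega>))"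
      by (rule tendsto_eventually)
    then show "ennreal (exp (\<Sum>i<n. \<theta> i * Y i \<omega>)) = liminf (\<lambda>m. ennreal (\<Prod>i<n. f m i (Y i \<omega>)))"
      by (simp add: lim_imp_Liminf)
  qed
  also have "\<dots> \<le> liminf (\<lambda>m. \<integral>\<^sup>+\<omega>. ennreal (\<Prod>i<n. f m i (Y i \<omega>)) \<partial>M)"
    by (intro nn_integral_liminf measurable_compose[OF _ measurable_ennreal] borel_measurable_prod measurable_compose[OF Y fm]) auto
  also have "\<dots> \<le> liminf (\<lambda>m :: nat. ?B)"
    by (intro Liminf_mono always_eventually allI bound)
  finally show ?thesis by (simp add: Liminf_const)
qed

text \<open>The degenerate mixture in one variable: all weight sits at \<open>k = 0\<close>, with
  shape exactly \<open>\<alpha>\<close> and rate \<open>1 / a\<close>.\<close>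

lemma gamma_exp_moment:
  fixes X :: "'w \<Rightarrow> real"
  assumes M: "prob_space M" and X: "X \<in> borel_measurable M" and X0: "\<And>\<omega>. \<omega> \<in> space M \<Longrightarrow> 0 \<le> X \<omega>"
    and \<alpha>: "0 < \<alpha>" and a: "0 < a"
    and laplace: "\<And>t. 0 < t \<Longrightarrow> (LINT \<omega>|M. exp (- (t * X \<omega>))) = (1 + a * t) powr - \<alpha>"
    and \<theta>: "a * \<theta> < 1"
  shows "(\<integral>\<^sup>+\<omega>. ennreal (exp (\<theta> * X \<omega>)) \<partial>M) \<le> ennreal ((1 - a * \<theta>) powr - \<alpha>)"
proof -
  have one: "(\<integral>\<^sup>+k. (if k = 0 then 1 else 0) * ennreal z \<partial>count_space (UNIV :: nat set)) = ennreal z" for z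
  proof -
    have "(\<integral>\<^sup>+k. (if k = 0 then 1 else 0) * ennreal z \<partial>count_space (UNIV :: nat set)) =
        (\<integral>\<^sup>+k. ennreal z * indicator {0} k \<partial>count_space (UNIV :: nat set))"
      by (intro nn_integral_cong) auto
    then show ?thesis by (simp add: nn_integral_cmult_indicator)
  qed
  have "(\<integral>\<^sup>+\<omega>. ennreal (exp (\<Sum>i<(1::nat). \<theta> * X \<omega>)) \<partial>M) \<le>
    (\<integral>\<^sup>+k. (if k = 0 then 1 else 0) * ennreal (\<Prod>i<(1::nat). (1 - \<theta> / (1 / a)) powr - (\<alpha> + real 0)) \<partial>count_space (UNIV :: nat set))"
  proof (rule gamma_mixture_exp_moment[OF M _ _ \<alpha>, where N = "\<lambda>_ _. 0"])
    show "ennreal (LINT \<omega>|M. exp (- (\<Sum>i<(1::nat). t i * X \<omega>))) =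
        (\<integral>\<^sup>+k. (if k = 0 then 1 else 0) * ennreal (\<Prod>i<(1::nat). (1 / a / (1 / a + t i)) powr (\<alpha> + real 0)) \<partial>count_space (UNIV :: nat set))"
      if t: "\<And>i. i < 1 \<Longrightarrow> 0 < t i" for t
    proof -
      have "(1 + a * t 0) powr - \<alpha> = inverse (1 + a * t 0) powr \<alpha>" by (simp add: powr_minus inverse_powr)
      also have "inverse (1 + a * t 0) = 1 / a / (1 / a + t 0)" using a by (simp add: field_simps)
      finally show ?thesis using laplace[of "t 0"] t[of 0] by (subst one) simp
    qed
    show "(\<integral>\<^sup>+k. (if k = 0 then 1 else 0) \<partial>count_space (UNIV :: nat set)) < \<infinity>" using one[of 1] by simp
  qed (use X X0 a \<theta> in \<open>auto simp: field_simps\<close>)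
  then show ?thesis by (subst (asm) one) (simp add: mult.commute)
qed

text \<open>The bivariate Laplace transform is a negative binomial mixture of products of gamma
  Laplace transforms, which extends it to exponents of either sign.\<close>

lemma bivariate_gamma_exp_moment:
  fixes X Y :: "'w \<Rightarrow> real"
  assumes M: "prob_space M" and X: "X \<in> borel_measurable M" and X0: "\<And>\<omega>. \<omega> \<in> space M \<Longrightarrow> 0 \<le> X \<omega>"
    and Y: "Y \<in> borel_measurable M" and Y0: "\<And>\<omega>. \<omega> \<in> space M \<Longrightarrow> 0 \<le> Y \<omega>"
    and \<alpha>: "0 < \<alpha>" and a: "0 < a" and b: "0 < b" and \<rho>: "0 \<le> \<rho>" "\<rho> < a * b"
    and laplace: "\<And>t u. 0 < t \<Longrightarrow> 0 < u \<Longrightarrow>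
      (LINT \<omega>|M. exp (- (t * X \<omega> + u * Y \<omega>))) = ((1 + a * t) * (1 + b * u) - \<rho> * t * u) powr - \<alpha>"
    and \<theta>: "0 < 1 - (a - b) * \<theta> - (a * b - \<rho>) * \<theta>\<^sup>2"
  shows "(\<integral>\<^sup>+\<omega>. ennreal (exp (\<theta> * (X \<omega> - Y \<omega>))) \<partial>M) \<le>
    ennreal ((1 - (a - b) * \<theta> - (a * b - \<rho>) * \<theta>\<^sup>2) powr - \<alpha>)"
proof -
  \<comment> \<open>\<open>D\<close> is the determinant of the two-point kernel, with
    \<open>\<rho>\<close> the product of its off-diagonal entries; \<open>r\<close> is the success
    parameter of the negative binomial mixing law.\<close>
  define D where "D = a * b - \<rho>"
  define r where "r = \<rho> / (a * b)"
  have D: "0 < D" using \<rho> by (simp add: D_def)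
  have r: "0 \<le> r" "r < 1" using \<rho> a b by (auto simp: r_def divide_less_eq)
  have rD: "(1 - r) * (a * b) = D" using a b by (simp add: r_def D_def field_simps)
  define c where "c k = (1 - r) powr \<alpha> * (\<alpha> + real k - 1 gchoose k) * r ^ k" for k
  have c0: "0 \<le> c k" for k
    using r gchoose_neg_binomial_nonneg[OF \<alpha>, of k] by (simp add: c_def)
  have csum: "(\<integral>\<^sup>+k. ennreal (c k) * ennreal (z powr (\<alpha> + real k)) \<partial>count_space UNIV) =
      ennreal (((1 / z - r) / (1 - r)) powr - \<alpha>)" if z: "0 < z" "z * r < 1" for z
  proof -
    have "(\<lambda>k. (1 - r) powr \<alpha> * z powr \<alpha> * ((\<alpha> + real k - 1 gchoose k) * (z * r) ^ k)) sums
        ((1 - r) powr \<alpha> * z powr \<alpha> * (1 - z * r) powr - \<alpha>)"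
      by (intro sums_mult negative_binomial_sums) (use z r in auto)
    moreover have "(1 - r) powr \<alpha> * z powr \<alpha> * ((\<alpha> + real k - 1 gchoose k) * (z * r) ^ k) =
        c k * z powr (\<alpha> + real k)" for k
      using z by (simp add: c_def powr_add powr_realpow power_mult_distrib)
    moreover have "(1 - r) powr \<alpha> * z powr \<alpha> * (1 - z * r) powr - \<alpha> = ((1 / z - r) / (1 - r)) powr - \<alpha>"
    proof -
      define w where "w = 1 / z - r"
      have w: "0 < w" "1 - z * r = z * w" using z by (simp_all add: w_def field_simps)
      have "0 < z powr \<alpha>" using z by simp
      then show ?thesis
        unfolding w(2) w_def[symmetric] using z w(1) r by (simp add: powr_mult powr_divide powr_minus field_simps)
    qed
    ultimately have "(\<lambda>k. c k * z powr (\<alpha> + real k)) sums (((1 / z - r) / (1 - r)) powr - \<alpha>)" by simp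
    then have "(\<Sum>k. ennreal (c k * z powr (\<alpha> + real k))) = ennreal (((1 / z - r) / (1 - r)) powr - \<alpha>)"
      by (rule suminf_ennreal_eq[rotated]) (rule mult_nonneg_nonneg[OF c0 powr_ge_zero])
    then have "ennreal (((1 / z - r) / (1 - r)) powr - \<alpha>) = (\<Sum>k. ennreal (c k * z powr (\<alpha> + real k)))"
      by (rule sym)
    also have "\<dots> = (\<integral>\<^sup>+k. ennreal (c k) * ennreal (z powr (\<alpha> + real k)) \<partial>count_space UNIV)"
      by (simp add: nn_integral_count_space_nat ennreal_mult c0)
    finally show ?thesis by simp
  qed
  \<comment> \<open>The rates are the diagonal entries of the inverse of the two-point
    kernel.\<close>
  define d where "d i = (if i = 0 then b / D else a / D)" for i :: nat
  have d: "0 < d i" for i using a b D by (simp add: d_def)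
  define \<theta>' where "\<theta>' i = (if i = 0 then \<theta> else - \<theta>)" for i :: nat
  have Q: "((1 - \<theta> / d 0) * (1 + \<theta> / d 1) - r) / (1 - r) = 1 - (a - b) * \<theta> - D * \<theta>\<^sup>2"
  proof -
    have "(1 - \<theta> / d 0) * (1 + \<theta> / d 1) - r = (1 - r) * (1 - (a - b) * \<theta> - D * \<theta>\<^sup>2)"
      using a b D unfolding d_def rD[symmetric] by (simp add: field_simps power2_eq_square)
    then show ?thesis using r by simp
  qed
  then have "0 < ((1 - \<theta> / d 0) * (1 + \<theta> / d 1) - r) / (1 - r)" using \<theta> by (simp add: D_def)
  then have Q0: "r < (1 - \<theta> / d 0) * (1 + \<theta> / d 1)" using r by (simp add: zero_less_divide_iff)
  then have Q1: "0 < (1 - \<theta> / d 0) * (1 + \<theta> / d 1)" using r by simp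
  \<comment> \<open>The product of the two factors is positive, and whatever the sign of
    \<open>\<theta>\<close> one of them is at least 1; hence both are positive.\<close>
  have pos: "0 < 1 - \<theta> / d 0" "0 < 1 + \<theta> / d 1"
  proof -
    have "0 < 1 - \<theta> / d 0 \<or> 0 < 1 + \<theta> / d 1"
      using d[of 0] d[of 1] by (cases "0 \<le> \<theta>") (auto simp: add_pos_nonneg divide_nonpos_pos intro: order.strict_trans2[of _ 0])
    then show "0 < 1 - \<theta> / d 0" "0 < 1 + \<theta> / d 1" using Q1 by (auto simp: zero_less_mult_iff)
  qed
  have two: "(\<Prod>i<2. g i) = g 0 * g 1" "(\<Sum>i<2. g i) = g 0 + g 1" for g :: "nat \<Rightarrow> real"
    by (simp_all add: numeral_2_eq_2)
  define Z where "Z i = (if i = 0 then X else Y)" for i :: nat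
  have "(\<integral>\<^sup>+\<omega>. ennreal (exp (\<Sum>i<2. \<theta>' i * Z i \<omega>)) \<partial>M) \<le>
    (\<integral>\<^sup>+k. ennreal (c k) * ennreal (\<Prod>i<2. (1 - \<theta>' i / d i) powr - (\<alpha> + real k)) \<partial>count_space UNIV)"
  proof (rule gamma_mixture_exp_moment[OF M _ _ \<alpha>, where N = "\<lambda>k _. k"])
    show "ennreal (LINT \<omega>|M. exp (- (\<Sum>i<2. t i * Z i \<omega>))) =
        (\<integral>\<^sup>+k. ennreal (c k) * ennreal (\<Prod>i<2. (d i / (d i + t i)) powr (\<alpha> + real k)) \<partial>count_space UNIV)"
      if t: "\<And>i. i < 2 \<Longrightarrow> 0 < t i" for t
    proof -
      have t: "0 < t 0" "0 < t 1" using t by auto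
      define z where "z = (d 0 / (d 0 + t 0)) * (d 1 / (d 1 + t 1))"
      have "0 < d i / (d i + t i)" "d i / (d i + t i) < 1" if "0 < t i" for i
        using d[of i] that by simp_all
      note q = this
      have z: "0 < z" unfolding z_def by (rule mult_pos_pos[OF q(1)[OF t(1)] q(1)[OF t(2)]])
      have "z < 1 * 1" unfolding z_def
        by (rule mult_strict_mono) (use q t in \<open>auto intro: less_imp_le\<close>)
      with z have z: "0 < z" "z < 1" by auto
      have zr: "z * r < 1" using z r mult_strict_mono[of z 1 r 1] by simp
      have "(1 + a * t 0) * (1 + b * t 1) - \<rho> * t 0 * t 1 = (1 / z - r) / (1 - r)"
      proof -
        have "1 / z = (1 + t 0 / d 0) * (1 + t 1 / d 1)"
          using d[of 0] d[of 1] t by (simp add: z_def field_simps)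
        also have "\<dots> - r = (1 - r) * ((1 + a * t 0) * (1 + b * t 1) - \<rho> * t 0 * t 1)"
        proof -
          have 1: "t 0 / d 0 = (1 - r) * (a * t 0)" and 2: "t 1 / d 1 = (1 - r) * (b * t 1)"
            using a b D unfolding d_def rD[symmetric] by simp_all
          have 3: "\<rho> = r * (a * b)" using a b by (simp add: r_def)
          show ?thesis unfolding 1 2 3 by (simp add: algebra_simps)
        qed
        finally show ?thesis using r by simp
      qed
      moreover have "(\<Prod>i<2. (d i / (d i + t i)) powr (\<alpha> + real k)) = z powr (\<alpha> + real k)" for k
        unfolding two z_def using d t by (simp add: powr_mult[symmetric] less_imp_le)
      ultimately show ?thesis using laplace[OF t] csum[OF z(1) zr] by (simp add: two Z_def)
    qed
    show "(\<integral>\<^sup>+k. ennreal (c k) \<partial>count_space UNIV) < \<infinity>" using csum[of 1] r by simp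
    show "\<theta>' i < d i" if "i < 2" for i
      using that pos d[of 0] d[of 1] by (auto simp: \<theta>'_def less_2_cases_iff field_simps)
  qed (use X X0 Y Y0 d in \<open>auto simp: Z_def\<close>)
  also have "(\<integral>\<^sup>+k. ennreal (c k) * ennreal (\<Prod>i<2. (1 - \<theta>' i / d i) powr - (\<alpha> + real k)) \<partial>count_space UNIV) =
      (\<integral>\<^sup>+k. ennreal (c k) * ennreal ((1 / ((1 - \<theta> / d 0) * (1 + \<theta> / d 1))) powr (\<alpha> + real k)) \<partial>count_space UNIV)"
  proof -
    have "(\<Prod>i<2. (1 - \<theta>' i / d i) powr - (\<alpha> + real k)) =
      (1 / ((1 - \<theta> / d 0) * (1 + \<theta> / d 1))) powr (\<alpha> + real k)" for k
    proof -
      have "x powr - e * y powr - e = (1 / (x * y)) powr e" if "0 < x" "0 < y" for x y e :: real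
        using that by (simp add: powr_minus powr_mult powr_divide field_simps)
      from this[OF pos] show ?thesis unfolding two by (simp add: \<theta>'_def del: minus_add_distrib)
    qed
    then show ?thesis by simp
  qed
  also have "(\<integral>\<^sup>+k. ennreal (c k) * ennreal ((1 / ((1 - \<theta> / d 0) * (1 + \<theta> / d 1))) powr (\<alpha> + real k)) \<partial>count_space UNIV) =
      ennreal ((1 - (a - b) * \<theta> - D * \<theta>\<^sup>2) powr - \<alpha>)"
    using Q0 Q1 Q by (subst csum) (auto simp: divide_less_eq)
  finally show ?thesis by (simp add: two \<theta>'_def Z_def D_def algebra_simps)
qed

subsection \<open>Kernels whose inverse is an M-matrix\<close>

lemma det_scale_rows:
  fixes a :: "nat \<Rightarrow> nat \<Rightarrow> real"
  shows "Determinant.det (Matrix.mat n n (\<lambda>(i, j). r i * a i j)) =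
    (\<Prod>i<n. r i) * Determinant.det (Matrix.mat n n (\<lambda>(i, j). a i j))"
  by (auto simp: det_def prod.distrib sum_distrib_left atLeast0LessThan mult_ac intro!: sum.cong)

lemma det_conjugate_diag:
  fixes a :: "nat \<Rightarrow> nat \<Rightarrow> real"
  assumes "\<And>i. i < n \<Longrightarrow> r i \<noteq> 0"
  shows "Determinant.det (Matrix.mat n n (\<lambda>(i, j). r j / r i * a i j)) =
    Determinant.det (Matrix.mat n n (\<lambda>(i, j). a i j))"
proof -
  have *: "(\<Prod>i = 0..<n. r (p i) * a i (p i) / r i) = (\<Prod>i = 0..<n. a i (p i))"
    if p: "p permutes {0..<n}" for p
  proof -
    have "(\<Prod>i = 0..<n. r (p i)) = (\<Prod>i = 0..<n. r i)"
      using prod.permute[OF p, of r] by (simp add: comp_def)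
    moreover have "(\<Prod>i = 0..<n. r i) \<noteq> 0" using assms by simp
    ultimately show ?thesis by (simp add: prod.distrib prod_dividef)
  qed
  show ?thesis by (auto simp: det_def * intro!: sum.cong)
qed

text \<open>Block elimination with the last index as pivot, so that an induction on the dimension
  keeps the indices below \<open>m\<close> unchanged.\<close>

lemma det_schur_complement:
  fixes a :: "nat \<Rightarrow> nat \<Rightarrow> real"
  assumes "a m m \<noteq> 0"
  shows "Determinant.det (Matrix.mat (Suc m) (Suc m) (\<lambda>(i, j). a i j)) =
    a m m * Determinant.det (Matrix.mat m m (\<lambda>(i, j). a i j - a i m * a m j / a m m))"
proof -
  define S where "S = Matrix.mat m m (\<lambda>(i, j). a i j - a i m * a m j / a m m)"
  define B where "B = Matrix.mat m 1 (\<lambda>(i, j). a i m)"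
  define C where "C = Matrix.mat 1 m (\<lambda>(i, j). a m j / a m m)"
  define D where "D = Matrix.mat 1 1 (\<lambda>(i, j). a m m)"
  have c: "S \<in> carrier_mat m m" "B \<in> carrier_mat m 1" "C \<in> carrier_mat 1 m" "D \<in> carrier_mat 1 1"
    by (auto simp: S_def B_def C_def D_def)
  have "four_block_mat S B (0\<^sub>m 1 m) D * four_block_mat (1\<^sub>m m) (0\<^sub>m m 1) C (1\<^sub>m 1) =
      four_block_mat (S * 1\<^sub>m m + B * C) (S * 0\<^sub>m m 1 + B * 1\<^sub>m 1) (0\<^sub>m 1 m * 1\<^sub>m m + D * C) (0\<^sub>m 1 m * 0\<^sub>m m 1 + D * 1\<^sub>m 1)"
    by (rule mult_four_block_mat) (use c in auto)
  also have "\<dots> = Matrix.mat (Suc m) (Suc m) (\<lambda>(i, j). a i j)"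
    using assms
    by (intro eq_matI) (auto simp: S_def B_def C_def D_def scalar_prod_def less_Suc_eq)
  finally have "Determinant.det (Matrix.mat (Suc m) (Suc m) (\<lambda>(i, j). a i j)) =
      Determinant.det (four_block_mat S B (0\<^sub>m 1 m) D * four_block_mat (1\<^sub>m m) (0\<^sub>m m 1) C (1\<^sub>m 1))" by simp
  also have "\<dots> = Determinant.det (four_block_mat S B (0\<^sub>m 1 m) D) *
      Determinant.det (four_block_mat (1\<^sub>m m) (0\<^sub>m m 1) C (1\<^sub>m 1))"
    by (rule det_mult[of _ "m + 1"]) (use c in auto)
  also have "Determinant.det (four_block_mat S B (0\<^sub>m 1 m) D) = Determinant.det S * Determinant.det D"
    by (rule det_four_block_mat_lower_left_zero[of _ m _ 1]) (use c in auto)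
  also have "Determinant.det (four_block_mat (1\<^sub>m m) (0\<^sub>m m 1) C (1\<^sub>m 1)) = 1"
    by (subst det_four_block_mat_upper_right_zero[of _ m _ 1]) (use c in auto)
  also have "Determinant.det D = a m m" unfolding D_def by (subst det_single) auto
  finally show ?thesis by (simp add: S_def)
qed

section \<open>Power series with nonnegative coefficients on the unit cube\<close>

definition unit_box :: "nat \<Rightarrow> (nat \<Rightarrow> real) set" where
  "unit_box n = {q. \<forall>i<n. 0 \<le> q i \<and> q i \<le> 1}"

text \<open>A power series in \<open>n\<close> variables, its monomials listed by exponent vectors
  \<open>N k\<close>, possibly with repetitions. Coefficients in \<open>ennreal\<close> reduce sums
  and products of series to Tonelli's theorem; their finiteness comes with the real value of
  \<open>\<Psi>\<close>. The variables will be \<open>q i = d i / (d i + t i)\<close>, so monomials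
  become gamma transforms of integer shape.\<close>

definition pos_series :: "nat \<Rightarrow> ((nat \<Rightarrow> real) \<Rightarrow> real) \<Rightarrow> bool" where
  "pos_series n \<Psi> \<longleftrightarrow> (\<exists>(c :: nat \<Rightarrow> ennreal) (N :: nat \<Rightarrow> nat \<Rightarrow> nat). \<forall>q\<in>unit_box n.
     0 \<le> \<Psi> q \<and> ennreal (\<Psi> q) = (\<integral>\<^sup>+k. c k * ennreal (\<Prod>i<n. q i ^ N k i) \<partial>count_space UNIV))"

lemma pos_series_nonneg: "pos_series n \<Psi> \<Longrightarrow> q \<in> unit_box n \<Longrightarrow> 0 \<le> \<Psi> q"
  by (auto simp: pos_series_def)

lemma ones_in_unit_box: "(\<lambda>_. 1) \<in> unit_box n"
  by (simp add: unit_box_def)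

lemma pos_series_mono_one:
  assumes "pos_series n \<Psi>" "q \<in> unit_box n"
  shows "\<Psi> q \<le> \<Psi> (\<lambda>_. 1)"
proof -
  obtain c :: "nat \<Rightarrow> ennreal" and N where c: "\<And>q. q \<in> unit_box n \<Longrightarrow> 0 \<le> \<Psi> q \<and>
      ennreal (\<Psi> q) = (\<integral>\<^sup>+k. c k * ennreal (\<Prod>i<n. q i ^ N k i) \<partial>count_space UNIV)"
    using assms(1) unfolding pos_series_def by blast
  have "ennreal (\<Psi> q) \<le> ennreal (\<Psi> (\<lambda>_. 1))"
    using c[OF assms(2)] c[OF ones_in_unit_box] assms(2)
    by (auto intro!: nn_integral_mono mult_left_mono prod_le_1 power_le_one simp: unit_box_def simp flip: ennreal_1 intro!: ennreal_leI)
  then show ?thesis using c[OF ones_in_unit_box] by (metis ennreal_le_iff)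
qed

text \<open>Frees the index set: products and countable sums of series are naturally indexed by
  pairs. Coefficients outside the range of \<open>to_nat\<close> are set to 0.\<close>

lemma pos_seriesI:
  fixes c :: "'i :: countable \<Rightarrow> ennreal"
  assumes "\<And>q. q \<in> unit_box n \<Longrightarrow> 0 \<le> \<Psi> q \<and>
    ennreal (\<Psi> q) = (\<integral>\<^sup>+k. c k * ennreal (\<Prod>i<n. q i ^ N k i) \<partial>count_space UNIV)"
  shows "pos_series n \<Psi>"
proof -
  define c' where "c' k = (if k \<in> range (to_nat :: 'i \<Rightarrow> nat) then c (from_nat k) else 0)" for k
  define N' where "N' k = N (from_nat k :: 'i)" for k
  have "(\<integral>\<^sup>+k. c' k * ennreal (\<Prod>i<n. q i ^ N' k i) \<partial>count_space UNIV) =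
      (\<integral>\<^sup>+k. c k * ennreal (\<Prod>i<n. q i ^ N k i) \<partial>count_space UNIV)" for q :: "nat \<Rightarrow> real"
  proof -
    have "(\<integral>\<^sup>+k. c' k * ennreal (\<Prod>i<n. q i ^ N' k i) \<partial>count_space UNIV) =
        (\<integral>\<^sup>+k. (c' k * ennreal (\<Prod>i<n. q i ^ N' k i)) * indicator (range (to_nat :: 'i \<Rightarrow> nat)) k \<partial>count_space UNIV)"
      by (intro nn_integral_cong) (simp add: c'_def indicator_def)
    also have "\<dots> = (\<integral>\<^sup>+k. c' k * ennreal (\<Prod>i<n. q i ^ N' k i) \<partial>count_space (range (to_nat :: 'i \<Rightarrow> nat)))"
      by (simp add: nn_integral_count_space_indicator)
    also have "\<dots> = (\<integral>\<^sup>+k. c' (to_nat k) * ennreal (\<Prod>i<n. q i ^ N' (to_nat (k :: 'i)) i) \<partial>count_space UNIV)"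
      by (rule nn_integral_bij_count_space[symmetric]) (simp add: inj_on_imp_bij_betw)
    finally show ?thesis by (simp add: c'_def N'_def)
  qed
  then show ?thesis unfolding pos_series_def using assms by (intro exI[of _ c'] exI[of _ N']) auto
qed

lemma pos_series_const: "0 \<le> a \<Longrightarrow> pos_series n (\<lambda>_. a)"
  by (rule pos_seriesI[where c = "\<lambda>_ :: unit. ennreal a" and N = "\<lambda>_ _. 0"])
    (simp add: nn_integral_count_space_finite)

lemma pos_series_var: "i < n \<Longrightarrow> pos_series n (\<lambda>q. q i)"
proof (rule pos_seriesI[where c = "\<lambda>_ :: unit. 1" and N = "\<lambda>_ j. if j = i then 1 else 0"])
  fix q assume "i < n" "q \<in> unit_box n"
  moreover have "(\<Prod>j<n. q j ^ (if j = i then 1 else 0)) = q i"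
    using prod.delta[of "{..<n}" i q] \<open>i < n\<close> by (simp add: if_distrib cong: if_cong)
  ultimately show "0 \<le> q i \<and> ennreal (q i) =
      (\<integral>\<^sup>+k. 1 * ennreal (\<Prod>j<n. q j ^ (if j = i then 1 else 0)) \<partial>count_space (UNIV :: unit set))"
    by (simp add: nn_integral_count_space_finite unit_box_def)
qed

lemma pos_series_mult:
  assumes "pos_series n \<Psi>" "pos_series n \<Phi>"
  shows "pos_series n (\<lambda>q. \<Psi> q * \<Phi> q)"
proof -
  obtain c :: "nat \<Rightarrow> ennreal" and N where c: "\<And>q. q \<in> unit_box n \<Longrightarrow> 0 \<le> \<Psi> q \<and>
      ennreal (\<Psi> q) = (\<integral>\<^sup>+k. c k * ennreal (\<Prod>i<n. q i ^ N k i) \<partial>count_space UNIV)"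
    using assms(1) unfolding pos_series_def by blast
  obtain c' :: "nat \<Rightarrow> ennreal" and N' where c': "\<And>q. q \<in> unit_box n \<Longrightarrow> 0 \<le> \<Phi> q \<and>
      ennreal (\<Phi> q) = (\<integral>\<^sup>+k. c' k * ennreal (\<Prod>i<n. q i ^ N' k i) \<partial>count_space UNIV)"
    using assms(2) unfolding pos_series_def by blast
  show ?thesis
  proof (rule pos_seriesI[where c = "\<lambda>x. c (fst x) * c' (snd x)" and N = "\<lambda>x i. N (fst x) i + N' (snd x) i"])
    fix q assume q: "q \<in> unit_box n"
    have nn: "0 \<le> (\<Prod>i<n. q i ^ M i)" for M using q by (auto simp: unit_box_def intro!: prod_nonneg)
    have "ennreal (\<Psi> q * \<Phi> q) = ennreal (\<Psi> q) * ennreal (\<Phi> q)"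
      using c[OF q] c'[OF q] by (simp add: ennreal_mult)
    also have "\<dots> = (\<integral>\<^sup>+k. \<integral>\<^sup>+l. (c k * ennreal (\<Prod>i<n. q i ^ N k i)) * (c' l * ennreal (\<Prod>i<n. q i ^ N' l i))
        \<partial>count_space UNIV \<partial>count_space UNIV)"
      using c[OF q] c'[OF q] by (simp add: nn_integral_cmult nn_integral_multc)
    also have "\<dots> = (\<integral>\<^sup>+k. \<integral>\<^sup>+l. (c k * c' l) * ennreal (\<Prod>i<n. q i ^ (N k i + N' l i))
        \<partial>count_space UNIV \<partial>count_space UNIV)"
      by (intro nn_integral_cong) (simp add: power_add prod.distrib ennreal_mult[OF nn nn] mult_ac)
    also have "\<dots> = (\<integral>\<^sup>+x. (c (fst x) * c' (snd x)) * ennreal (\<Prod>i<n. q i ^ (N (fst x) i + N' (snd x) i)) \<partial>count_space UNIV)"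
      by (subst nn_integral_fst_count_space[symmetric]) simp
    finally show "0 \<le> \<Psi> q * \<Phi> q \<and> ennreal (\<Psi> q * \<Phi> q) =
        (\<integral>\<^sup>+x. (c (fst x) * c' (snd x)) * ennreal (\<Prod>i<n. q i ^ (N (fst x) i + N' (snd x) i)) \<partial>count_space UNIV)"
      using c[OF q] c'[OF q] by simp
  qed
qed

lemma pos_series_sums:
  assumes "\<And>m. pos_series n (\<Psi> m)" and "\<And>q. q \<in> unit_box n \<Longrightarrow> (\<lambda>m. \<Psi> m q) sums \<Phi> q"
  shows "pos_series n \<Phi>"
proof -
  have "\<exists>(c :: nat \<Rightarrow> ennreal) N. \<forall>q\<in>unit_box n. 0 \<le> \<Psi> m q \<and>
      ennreal (\<Psi> m q) = (\<integral>\<^sup>+k. c k * ennreal (\<Prod>i<n. q i ^ N k i) \<partial>count_space UNIV)" for m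
    using assms(1)[of m] unfolding pos_series_def .
  then obtain c :: "nat \<Rightarrow> nat \<Rightarrow> ennreal" and N where c: "\<And>m q. q \<in> unit_box n \<Longrightarrow> 0 \<le> \<Psi> m q \<and>
      ennreal (\<Psi> m q) = (\<integral>\<^sup>+k. c m k * ennreal (\<Prod>i<n. q i ^ N m k i) \<partial>count_space UNIV)"
    by metis
  show ?thesis
  proof (rule pos_seriesI[where c = "\<lambda>x. c (fst x) (snd x)" and N = "\<lambda>x. N (fst x) (snd x)"])
    fix q assume q: "q \<in> unit_box n"
    have "ennreal (\<Phi> q) = (\<Sum>m. ennreal (\<Psi> m q))"
      using suminf_ennreal_eq[OF _ assms(2)[OF q]] c[OF q] by simp
    also have "\<dots> = (\<integral>\<^sup>+m. \<integral>\<^sup>+k. c m k * ennreal (\<Prod>i<n. q i ^ N m k i) \<partial>count_space UNIV \<partial>count_space UNIV)"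
      using c[OF q] by (simp add: nn_integral_count_space_nat)
    also have "\<dots> = (\<integral>\<^sup>+x. c (fst x) (snd x) * ennreal (\<Prod>i<n. q i ^ N (fst x) (snd x) i) \<partial>count_space UNIV)"
      by (subst nn_integral_fst_count_space[symmetric]) simp
    finally show "0 \<le> \<Phi> q \<and> ennreal (\<Phi> q) =
        (\<integral>\<^sup>+x. c (fst x) (snd x) * ennreal (\<Prod>i<n. q i ^ N (fst x) (snd x) i) \<partial>count_space UNIV)"
      using sums_le[OF _ sums_zero assms(2)[OF q]] c[OF q] by simp
  qed
qed

lemma pos_series_add:
  assumes "pos_series n \<Psi>" "pos_series n \<Phi>"
  shows "pos_series n (\<lambda>q. \<Psi> q + \<Phi> q)"
proof (rule pos_series_sums[where \<Psi> = "\<lambda>m. if m = 0 then \<Psi> else if m = (1 :: nat) then \<Phi> else (\<lambda>_. 0)"])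
  fix q :: "nat \<Rightarrow> real"
  show "(\<lambda>m. (if m = 0 then \<Psi> else if m = (1 :: nat) then \<Phi> else (\<lambda>_. 0)) q) sums (\<Psi> q + \<Phi> q)"
    using sums_finite[of "{0, 1}" "\<lambda>m. (if m = 0 then \<Psi> else if m = (1 :: nat) then \<Phi> else (\<lambda>_. 0)) q"] by simp
qed (use assms pos_series_const[of 0] in auto)

lemma pos_series_power: "pos_series n \<Psi> \<Longrightarrow> pos_series n (\<lambda>q. \<Psi> q ^ m)"
  by (induction m) (simp_all add: pos_series_const pos_series_mult)

lemma pos_series_one_minus_powr:
  assumes \<beta>: "0 < \<beta>" and "pos_series n \<Psi>" and "\<Psi> (\<lambda>_. 1) < 1"
  shows "pos_series n (\<lambda>q. (1 - \<Psi> q) powr - \<beta>)"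
proof (rule pos_series_sums)
  show "pos_series n (\<lambda>q. (\<beta> + real m - 1 gchoose m) * \<Psi> q ^ m)" for m
    by (intro pos_series_mult pos_series_const pos_series_power gchoose_neg_binomial_nonneg assms)
  show "(\<lambda>m. (\<beta> + real m - 1 gchoose m) * \<Psi> q ^ m) sums (1 - \<Psi> q) powr - \<beta>" if "q \<in> unit_box n" for q
    by (rule negative_binomial_sums)
      (use pos_series_nonneg[OF assms(2) that] pos_series_mono_one[OF assms(2) that] assms(3) in auto)
qed

text \<open>Induction by Schur complements: each pivot contributes a factor
  \<open>(1 - p m m) powr - \<alpha>\<close>, a positive series by the binomial expansion. The
  strict inequality with the positive vector \<open>x\<close> is the M-matrix criterion at the
  corner \<open>q = 1\<close>; it passes to the Schur complement and keeps every pivot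
  positive.\<close>

lemma pos_series_det_powr:
  fixes p :: "nat \<Rightarrow> nat \<Rightarrow> (nat \<Rightarrow> real) \<Rightarrow> real"
  assumes \<alpha>: "0 < \<alpha>"
    and "\<And>i j. i < m \<Longrightarrow> j < m \<Longrightarrow> pos_series n (p i j)" and "\<And>i. i < m \<Longrightarrow> 0 < x i"
    and "\<And>i. i < m \<Longrightarrow> (\<Sum>j<m. p i j (\<lambda>_. 1) * x j) < x i"
  shows "(\<forall>q\<in>unit_box n. 0 < Determinant.det (Matrix.mat m m (\<lambda>(i, j). of_bool (i = j) - p i j q))) \<and>
    pos_series n (\<lambda>q. Determinant.det (Matrix.mat m m (\<lambda>(i, j). of_bool (i = j) - p i j q)) powr - \<alpha>)"
  using assms(2-)
proof (induction m arbitrary: p)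
  case 0
  then show ?case by (simp add: pos_series_const det_dim_zero[of "Matrix.mat 0 0 f" for f])
next
  case (Suc m)
  define u where "u q = 1 - p m m q" for q
  \<comment> \<open>The Schur complement is again the identity minus a matrix of positive series.
    The reciprocal of the pivot is written \<open>u q powr - 1\<close> so that it falls under the
    binomial series with exponent 1.\<close>
  define p' where "p' i j q = p i j q + p i m q * p m j q * u q powr - 1" for i j q
  have ps: "pos_series n (p i j)" if "i \<le> m" "j \<le> m" for i j using Suc.prems(1) that by simp
  have x: "0 < x i" if "i \<le> m" for i using Suc.prems(2) that by simp
  have p1: "0 \<le> p i j (\<lambda>_. 1)" if "i \<le> m" "j \<le> m" for i j
    using pos_series_nonneg[OF ps[OF that] ones_in_unit_box] .
  have row: "(\<Sum>j<m. p i j (\<lambda>_. 1) * x j) + p i m (\<lambda>_. 1) * x m < x i" if "i \<le> m" for i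
    using Suc.prems(3)[of i] that by simp
  have s0: "0 \<le> (\<Sum>j<m. p i j (\<lambda>_. 1) * x j)" if "i \<le> m" for i
    using that by (intro sum_nonneg mult_nonneg_nonneg p1 less_imp_le[OF x]) auto
  have "p m m (\<lambda>_. 1) * x m < 1 * x m" using row[of m] s0[of m] by simp
  then have pmm: "p m m (\<lambda>_. 1) < 1" using x[of m] by (simp only: mult_less_cancel_right_pos)
  have u: "0 < u q" if "q \<in> unit_box n" for q
    using pos_series_mono_one[OF ps[of m m] that] pmm by (simp add: u_def)
  have ui: "pos_series n (\<lambda>q. u q powr - \<beta>)" if "0 < \<beta>" for \<beta>
    unfolding u_def by (rule pos_series_one_minus_powr[OF that ps pmm]) auto
  have IH: "(\<forall>q\<in>unit_box n. 0 < Determinant.det (Matrix.mat m m (\<lambda>(i, j). of_bool (i = j) - p' i j q))) \<and>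
    pos_series n (\<lambda>q. Determinant.det (Matrix.mat m m (\<lambda>(i, j). of_bool (i = j) - p' i j q)) powr - \<alpha>)"
  proof (rule Suc.IH)
    fix i assume i: "i < m"
    show "0 < x i" using x i by simp
    show "pos_series n (p' i j)" if "j < m" for j
      unfolding p'_def by (intro pos_series_add pos_series_mult ps ui) (use i that in auto)
    have u1: "0 < u (\<lambda>_. 1)" by (rule u[OF ones_in_unit_box])
    have "(\<Sum>j<m. p' i j (\<lambda>_. 1) * x j) = (\<Sum>j<m. p i j (\<lambda>_. 1) * x j) +
        p i m (\<lambda>_. 1) * ((\<Sum>j<m. p m j (\<lambda>_. 1) * x j) / u (\<lambda>_. 1))"
      using u1 by (simp add: p'_def powr_minus_divide sum.distrib sum_distrib_left sum_divide_distrib algebra_simps)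
    \<comment> \<open>The inequality of the eliminated row, solved for \<open>x m\<close>: what
      elimination adds to row \<open>i\<close> is at most the term \<open>p i m * x m\<close> that
      it removes.\<close>
    also have "(\<Sum>j<m. p m j (\<lambda>_. 1) * x j) / u (\<lambda>_. 1) \<le> x m"
      using row[of m] u1 by (simp add: u_def divide_le_eq algebra_simps)
    then have "p i m (\<lambda>_. 1) * ((\<Sum>j<m. p m j (\<lambda>_. 1) * x j) / u (\<lambda>_. 1)) \<le> p i m (\<lambda>_. 1) * x m"
      by (intro mult_left_mono p1) (use i in auto)
    finally show "(\<Sum>j<m. p' i j (\<lambda>_. 1) * x j) < x i" using row[of i] i by simp
  qed
  have d: "Determinant.det (Matrix.mat (Suc m) (Suc m) (\<lambda>(i, j). of_bool (i = j) - p i j q)) =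
      u q * Determinant.det (Matrix.mat m m (\<lambda>(i, j). of_bool (i = j) - p' i j q))" if q: "q \<in> unit_box n" for q
  proof -
    have "Determinant.det (Matrix.mat (Suc m) (Suc m) (\<lambda>(i, j). of_bool (i = j) - p i j q)) =
      u q * Determinant.det (Matrix.mat m m (\<lambda>(i, j). of_bool (i = j) - p i j q -
        (of_bool (i = m) - p i m q) * (of_bool (m = j) - p m j q) / u q))"
      using det_schur_complement[of "\<lambda>i j. of_bool (i = j) - p i j q" m] u[OF q] by (simp add: u_def)
    also have "Matrix.mat m m (\<lambda>(i, j). of_bool (i = j) - p i j q -
        (of_bool (i = m) - p i m q) * (of_bool (m = j) - p m j q) / u q) =
        Matrix.mat m m (\<lambda>(i, j). of_bool (i = j) - p' i j q)"
      by (rule cong_mat) (use u[OF q] in \<open>auto simp: p'_def powr_minus_divide\<close>)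
    finally show ?thesis .
  qed
  have "pos_series n (\<lambda>q. u q powr - \<alpha> * Determinant.det (Matrix.mat m m (\<lambda>(i, j). of_bool (i = j) - p' i j q)) powr - \<alpha>)"
    using IH ui[OF \<alpha>] by (intro pos_series_mult) auto
  then show ?case
    using IH u d by (auto simp: pos_series_def powr_mult less_imp_le)
qed

text \<open>Here \<open>A\<close> is the inverse of the kernel. Writing \<open>A = D - P\<close> with \<open>D\<close> diagonal and \<open>P \<ge> 0\<close>,
  \<open>det (I + K T) = det K * det (D + T) * det (I - (D + T)\<^sup>-\<^sup>1 P)\<close>.\<close>

lemma M_matrix_laplace:
  fixes K A :: "nat \<Rightarrow> nat \<Rightarrow> real"
  assumes \<alpha>: "0 < \<alpha>" and d: "\<And>i. i < n \<Longrightarrow> 0 < d i"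
    and off: "\<And>i j. i < n \<Longrightarrow> j < n \<Longrightarrow> i \<noteq> j \<Longrightarrow> A i j \<le> 0" and diag: "\<And>i. i < n \<Longrightarrow> A i i \<le> d i"
    and inv: "\<And>i k. i < n \<Longrightarrow> k < n \<Longrightarrow> (\<Sum>j<n. A i j * K j k) = of_bool (i = k)"
    and x: "\<And>i. i < n \<Longrightarrow> 0 < x i" and Ax: "\<And>i. i < n \<Longrightarrow> 0 < (\<Sum>j<n. A i j * x j)"
  shows "\<exists>\<psi>. pos_series n \<psi> \<and> \<psi> (\<lambda>_. 1) = 1 \<and> (\<forall>t. (\<forall>i<n. 0 \<le> t i) \<longrightarrow>
    Determinant.det (1\<^sub>m n + Matrix.mat n n (\<lambda>(p, q). K p q) * mat_diag n t) powr - \<alpha> =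
    (\<Prod>i<n. (d i / (d i + t i)) powr \<alpha>) * \<psi> (\<lambda>i. d i / (d i + t i)))"
proof -
  \<comment> \<open>Since \<open>q i / d i = 1 / (d i + t i)\<close>, this is the inverse of
    \<open>D + T\<close> times \<open>P\<close>, written as a linear form in \<open>q\<close>. With
    \<open>A i i \<le> d i\<close> the diagonal of \<open>P\<close> is nonnegative as well.\<close>
  define p where "p i j q = q i * ((of_bool (i = j) * d i - A i j) / d i)" for i j and q :: "nat \<Rightarrow> real"
  define \<Xi> where "\<Xi> q = Determinant.det (Matrix.mat n n (\<lambda>(i, j). of_bool (i = j) - p i j q))" for q
  have ps: "(\<forall>q\<in>unit_box n. 0 < \<Xi> q) \<and> pos_series n (\<lambda>q. \<Xi> q powr - \<alpha>)"
    unfolding \<Xi>_def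
  proof (rule pos_series_det_powr[OF \<alpha>])
    fix i assume i: "i < n"
    show "pos_series n (p i j)" if j: "j < n" for j
      unfolding p_def using i j off[OF i j] diag[OF i] d[OF i]
      by (intro pos_series_mult pos_series_var pos_series_const) (cases "i = j", auto simp: divide_nonpos_pos)
    show "0 < x i" by (rule x[OF i])
    have "(\<Sum>j<n. p i j (\<lambda>_. 1) * x j) = (\<Sum>j<n. of_bool (j = i) * x j - A i j * x j / d i)"
      using d[OF i] by (intro sum.cong) (auto simp: p_def field_simps)
    also have "\<dots> = x i - (\<Sum>j<n. A i j * x j) / d i"
      using i by (simp add: sum_subtractf sum_divide_distrib sum.delta)
    also have "\<dots> < x i" using Ax[OF i] d[OF i] by simp
    finally show "(\<Sum>j<n. p i j (\<lambda>_. 1) * x j) < x i" .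
  qed
  define a where "a = Matrix.mat n n (\<lambda>(i, j). A i j)"
  define k where "k = Matrix.mat n n (\<lambda>(i, j). K i j)"
  have ac: "a \<in> carrier_mat n n" "k \<in> carrier_mat n n" by (auto simp: a_def k_def)
  have ak: "a * k = 1\<^sub>m n"
    by (rule eq_matI) (auto simp: a_def k_def scalar_prod_def inv atLeast0LessThan)
  have fact: "Determinant.det (a + mat_diag n t) = (\<Prod>i<n. d i + t i) * \<Xi> (\<lambda>i. d i / (d i + t i))"
    if t: "\<And>i. i < n \<Longrightarrow> 0 \<le> t i" for t
  proof -
    have "a + mat_diag n t = Matrix.mat n n (\<lambda>(i, j). (d i + t i) * (of_bool (i = j) - p i j (\<lambda>i. d i / (d i + t i))))"
      (is "_ = ?r")
    proof (rule eq_matI)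
      fix i j assume "i < dim_row ?r" "j < dim_col ?r"
      then have i: "i < n" and j: "j < n" by simp_all
      have "A i j + (if i = j then t j else 0) =
        (d i + t i) * (of_bool (i = j) - p i j (\<lambda>i. d i / (d i + t i)))"
      proof -
        have 1: "(d i + t i) * (d i / (d i + t i)) = d i" and 2: "d i \<noteq> 0" using d[OF i] t[OF i] by auto
        have "(d i + t i) * (of_bool (i = j) - p i j (\<lambda>i. d i / (d i + t i))) =
          (d i + t i) * of_bool (i = j) - ((d i + t i) * (d i / (d i + t i))) * ((of_bool (i = j) * d i - A i j) / d i)"
          unfolding p_def by (simp only: right_diff_distrib mult.assoc)
        also have "\<dots> = (d i + t i) * of_bool (i = j) - (of_bool (i = j) * d i - A i j)"
          unfolding 1 using 2 by simp
        finally show ?thesis by auto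
      qed
      then show "(a + mat_diag n t) $$ (i, j) = ?r $$ (i, j)"
        using i j by (simp add: a_def mat_diag_def)
    qed (simp_all add: a_def mat_diag_def)
    then show ?thesis by (simp add: det_scale_rows \<Xi>_def)
  qed
  have box: "(\<lambda>i. d i / (d i + t i)) \<in> unit_box n" if "\<And>i. i < n \<Longrightarrow> 0 \<le> t i" for t
    using d that by (auto simp: unit_box_def divide_le_eq_1 add_pos_nonneg less_imp_le)
  have \<Xi>1: "\<Xi> (\<lambda>i. d i / (d i + 0)) = \<Xi> (\<lambda>_. 1)"
    unfolding \<Xi>_def p_def by (rule arg_cong[where f = Determinant.det], rule cong_mat) (use d in auto)
  have deta: "Determinant.det a = (\<Prod>i<n. d i) * \<Xi> (\<lambda>_. 1)"
  proof -
    have "a + mat_diag n (\<lambda>_. 0) = a" by (rule eq_matI) (auto simp: a_def mat_diag_def)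
    then show ?thesis using fact[of "\<lambda>_. 0"] \<Xi>1 by simp
  qed
  \<comment> \<open>\<open>q = 1\<close> corresponds to \<open>t = 0\<close>. Normalising there
    makes the coefficients of \<open>\<psi>\<close> sum to 1, that is, a probability law on exponent
    vectors.\<close>
  define \<psi> where "\<psi> q = \<Xi> (\<lambda>_. 1) powr \<alpha> * \<Xi> q powr - \<alpha>" for q
  have \<Xi>pos: "0 < \<Xi> q" if "q \<in> unit_box n" for q using ps that by blast
  show ?thesis
  proof (intro exI[of _ \<psi>] conjI allI impI)
    show "pos_series n \<psi>" unfolding \<psi>_def using ps by (intro pos_series_mult pos_series_const) auto
    show "\<psi> (\<lambda>_. 1) = 1" using \<Xi>pos[OF ones_in_unit_box] by (simp add: \<psi>_def powr_minus)
    fix t :: "nat \<Rightarrow> real" assume "\<forall>i<n. 0 \<le> t i"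
    then have t: "\<And>i. i < n \<Longrightarrow> 0 \<le> t i" by blast
    define q where "q i = d i / (d i + t i)" for i
    \<comment> \<open>Multiplying by the inverse \<open>a\<close> of the kernel turns
      \<open>I + K T\<close> into \<open>a + T\<close>, whose determinant \<open>fact\<close> has
      factored.\<close>
    have "Determinant.det a * Determinant.det (1\<^sub>m n + k * mat_diag n t) = Determinant.det (a * (1\<^sub>m n + k * mat_diag n t))"
      using ac by (subst det_mult[of _ n]) auto
    also have "a * (1\<^sub>m n + k * mat_diag n t) = a + mat_diag n t"
      using ac by (subst mult_add_distrib_mat[of _ n n _ n]) (auto simp: assoc_mult_mat[of a n n k n "mat_diag n t" n, symmetric] ak left_mult_one_mat[OF mat_diag_dim])
    finally have "(\<Prod>i<n. d i) * \<Xi> (\<lambda>_. 1) * Determinant.det (1\<^sub>m n + k * mat_diag n t) =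
        (\<Prod>i<n. d i + t i) * \<Xi> q"
      by (simp add: deta fact[OF t] q_def[abs_def])
    moreover have P: "0 < (\<Prod>i<n. d i)" "0 < (\<Prod>i<n. d i + t i)" using d t by (auto intro!: prod_pos add_pos_nonneg)
    moreover have X: "0 < \<Xi> (\<lambda>_. 1)" "0 < \<Xi> q"
      using \<Xi>pos[OF ones_in_unit_box] \<Xi>pos[OF box[of t]] t by (auto simp: q_def[abs_def])
    moreover have "D = x / x1 * (p / p0)" if "p0 * x1 * D = p * x" "0 < p0" "0 < x1" for D x x1 p p0 :: real
      using that by (simp add: field_simps)
    ultimately have "Determinant.det (1\<^sub>m n + k * mat_diag n t) =
        \<Xi> q / \<Xi> (\<lambda>_. 1) * ((\<Prod>i<n. d i + t i) / (\<Prod>i<n. d i))" by blast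
    also have "\<dots> powr - \<alpha> = (\<Xi> q / \<Xi> (\<lambda>_. 1)) powr - \<alpha> * ((\<Prod>i<n. d i + t i) / (\<Prod>i<n. d i)) powr - \<alpha>"
      by (rule powr_mult)
    also have "((\<Prod>i<n. d i + t i) / (\<Prod>i<n. d i)) powr - \<alpha> = (\<Prod>i<n. q i) powr \<alpha>"
      using P by (simp add: q_def prod_dividef powr_minus powr_divide)
    also have "\<dots> = (\<Prod>i<n. q i powr \<alpha>)"
      by (rule prod_powr_distrib)
    also have "(\<Xi> q / \<Xi> (\<lambda>_. 1)) powr - \<alpha> = \<psi> q"
      using X by (simp add: \<psi>_def powr_divide powr_minus field_simps)
    finally show "Determinant.det (1\<^sub>m n + Matrix.mat n n (\<lambda>(p, q). K p q) * mat_diag n t) powr - \<alpha> =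
        (\<Prod>i<n. (d i / (d i + t i)) powr \<alpha>) * \<psi> (\<lambda>i. d i / (d i + t i))"
      unfolding k_def q_def by (simp add: mult.commute)
  qed
qed

text \<open>Under the mixture the coordinates are independent gamma variables with shapes
  \<open>\<alpha> + N k i\<close>. Larger shapes only lower the mean of a decreasing function, so
  shape \<open>\<alpha>\<close> bounds every component, and the weights sum to 1. The gap between
  \<open>u\<close> and \<open>v\<close> leaves room for continuous test functions.\<close>

lemma M_matrix_gamma_domination:
  fixes K A :: "nat \<Rightarrow> nat \<Rightarrow> real" and Y :: "nat \<Rightarrow> 'w \<Rightarrow> real"
  assumes M: "prob_space M" and Y: "\<And>i. i < n \<Longrightarrow> Y i \<in> borel_measurable M"
    and Y0: "\<And>i \<omega>. i < n \<Longrightarrow> \<omega> \<in> space M \<Longrightarrow> 0 \<le> Y i \<omega>"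
    and \<alpha>: "0 < \<alpha>" and d: "\<And>i. i < n \<Longrightarrow> 0 < d i"
    and off: "\<And>i j. i < n \<Longrightarrow> j < n \<Longrightarrow> i \<noteq> j \<Longrightarrow> A i j \<le> 0" and diag: "\<And>i. i < n \<Longrightarrow> A i i \<le> d i"
    and inv: "\<And>i k. i < n \<Longrightarrow> k < n \<Longrightarrow> (\<Sum>j<n. A i j * K j k) = of_bool (i = k)"
    and x: "\<And>i. i < n \<Longrightarrow> 0 < x i" and Ax: "\<And>i. i < n \<Longrightarrow> 0 < (\<Sum>j<n. A i j * x j)"
    and laplace: "\<And>t. (\<And>i. i < n \<Longrightarrow> 0 < t i) \<Longrightarrow>
      (LINT \<omega>|M. exp (- (\<Sum>i<n. t i * Y i \<omega>))) =
      Determinant.det (1\<^sub>m n + Matrix.mat n n (\<lambda>(p, q). K p q) * mat_diag n t) powr - \<alpha>"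
    and uv: "\<And>i. i < n \<Longrightarrow> u i < v i"
  shows "measure M {\<omega> \<in> space M. \<forall>i<n. Y i \<omega> \<le> u i} \<le>
    (\<Prod>i<n. 1 - measure (gamma_law \<alpha>) {d i * v i..})"
proof -
  interpret M: prob_space M by fact
  interpret G: prob_space "gamma_law \<alpha>" by (rule prob_space_gamma_law[OF \<alpha>])
  obtain \<psi> where \<psi>: "pos_series n \<psi>" "\<psi> (\<lambda>_. 1) = 1" and \<psi>L: "\<And>t. (\<And>i. i < n \<Longrightarrow> 0 \<le> t i) \<Longrightarrow>
      Determinant.det (1\<^sub>m n + Matrix.mat n n (\<lambda>(p, q). K p q) * mat_diag n t) powr - \<alpha> =
      (\<Prod>i<n. (d i / (d i + t i)) powr \<alpha>) * \<psi> (\<lambda>i. d i / (d i + t i))"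
    using M_matrix_laplace[OF \<alpha> d off diag inv x Ax] by blast
  obtain c :: "nat \<Rightarrow> ennreal" and N where c: "\<And>q. q \<in> unit_box n \<Longrightarrow> 0 \<le> \<psi> q \<and>
      ennreal (\<psi> q) = (\<integral>\<^sup>+k. c k * ennreal (\<Prod>i<n. q i ^ N k i) \<partial>count_space UNIV)"
    using \<psi>(1) unfolding pos_series_def by blast
  have c1: "(\<integral>\<^sup>+k. c k \<partial>count_space UNIV) = 1"
    using c[OF ones_in_unit_box] \<psi>(2) by simp
  \<comment> \<open>A decreasing ramp, 1 up to \<open>u i\<close> and 0 from \<open>v i\<close> on;
    it lies between the two indicator functions that are to be compared.\<close>
  define f where "f i y = max 0 (min 1 ((v i - y) / (v i - u i)))" for i y
  define R where "R = (\<Sum>i<n. \<bar>v i\<bar>)"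
  have fcont: "continuous_on UNIV (f i)" if "i < n" for i
    unfolding f_def using uv[OF that] by (intro continuous_intros) auto
  have f0: "0 \<le> f i y" for i y by (simp add: f_def)
  have f1: "f i y \<le> 1" for i y by (simp add: f_def)
  have fanti: "f i y' \<le> f i y" if "i < n" "y \<le> y'" for i y y'
    unfolding f_def using that uv[OF that(1)] by (intro max.mono min.mono divide_right_mono) auto
  have fu: "f i y = 1" if "i < n" "y \<le> u i" for i y
    using that uv[OF that(1)] by (simp add: f_def)
  have fv: "f i y = 0" if "i < n" "v i \<le> y" for i y
    using that uv[OF that(1)] by (simp add: f_def divide_nonpos_pos)
  have fm: "f i \<in> borel_measurable borel" if "i < n" for i
    by (rule borel_measurable_continuous_onI[OF fcont[OF that]])
  have gm: "(LINT y|gamma_law \<alpha>. f i (y / d i)) \<le> 1 - measure (gamma_law \<alpha>) {d i * v i..}" if i: "i < n" for i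
  proof -
    have "(LINT y|gamma_law \<alpha>. f i (y / d i)) \<le> (LINT y|gamma_law \<alpha>. indicator (UNIV - {d i * v i..}) y)"
    proof (rule integral_mono)
      show "integrable (gamma_law \<alpha>) (\<lambda>y. f i (y / d i))"
        by (rule G.integrable_const_bound[where B = 1]) (use f0 f1 fm[OF i] in auto)
      show "integrable (gamma_law \<alpha>) (\<lambda>y. indicator (UNIV - {d i * v i..}) y :: real)"
        by (rule G.integrable_const_bound[where B = 1]) auto
      show "f i (y / d i) \<le> indicator (UNIV - {d i * v i..}) y" for y
        using fv[OF i, of "y / d i"] d[OF i] f1[of i "y / d i"]
        by (auto simp: indicator_def pos_le_divide_eq mult.commute)
    qed
    also have "\<dots> = measure (gamma_law \<alpha>) (space (gamma_law \<alpha>) - {d i * v i..})" by simp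
    also have "\<dots> = 1 - measure (gamma_law \<alpha>) {d i * v i..}" by (rule G.prob_compl) simp
    finally show ?thesis .
  qed
  define E where "E = {\<omega> \<in> space M. \<forall>i<n. Y i \<omega> \<le> u i}"
  have "{\<omega> \<in> space M. \<forall>i\<in>{..<n}. Y i \<omega> \<le> u i} \<in> sets M"
  proof (rule sets.sets_Collect_finite_All)
    show "{\<omega> \<in> space M. Y i \<omega> \<le> u i} \<in> sets M" if "i \<in> {..<n}" for i
    proof -
      have "Y i \<in> borel_measurable M" using Y that by simp
      then show ?thesis by measurable
    qed
  qed simp
  also have "{\<omega> \<in> space M. \<forall>i\<in>{..<n}. Y i \<omega> \<le> u i} = E" by (auto simp: E_def)
  finally have E: "E \<in> sets M" .
  have "measure M E = (LINT \<omega>|M. indicator E \<omega>)"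
    by (simp only: Bochner_Integration.integral_indicator Int_absorb2[OF sets.sets_into_space[OF E]])
  also have "\<dots> \<le> (LINT \<omega>|M. (\<Prod>i<n. f i (Y i \<omega>)))"
  proof (rule integral_mono)
    show "integrable M (\<lambda>\<omega>. indicator E \<omega> :: real)"
      using E by (intro M.integrable_const_bound[where B = 1]) auto
    show "integrable M (\<lambda>\<omega>. \<Prod>i<n. f i (Y i \<omega>))"
    proof (rule M.integrable_const_bound[where B = 1])
      show "(\<lambda>\<omega>. \<Prod>i<n. f i (Y i \<omega>)) \<in> borel_measurable M"
        by (intro borel_measurable_prod measurable_compose[OF Y fm]) auto
    qed (auto simp: abs_prod abs_of_nonneg f0 f1 intro!: prod_le_1)
    show "indicator E \<omega> \<le> (\<Prod>i<n. f i (Y i \<omega>))" for \<omega>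
      using fu f0 by (auto simp: E_def indicator_def intro!: prod_nonneg)
  qed
  finally have le: "measure M E \<le> (LINT \<omega>|M. (\<Prod>i<n. f i (Y i \<omega>)))" .
  have "ennreal (LINT \<omega>|M. (\<Prod>i<n. f i (Y i \<omega>))) = (\<integral>\<^sup>+k. c k * ennreal (\<Prod>i<n. LINT y|gamma_law (\<alpha> + real (N k i)). f i (y / d i)) \<partial>count_space UNIV)"
  proof (rule gamma_mixture_product[OF M Y Y0 \<alpha> d _ _ fcont f0, where R = R])
    show "(\<integral>\<^sup>+k. c k \<partial>count_space UNIV) < \<infinity>" by (simp add: c1)
    show "f i y = 0" if "i < n" "R \<le> y" for i y
    proof -
      have "v i \<le> \<bar>v i\<bar>" by simp
      also have "\<dots> \<le> R" unfolding R_def by (rule member_le_sum) (use that in auto)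
      finally show ?thesis using fv[OF that(1)] that(2) by simp
    qed
    fix t :: "nat \<Rightarrow> real" assume t: "\<And>i. i < n \<Longrightarrow> 0 < t i"
    define q where "q i = d i / (d i + t i)" for i
    have q: "0 < q i" "q i \<le> 1" if "i < n" for i
      using t[OF that] d[OF that] by (auto simp: q_def divide_le_eq_1)
    have box: "q \<in> unit_box n" using q by (auto simp: unit_box_def less_imp_le)
    have "ennreal (LINT \<omega>|M. exp (- (\<Sum>i<n. t i * Y i \<omega>))) = ennreal (\<Prod>i<n. q i powr \<alpha>) * ennreal (\<psi> q)"
      using laplace[OF t] \<psi>L[of t] t c[OF box]
      by (simp add: q_def[abs_def] less_imp_le ennreal_mult prod_nonneg)
    also have "\<dots> = (\<integral>\<^sup>+k. ennreal (\<Prod>i<n. q i powr \<alpha>) * (c k * ennreal (\<Prod>i<n. q i ^ N k i)) \<partial>count_space UNIV)"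
      using c[OF box] by (simp add: nn_integral_cmult)
    also have "\<dots> = (\<integral>\<^sup>+k. c k * ennreal (\<Prod>i<n. q i powr (\<alpha> + real (N k i))) \<partial>count_space UNIV)"
    proof (intro nn_integral_cong)
      fix k
      have "(\<Prod>i<n. q i powr (\<alpha> + real (N k i))) = (\<Prod>i<n. q i powr \<alpha>) * (\<Prod>i<n. q i ^ N k i)"
        unfolding prod.distrib[symmetric]
        by (intro prod.cong refl) (use q in \<open>auto simp: powr_add powr_realpow\<close>)
      then show "ennreal (\<Prod>i<n. q i powr \<alpha>) * (c k * ennreal (\<Prod>i<n. q i ^ N k i)) =
          c k * ennreal (\<Prod>i<n. q i powr (\<alpha> + real (N k i)))"
        using ennreal_mult[of "\<Prod>i<n. q i powr \<alpha>" "\<Prod>i<n. q i ^ N k i"] prod_nonneg[of "{..<n}" "\<lambda>i. q i ^ N k i"] q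
        by (simp add: prod_nonneg less_imp_le mult_ac)
    qed
    finally show "ennreal (LINT \<omega>|M. exp (- (\<Sum>i<n. t i * Y i \<omega>))) =
        (\<integral>\<^sup>+k. c k * ennreal (\<Prod>i<n. (d i / (d i + t i)) powr (\<alpha> + real (N k i))) \<partial>count_space UNIV)"
      by (simp add: q_def)
  qed auto
  also have "\<dots> \<le> (\<integral>\<^sup>+k. c k * ennreal (\<Prod>i<n. 1 - measure (gamma_law \<alpha>) {d i * v i..}) \<partial>count_space UNIV)"
  proof (intro nn_integral_mono mult_left_mono ennreal_leI prod_mono conjI)
    fix k i assume "i \<in> {..<n}"
    then have i: "i < n" by simp
    show "0 \<le> (LINT y|gamma_law (\<alpha> + real (N k i)). f i (y / d i))"
      by (intro integral_nonneg_AE AE_I2 f0)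
    have "(LINT y|gamma_law (\<alpha> + real (N k i)). f i (y / d i)) \<le> (LINT y|gamma_law \<alpha>. f i (y / d i))"
      by (rule gamma_law_stochastic_order[OF \<alpha> _ f0 f1])
        (use fm[OF i] d[OF i] in \<open>auto intro!: fanti[OF i] divide_right_mono\<close>)
    then show "(LINT y|gamma_law (\<alpha> + real (N k i)). f i (y / d i)) \<le> 1 - measure (gamma_law \<alpha>) {d i * v i..}"
      using gm[OF i] by linarith
  qed simp
  also have "\<dots> = ennreal (\<Prod>i<n. 1 - measure (gamma_law \<alpha>) {d i * v i..})"
    by (simp add: nn_integral_multc c1)
  finally have "(LINT \<omega>|M. (\<Prod>i<n. f i (Y i \<omega>))) \<le> (\<Prod>i<n. 1 - measure (gamma_law \<alpha>) {d i * v i..})"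
    by (subst (asm) ennreal_le_iff) (auto intro!: prod_nonneg)
  with le show ?thesis by (simp add: E_def)
qed

section \<open>The minimum kernel and its rank-one perturbations\<close>

definition difference_quotient :: "(nat \<Rightarrow> real) \<Rightarrow> (nat \<Rightarrow> real) \<Rightarrow> nat \<Rightarrow> real" where
  "difference_quotient \<sigma> y i = (y (Suc i) - y i) / (\<sigma> (Suc i) - \<sigma> i)"

text \<open>The inverse of the matrix \<open>min (\<sigma> (Suc i)) (\<sigma> (Suc j))\<close>, \<open>i, j < n\<close>.\<close>

definition min_inverse :: "nat \<Rightarrow> (nat \<Rightarrow> real) \<Rightarrow> nat \<Rightarrow> nat \<Rightarrow> real" where
  "min_inverse n \<sigma> i j =
     of_bool (i = j) * (1 / (\<sigma> (Suc i) - \<sigma> i) + of_bool (Suc i < n) / (\<sigma> (Suc (Suc i)) - \<sigma> (Suc i)))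
     - of_bool (j = Suc i) / (\<sigma> (Suc (Suc i)) - \<sigma> (Suc i)) - of_bool (i = Suc j) / (\<sigma> (Suc i) - \<sigma> i)"

lemma min_inverse_sym: "min_inverse n \<sigma> i j = min_inverse n \<sigma> j i"
  by (auto simp: min_inverse_def)

text \<open>\<open>min_inverse\<close> is the negative second difference in the scale
  \<open>\<sigma>\<close>, with value 0 at index 0 and slope 0 beyond index
  \<open>n\<close>.\<close>

lemma min_inverse_apply:
  assumes "i < n" and "y 0 = 0"
  shows "(\<Sum>j<n. min_inverse n \<sigma> i j * y (Suc j)) =
    difference_quotient \<sigma> y i - of_bool (Suc i < n) * difference_quotient \<sigma> y (Suc i)"
proof -
  define p where "p = 1 / (\<sigma> (Suc i) - \<sigma> i)"
  define r where "r = 1 / (\<sigma> (Suc (Suc i)) - \<sigma> (Suc i))"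
  have 1: "(\<Sum>j<n. of_bool (i = j) * y (Suc j)) = y (Suc i)"
    using assms(1) sum.delta[of "{..<n}" i "\<lambda>j. y (Suc j)"] by (simp add: of_bool_def if_distrib[where f = "\<lambda>x. x * _"] cong: if_cong)
  have 2: "(\<Sum>j<n. of_bool (j = Suc i) * y (Suc j)) = of_bool (Suc i < n) * y (Suc (Suc i))"
    using sum.delta[of "{..<n}" "Suc i" "\<lambda>j. y (Suc j)"] by (simp add: of_bool_def if_distrib[where f = "\<lambda>x. x * _"] cong: if_cong)
  have 3: "(\<Sum>j<n. of_bool (i = Suc j) * y (Suc j)) = y i"
  proof (cases i)
    case 0
    then show ?thesis using assms(2) by simp
  next
    case (Suc l)
    then show ?thesis using assms(1) sum.delta[of "{..<n}" l "\<lambda>j. y (Suc j)"]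
      by (simp add: of_bool_def if_distrib[where f = "\<lambda>x. x * _"] cong: if_cong)
  qed
  have "(\<Sum>j<n. min_inverse n \<sigma> i j * y (Suc j)) =
      (\<Sum>j<n. (p + of_bool (Suc i < n) * r) * (of_bool (i = j) * y (Suc j))
        - r * (of_bool (j = Suc i) * y (Suc j)) - p * (of_bool (i = Suc j) * y (Suc j)))"
    by (intro sum.cong refl) (simp add: min_inverse_def p_def r_def algebra_simps)
  also have "\<dots> = (p + of_bool (Suc i < n) * r) * y (Suc i) - r * (of_bool (Suc i < n) * y (Suc (Suc i))) - p * y i"
    unfolding sum_subtractf sum_distrib_left[symmetric] 1 2 3 ..
  also have "\<dots> = p * (y (Suc i) - y i) - of_bool (Suc i < n) * (r * (y (Suc (Suc i)) - y (Suc i)))"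
    by (simp add: algebra_simps)
  finally show ?thesis by (simp add: difference_quotient_def p_def r_def)
qed

text \<open>Sherman-Morrison: the perturbation \<open>b \<phi>\<close> has rank one, so the inverse
  changes by \<open>h i * \<eta> j / c\<close>, where \<open>h\<close> and \<open>\<eta>\<close> are
  the images of \<open>b\<close> and \<open>\<phi>\<close> under the inverse of the minimum matrix.
  These images are second differences, nonnegative by concavity and monotonicity. Subtracting their
  product therefore keeps off-diagonal entries nonpositive and lowers the diagonal.\<close>

lemma perturbed_min_kernel_M_matrix:
  fixes \<sigma> b \<phi> :: "nat \<Rightarrow> real"
  assumes \<sigma>0: "\<sigma> 0 = 0" and \<sigma>: "\<And>i. \<sigma> i < \<sigma> (Suc i)"
    and b0: "b 0 = 0" and b: "\<And>i. 0 \<le> difference_quotient \<sigma> b i"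
      "\<And>i. difference_quotient \<sigma> b (Suc i) \<le> difference_quotient \<sigma> b i"
    and \<phi>0: "\<phi> 0 = 0" and \<phi>: "\<And>i. 0 \<le> difference_quotient \<sigma> \<phi> i"
      "\<And>i. difference_quotient \<sigma> \<phi> (Suc i) \<le> difference_quotient \<sigma> \<phi> i"
  defines "K \<equiv> \<lambda>i j. min (\<sigma> (Suc i)) (\<sigma> (Suc j)) + b (Suc i) * \<phi> (Suc j)"
  shows "\<exists>A x. (\<forall>i<n. \<forall>j<n. i \<noteq> j \<longrightarrow> A i j \<le> 0) \<and>
    (\<forall>i<n. A i i \<le> 1 / (\<sigma> (Suc i) - \<sigma> i) + 1 / (\<sigma> (Suc (Suc i)) - \<sigma> (Suc i))) \<and>
    (\<forall>i<n. \<forall>k<n. (\<Sum>j<n. A i j * K j k) = of_bool (i = k)) \<and>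
    (\<forall>i<n. 0 < x i) \<and> (\<forall>i<n. 0 < (\<Sum>j<n. A i j * x j))"
proof -
  have mono: "mono \<sigma>" using \<sigma> by (intro incseq_SucI less_imp_le)
  have smono: "i < j \<Longrightarrow> \<sigma> i < \<sigma> j" for i j using lift_Suc_mono_less[of \<sigma>] \<sigma> by blast
  have y_nonneg: "0 \<le> y i" if "y 0 = 0" "\<And>i. 0 \<le> difference_quotient \<sigma> y i" for y :: "nat \<Rightarrow> real" and i
  proof (induction i)
    case (Suc i)
    then show ?case using that(2)[of i] \<sigma>[of i] by (auto simp: difference_quotient_def zero_le_divide_iff)
  qed (simp add: that)
  define G where "G y i = difference_quotient \<sigma> y i - of_bool (Suc i < n) * difference_quotient \<sigma> y (Suc i)" for y i
  define h where "h = G b"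
  define \<eta> where "\<eta> = G \<phi>"
  have h: "0 \<le> h i" and \<eta>: "0 \<le> \<eta> i" for i
    using b[of i] \<phi>[of i] by (auto simp: h_def \<eta>_def G_def of_bool_def)
  have M0: "(\<Sum>j<n. min_inverse n \<sigma> i j * min (\<sigma> (Suc j)) (\<sigma> (Suc k))) = of_bool (i = k)"
    if "i < n" "k < n" for i k
  proof -
    \<comment> \<open>A column of the minimum matrix has slope 1 up to its index and 0 afterwards,
      so its second difference is a unit vector.\<close>
    have "difference_quotient \<sigma> (\<lambda>l. min (\<sigma> l) (\<sigma> (Suc k))) i = of_bool (i \<le> k)" for i
    proof (cases "i \<le> k")
      case True
      then have "\<sigma> i \<le> \<sigma> (Suc k)" "\<sigma> (Suc i) \<le> \<sigma> (Suc k)" using mono by (auto simp: mono_def)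
      then show ?thesis using True \<sigma>[of i] by (simp add: difference_quotient_def)
    next
      case False
      then have "\<sigma> (Suc k) \<le> \<sigma> i" "\<sigma> (Suc k) \<le> \<sigma> (Suc i)" using mono by (auto simp: mono_def)
      then show ?thesis using False by (simp add: difference_quotient_def)
    qed
    moreover have "min (\<sigma> 0) (\<sigma> (Suc k)) = 0" using smono[of 0 "Suc k"] \<sigma>0 by simp
    ultimately show ?thesis
      using min_inverse_apply[of i n "\<lambda>l. min (\<sigma> l) (\<sigma> (Suc k))" \<sigma>] that by auto
  qed
  have \<eta>K: "(\<Sum>j<n. \<eta> j * min (\<sigma> (Suc j)) (\<sigma> (Suc k))) = \<phi> (Suc k)" if k: "k < n" for k
  proof -
    have "(\<Sum>j<n. \<eta> j * min (\<sigma> (Suc j)) (\<sigma> (Suc k))) =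
        (\<Sum>j<n. \<Sum>l<n. min_inverse n \<sigma> j l * \<phi> (Suc l) * min (\<sigma> (Suc j)) (\<sigma> (Suc k)))"
      unfolding \<eta>_def G_def
      by (intro sum.cong refl) (subst min_inverse_apply[symmetric], auto simp: \<phi>0 sum_distrib_right)
    \<comment> \<open>Symmetry of \<open>min_inverse\<close> allows it to act on the column of
      minima instead of on \<open>\<phi>\<close>.\<close>
    also have "\<dots> = (\<Sum>l<n. \<phi> (Suc l) * (\<Sum>j<n. min_inverse n \<sigma> l j * min (\<sigma> (Suc j)) (\<sigma> (Suc k))))"
      by (subst sum.swap) (simp add: sum_distrib_left min_inverse_sym[of n \<sigma> _ l for l] mult_ac)
    also have "\<dots> = (\<Sum>l<n. \<phi> (Suc l) * of_bool (l = k))"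
      by (intro sum.cong refl) (simp add: M0 k)
    also have "\<dots> = \<phi> (Suc k)"
      using k sum.delta[of "{..<n}" k "\<lambda>l. \<phi> (Suc l)"] by (simp add: of_bool_def if_distrib[where f = "\<lambda>x. _ * x"] cong: if_cong)
    finally show ?thesis .
  qed
  define c where "c = 1 + (\<Sum>j<n. \<eta> j * b (Suc j))"
  have c: "1 \<le> c" unfolding c_def using \<eta> y_nonneg[OF b0 b(1)] by (auto intro!: sum_nonneg)
  define A where "A i j = min_inverse n \<sigma> i j - h i * \<eta> j / c" for i j
  \<comment> \<open>The row sums of \<open>K\<close> form the vector that \<open>A\<close> maps to
    the all-ones vector.\<close>
  define x where "x i = (\<Sum>k<n. K i k)" for i
  have inv: "(\<Sum>j<n. A i j * K j k) = of_bool (i = k)" if i: "i < n" and k: "k < n" for i k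
  proof -
    have "(\<Sum>j<n. A i j * K j k) =
        (\<Sum>j<n. min_inverse n \<sigma> i j * min (\<sigma> (Suc j)) (\<sigma> (Suc k))
          + \<phi> (Suc k) * (min_inverse n \<sigma> i j * b (Suc j))
          - h i / c * (\<eta> j * min (\<sigma> (Suc j)) (\<sigma> (Suc k)))
          - h i / c * \<phi> (Suc k) * (\<eta> j * b (Suc j)))"
      by (intro sum.cong refl) (simp add: A_def K_def algebra_simps)
    also have "\<dots> = of_bool (i = k) + \<phi> (Suc k) * h i - h i / c * \<phi> (Suc k) - h i / c * \<phi> (Suc k) * (c - 1)"
      unfolding sum_subtractf sum.distrib sum_distrib_left[symmetric] M0[OF that] \<eta>K[OF k]
        min_inverse_apply[OF i, of b, OF b0] by (simp add: c_def h_def G_def)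
    also have "\<dots> = of_bool (i = k)" using c by (simp add: field_simps)
    finally show ?thesis .
  qed
  have Kpos: "0 < K i j" for i j
    unfolding K_def using smono[of 0 "Suc i"] smono[of 0 "Suc j"] \<sigma>0 y_nonneg[OF b0 b(1), of "Suc i"] y_nonneg[OF \<phi>0 \<phi>(1), of "Suc j"]
    by (intro add_pos_nonneg) auto
  show ?thesis
  proof (intro exI[of _ A] exI[of _ x] conjI allI impI)
    fix i assume i: "i < n"
    have hn: "0 \<le> h i * \<eta> j / c" for j using h \<eta> c by simp
    show "A i j \<le> 0" if "i \<noteq> j" for j
      using hn[of j] that \<sigma>[of i] \<sigma>[of "Suc i"] by (auto simp: A_def min_inverse_def of_bool_def intro: order_trans[of _ 0])
    \<comment> \<open>The last row lacks the second summand; adding it there too gives a bound that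
      does not depend on \<open>n\<close>.\<close>
    show "A i i \<le> 1 / (\<sigma> (Suc i) - \<sigma> i) + 1 / (\<sigma> (Suc (Suc i)) - \<sigma> (Suc i))"
    proof -
      have "0 \<le> 1 / (\<sigma> (Suc (Suc i)) - \<sigma> (Suc i))" using \<sigma>[of "Suc i"] by simp
      then have "of_bool (Suc i < n) / (\<sigma> (Suc (Suc i)) - \<sigma> (Suc i)) \<le> 1 / (\<sigma> (Suc (Suc i)) - \<sigma> (Suc i))"
        by (cases "Suc i < n") auto
      moreover have "A i i = 1 / (\<sigma> (Suc i) - \<sigma> i) + of_bool (Suc i < n) / (\<sigma> (Suc (Suc i)) - \<sigma> (Suc i)) - h i * \<eta> i / c"
        by (simp add: A_def min_inverse_def)
      ultimately show ?thesis using hn[of i] by linarith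
    qed
    show "(\<Sum>j<n. A i j * K j k) = of_bool (i = k)" if "k < n" for k by (rule inv[OF i that])
    show "0 < x i" unfolding x_def using i by (intro sum_pos Kpos) auto
    have "(\<Sum>j<n. A i j * x j) = (\<Sum>k<n. \<Sum>j<n. A i j * K j k)"
      unfolding x_def sum_distrib_left by (rule sum.swap)
    also have "\<dots> = (\<Sum>k<n. of_bool (i = k))" by (intro sum.cong refl inv i) simp
    also have "\<dots> = 1" using i by (simp add: of_bool_def)
    finally show "0 < (\<Sum>j<n. A i j * x j)" by simp
  qed
qed

subsection \<open>Chaining\<close>

text \<open>The set is halved repeatedly; the induction is on the number of halvings left.\<close>

lemma dyadic_chaining_aux:
  fixes Y :: "nat \<Rightarrow> 'w \<Rightarrow> real" and x :: "nat \<Rightarrow> real"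
  assumes M: "prob_space M" and Y: "\<And>i. i \<in> I \<Longrightarrow> Y i \<in> borel_measurable M"
    and mono: "\<And>i j. i \<in> I \<Longrightarrow> j \<in> I \<Longrightarrow> i < j \<Longrightarrow> x i < x j"
    and step: "\<And>l i j. i \<in> I \<Longrightarrow> j \<in> I \<Longrightarrow> i < j \<Longrightarrow> x j - x i \<le> L / 2 ^ l \<Longrightarrow>
      measure M {\<omega> \<in> space M. \<epsilon> l < \<bar>Y j \<omega> - Y i \<omega>\<bar>} \<le> p l"
    and p: "\<And>l. 0 \<le> p l" and \<epsilon>: "\<And>l. 0 \<le> \<epsilon> l"
  shows "finite J \<Longrightarrow> J \<subseteq> I \<Longrightarrow> J \<noteq> {} \<Longrightarrow> (\<And>j. j \<in> J \<Longrightarrow> a \<le> x j \<and> x j < a + L / 2 ^ l) \<Longrightarrow>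
    (\<And>i j. i \<in> J \<Longrightarrow> j \<in> J \<Longrightarrow> i < j \<Longrightarrow> L / 2 ^ (l + m) \<le> x j - x i) \<Longrightarrow>
    measure M {\<omega> \<in> space M. \<exists>j\<in>J. (\<Sum>k=l..<l + m. \<epsilon> k) < \<bar>Y j \<omega> - Y (Min J) \<omega>\<bar>} \<le> (\<Sum>k=l..<l + m. 2 ^ (k - l) * p k)"
proof (induction m arbitrary: J a l)
  case 0
  \<comment> \<open>With no halving left, distinct points are at least as far apart as the interval
    is long, so \<open>J\<close> is a singleton.\<close>
  have "j = Min J" if "j \<in> J" for j
  proof (rule ccontr)
    assume "j \<noteq> Min J"
    then have "Min J < j" using that Min_le[OF 0(1) that] by simp
    moreover have "Min J \<in> J" using 0 by simp
    ultimately show False using 0(4)[OF that] 0(4)[of "Min J"] 0(5)[of "Min J" j] that by simp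
  qed
  then have "{\<omega> \<in> space M. \<exists>j\<in>J. (\<Sum>k=l..<l + 0. \<epsilon> k) < \<bar>Y j \<omega> - Y (Min J) \<omega>\<bar>} = {}" by auto
  then show ?case by (simp only: measure_empty) simp
next
  case (Suc m)
  interpret M: prob_space M by fact
  define B where "B J l = {\<omega> \<in> space M. \<exists>j\<in>J. (\<Sum>k=l..<l + m. \<epsilon> k) < \<bar>Y j \<omega> - Y (Min J) \<omega>\<bar>}" for J l
  define q where "q = (\<Sum>k=Suc l..<Suc l + m. 2 ^ (k - Suc l) * p k)"
  have q0: "0 \<le> q" unfolding q_def using p by (intro sum_nonneg) auto
  \<comment> \<open>Each halving doubles the number of pieces, hence the weight
    \<open>2 ^ (k - l)\<close> on level \<open>k\<close>.\<close>
  have qsum: "(\<Sum>k=l..<l + Suc m. 2 ^ (k - l) * p k) = p l + 2 * q"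
  proof -
    have "(\<Sum>k=l..<l + Suc m. 2 ^ (k - l) * p k) = p l + (\<Sum>k=Suc l..<Suc l + m. 2 ^ (k - l) * p k)"
      by (subst sum.atLeast_Suc_lessThan) auto
    also have "(\<Sum>k=Suc l..<Suc l + m. 2 ^ (k - l) * p k) = 2 * q"
      unfolding q_def sum_distrib_left
    proof (intro sum.cong refl)
      fix k assume "k \<in> {Suc l..<Suc l + m}"
      then have "k - l = Suc (k - Suc l)" by auto
      then show "2 ^ (k - l) * p k = 2 * (2 ^ (k - Suc l) * p k)" by simp
    qed
    finally show ?thesis .
  qed
  have esum: "(\<Sum>k=l..<l + Suc m. \<epsilon> k) = \<epsilon> l + (\<Sum>k=Suc l..<Suc l + m. \<epsilon> k)"
    by (subst sum.atLeast_Suc_lessThan) auto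
  define J1 where "J1 = {j \<in> J. x j < a + L / 2 ^ Suc l}"
  define J2 where "J2 = {j \<in> J. a + L / 2 ^ Suc l \<le> x j}"
  have J: "J = J1 \<union> J2" "finite J1" "finite J2" "J1 \<subseteq> I" "J2 \<subseteq> I"
    using Suc.prems(1,2) by (auto simp: J1_def J2_def)
  have fm: "finite J'" if "J' \<subseteq> J" for J' using that Suc.prems(1) by (rule finite_subset)
  have Bm: "B J' (Suc l) \<in> sets M" if "J' \<subseteq> J" "J' \<noteq> {}" for J'
  proof -
    have 1: "Y j \<in> borel_measurable M" if "j \<in> J'" for j
      using that \<open>J' \<subseteq> J\<close> Suc.prems(2) Y by blast
    have 2: "Min J' \<in> J'" using fm that by simp
    have "(\<Union>j\<in>J'. {\<omega> \<in> space M. (\<Sum>k=Suc l..<Suc l + m. \<epsilon> k) < \<bar>Y j \<omega> - Y (Min J') \<omega>\<bar>}) \<in> sets M"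
      by (intro sets.finite_UN fm that borel_measurable_less borel_measurable_const borel_measurable_abs borel_measurable_diff 1 2)
    also have "(\<Union>j\<in>J'. {\<omega> \<in> space M. (\<Sum>k=Suc l..<Suc l + m. \<epsilon> k) < \<bar>Y j \<omega> - Y (Min J') \<omega>\<bar>}) = B J' (Suc l)"
      by (auto simp: B_def)
    finally show ?thesis .
  qed
  have ih: "measure M (B J' (Suc l)) \<le> q" if "J' \<subseteq> J" "J' \<noteq> {}" "\<And>j. j \<in> J' \<Longrightarrow> a' \<le> x j \<and> x j < a' + L / 2 ^ Suc l" for J' a'
    unfolding B_def q_def
    by (rule Suc.IH[of J' a' "Suc l"]) (use that Suc.prems fm in \<open>auto simp: subset_iff\<close>)
  have sub: "{\<omega> \<in> space M. \<exists>j\<in>J'. (\<Sum>k=l..<l + Suc m. \<epsilon> k) < \<bar>Y j \<omega> - Y (Min J') \<omega>\<bar>} \<subseteq> B J' (Suc l)" for J'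
    unfolding B_def esum using \<epsilon>[of l] by force
  have half: "L / 2 ^ l = L / 2 ^ Suc l + L / 2 ^ Suc l" by (simp add: field_simps)
  consider "J1 = {}" | "J2 = {}" | "J1 \<noteq> {}" "J2 \<noteq> {}" by blast
  then show ?case
  proof cases
    case 1
    then have "J2 = J" using J by simp
    have "measure M {\<omega> \<in> space M. \<exists>j\<in>J. (\<Sum>k=l..<l + Suc m. \<epsilon> k) < \<bar>Y j \<omega> - Y (Min J) \<omega>\<bar>} \<le> measure M (B J (Suc l))"
      by (rule M.finite_measure_mono[OF sub Bm]) (use Suc.prems in auto)
    also have "\<dots> \<le> q"
    proof (rule ih[of J "a + L / 2 ^ Suc l"])
      fix j assume "j \<in> J"
      then have "j \<in> J" "a + L / 2 ^ Suc l \<le> x j" using \<open>J2 = J\<close> unfolding J2_def by auto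
      then show "a + L / 2 ^ Suc l \<le> x j \<and> x j < a + L / 2 ^ Suc l + L / 2 ^ Suc l"
        using Suc.prems(4)[of j] half by linarith
    qed (use Suc.prems(3) in auto)
    finally show ?thesis using qsum q0 p[of l] by linarith
  next
    case 2
    then have "J1 = J" using J by simp
    have "measure M {\<omega> \<in> space M. \<exists>j\<in>J. (\<Sum>k=l..<l + Suc m. \<epsilon> k) < \<bar>Y j \<omega> - Y (Min J) \<omega>\<bar>} \<le> measure M (B J (Suc l))"
      by (rule M.finite_measure_mono[OF sub Bm]) (use Suc.prems in auto)
    also have "\<dots> \<le> q"
    proof (rule ih[of J "a"])
      fix j assume "j \<in> J"
      then have "j \<in> J" "x j < a + L / 2 ^ Suc l" using \<open>J1 = J\<close> unfolding J1_def by auto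
      then show "a \<le> x j \<and> x j < a + L / 2 ^ Suc l"
        using Suc.prems(4)[of j] half by linarith
    qed (use Suc.prems(3) in auto)
    finally show ?thesis using qsum q0 p[of l] by linarith
  next
    case 3
    define i1 where "i1 = Min J1"
    define i2 where "i2 = Min J2"
    have i: "i1 \<in> J1" "i2 \<in> J2" using 3 J by (auto simp: i1_def i2_def)
    have lt: "j < j'" if "j \<in> J1" "j' \<in> J2" for j j'
    proof (rule ccontr)
      assume "\<not> j < j'"
      then have "j' < j \<or> j' = j" by auto
      moreover have "x j < x j'" using that by (auto simp: J1_def J2_def)
      ultimately show False using mono[of j' j] that J(4,5) by auto
    qed
    have minJ: "Min J = i1"
    proof (rule Min_eqI[OF Suc.prems(1)])
      show "i1 \<le> j" if "j \<in> J" for j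
        using that J lt[OF i(1)] Min_le[OF J(2), of j] by (auto simp: i1_def[symmetric] less_imp_le)
      show "i1 \<in> J" using i J by auto
    qed
    \<comment> \<open>The minimum of \<open>J\<close> is that of its left half, so the left half
      needs no link; the only new increment at this level joins the two minima. If one half is empty
      there is no increment at all.\<close>
    define C where "C = {\<omega> \<in> space M. \<epsilon> l < \<bar>Y i2 \<omega> - Y i1 \<omega>\<bar>}"
    have iI: "i1 \<in> I" "i2 \<in> I" using i J by auto
    have Cm: "C \<in> sets M" unfolding C_def
      by (intro borel_measurable_less borel_measurable_const borel_measurable_abs borel_measurable_diff Y iI)
    have xx: "x i2 - x i1 \<le> L / 2 ^ l"
      using Suc.prems(4)[of i1] Suc.prems(4)[of i2] i J by auto
    have C: "measure M C \<le> p l"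
      unfolding C_def by (rule step[OF iI lt[OF i] xx])
    have "{\<omega> \<in> space M. \<exists>j\<in>J. (\<Sum>k=l..<l + Suc m. \<epsilon> k) < \<bar>Y j \<omega> - Y (Min J) \<omega>\<bar>} \<subseteq> C \<union> (B J1 (Suc l) \<union> B J2 (Suc l))"
    proof
      fix \<omega> assume "\<omega> \<in> {\<omega> \<in> space M. \<exists>j\<in>J. (\<Sum>k=l..<l + Suc m. \<epsilon> k) < \<bar>Y j \<omega> - Y (Min J) \<omega>\<bar>}"
      then obtain j where j: "\<omega> \<in> space M" "j \<in> J" "\<epsilon> l + (\<Sum>k=Suc l..<Suc l + m. \<epsilon> k) < \<bar>Y j \<omega> - Y i1 \<omega>\<bar>"
        unfolding esum minJ by blast
      show "\<omega> \<in> C \<union> (B J1 (Suc l) \<union> B J2 (Suc l))"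
      proof (cases "j \<in> J1")
        case True
        then have "\<omega> \<in> B J1 (Suc l)"
          using j \<epsilon>[of l] unfolding B_def i1_def[symmetric] by (intro CollectI conjI bexI[of _ j]) auto
        then show ?thesis by simp
      next
        case False
        then have j2: "j \<in> J2" using j J by auto
        show ?thesis
        proof (cases "\<omega> \<in> C")
          case False
          then have "\<bar>Y i2 \<omega> - Y i1 \<omega>\<bar> \<le> \<epsilon> l" using j(1) by (simp add: C_def)
          then have "(\<Sum>k=Suc l..<Suc l + m. \<epsilon> k) < \<bar>Y j \<omega> - Y i2 \<omega>\<bar>" using j(3) by linarith
          then have "\<omega> \<in> B J2 (Suc l)"
            using j(1) j2 unfolding B_def i2_def[symmetric] by blast
          then show ?thesis by simp
        qed simp
      qed
    qed
    then have "measure M {\<omega> \<in> space M. \<exists>j\<in>J. (\<Sum>k=l..<l + Suc m. \<epsilon> k) < \<bar>Y j \<omega> - Y (Min J) \<omega>\<bar>} \<le>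
        measure M (C \<union> (B J1 (Suc l) \<union> B J2 (Suc l)))"
      by (rule M.finite_measure_mono) (use Cm Bm[of J1] Bm[of J2] 3 J in auto)
    also have "\<dots> \<le> measure M C + measure M (B J1 (Suc l) \<union> B J2 (Suc l))"
      by (rule measure_Un_le) (use Cm Bm[of J1] Bm[of J2] 3 J in auto)
    also have "measure M (B J1 (Suc l) \<union> B J2 (Suc l)) \<le> measure M (B J1 (Suc l)) + measure M (B J2 (Suc l))"
      by (rule measure_Un_le) (use Bm[of J1] Bm[of J2] 3 J in auto)
    also have "measure M (B J1 (Suc l)) \<le> q"
    proof (rule ih[of J1 "a"])
      fix j assume "j \<in> J1"
      then have "j \<in> J" "x j < a + L / 2 ^ Suc l" unfolding J1_def by auto
      then show "a \<le> x j \<and> x j < a + L / 2 ^ Suc l"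
        using Suc.prems(4)[of j] half by linarith
    qed (use 3 J(1) in auto)
    also have "measure M (B J2 (Suc l)) \<le> q"
    proof (rule ih[of J2 "a + L / 2 ^ Suc l"])
      fix j assume "j \<in> J2"
      then have "j \<in> J" "a + L / 2 ^ Suc l \<le> x j" unfolding J2_def by auto
      then show "a + L / 2 ^ Suc l \<le> x j \<and> x j < a + L / 2 ^ Suc l + L / 2 ^ Suc l"
        using Suc.prems(4)[of j] half by linarith
    qed (use 3 J(1) in auto)
    finally show ?thesis using C qsum by linarith
  qed
qed

text \<open>A finite set has a smallest gap, so finitely many halvings separate its points. The
  bounds \<open>E\<close> and \<open>P\<close> hold for every number of levels, and the gap leaves
  no trace in the conclusion.\<close>

lemma dyadic_chaining:
  fixes Y :: "nat \<Rightarrow> 'w \<Rightarrow> real" and x :: "nat \<Rightarrow> real"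
  assumes M: "prob_space M" and Y: "\<And>i. i \<in> J \<Longrightarrow> Y i \<in> borel_measurable M"
    and mono: "\<And>i j. i \<in> J \<Longrightarrow> j \<in> J \<Longrightarrow> i < j \<Longrightarrow> x i < x j"
    and step: "\<And>l i j. i \<in> J \<Longrightarrow> j \<in> J \<Longrightarrow> i < j \<Longrightarrow> x j - x i \<le> L / 2 ^ l \<Longrightarrow>
      measure M {\<omega> \<in> space M. \<epsilon> l < \<bar>Y j \<omega> - Y i \<omega>\<bar>} \<le> p l"
    and p: "\<And>l. 0 \<le> p l" and \<epsilon>: "\<And>l. 0 \<le> \<epsilon> l"
    and J: "finite J" "J \<noteq> {}" and L: "0 < L" and range: "\<And>j. j \<in> J \<Longrightarrow> a \<le> x j \<and> x j < a + L"
    and e: "\<And>m. (\<Sum>k<m. \<epsilon> k) \<le> E" and P: "\<And>m. (\<Sum>k<m. 2 ^ k * p k) \<le> P"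
  shows "measure M {\<omega> \<in> space M. \<exists>j\<in>J. E < \<bar>Y j \<omega> - Y (Min J) \<omega>\<bar>} \<le> P"
proof -
  interpret M: prob_space M by fact
  have "\<exists>m. \<forall>i\<in>J. \<forall>j\<in>J. i < j \<longrightarrow> L / 2 ^ m \<le> x j - x i"
  proof -
    have lim: "(\<lambda>m. L / 2 ^ m) \<longlonglongrightarrow> 0"
      by (rule LIMSEQ_divide_realpow_zero) simp
    have "eventually (\<lambda>m. i < j \<longrightarrow> L / 2 ^ m \<le> x j - x i) sequentially" if "i \<in> J" "j \<in> J" for i j
    proof (cases "i < j")
      case True
      have "eventually (\<lambda>m. L / 2 ^ m < x j - x i) sequentially"
        using mono[OF that True] by (intro order_tendstoD(2)[OF lim]) simp
      then show ?thesis by eventually_elim simp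
    qed simp
    then have "eventually (\<lambda>m. \<forall>i\<in>J. \<forall>j\<in>J. i < j \<longrightarrow> L / 2 ^ m \<le> x j - x i) sequentially"
      by (intro eventually_ball_finite ballI J(1))
    then show ?thesis by (auto simp: eventually_sequentially)
  qed
  then obtain m where m: "\<And>i j. i \<in> J \<Longrightarrow> j \<in> J \<Longrightarrow> i < j \<Longrightarrow> L / 2 ^ m \<le> x j - x i" by blast
  have s: "{0..<0 + m} = {..<m}" by auto
  have "measure M {\<omega> \<in> space M. \<exists>j\<in>J. E < \<bar>Y j \<omega> - Y (Min J) \<omega>\<bar>} \<le>
      measure M {\<omega> \<in> space M. \<exists>j\<in>J. (\<Sum>k=0..<0 + m. \<epsilon> k) < \<bar>Y j \<omega> - Y (Min J) \<omega>\<bar>}"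
  proof (rule M.finite_measure_mono)
    show "{\<omega> \<in> space M. \<exists>j\<in>J. E < \<bar>Y j \<omega> - Y (Min J) \<omega>\<bar>} \<subseteq>
      {\<omega> \<in> space M. \<exists>j\<in>J. (\<Sum>k=0..<0 + m. \<epsilon> k) < \<bar>Y j \<omega> - Y (Min J) \<omega>\<bar>}"
      using e[of m] unfolding s by force
    have "(\<Union>j\<in>J. {\<omega> \<in> space M. (\<Sum>k=0..<0 + m. \<epsilon> k) < \<bar>Y j \<omega> - Y (Min J) \<omega>\<bar>}) \<in> sets M"
      by (intro sets.finite_UN J borel_measurable_less borel_measurable_const borel_measurable_abs borel_measurable_diff Y Min_in)
    also have "(\<Union>j\<in>J. {\<omega> \<in> space M. (\<Sum>k=0..<0 + m. \<epsilon> k) < \<bar>Y j \<omega> - Y (Min J) \<omega>\<bar>}) =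
      {\<omega> \<in> space M. \<exists>j\<in>J. (\<Sum>k=0..<0 + m. \<epsilon> k) < \<bar>Y j \<omega> - Y (Min J) \<omega>\<bar>}" by auto
    finally show "{\<omega> \<in> space M. \<exists>j\<in>J. (\<Sum>k=0..<0 + m. \<epsilon> k) < \<bar>Y j \<omega> - Y (Min J) \<omega>\<bar>} \<in> sets M" .
  qed
  also have "\<dots> \<le> (\<Sum>k=0..<0 + m. 2 ^ (k - 0) * p k)"
    by (rule dyadic_chaining_aux[OF M Y mono step p \<epsilon> J(1) subset_refl J(2), where a = a and L = L])
      (use range m in auto)
  also have "\<dots> = (\<Sum>k<m. 2 ^ k * p k)" unfolding s by simp
  also have "\<dots> \<le> P" by (rule P)
  finally show ?thesis .
qed

subsection \<open>Concave functions and limits\<close>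

lemma concave_on_increment:
  fixes f :: "real \<Rightarrow> real"
  assumes "concave_on {0..} f" "0 \<le> x" "x < y" "y < z"
  shows "(f z - f y) / (z - y) \<le> (f y - f x) / (y - x)"
proof -
  have "(z - y) / (z - x) * f x + (y - x) / (z - x) * f z \<le>
      f (((z - y) / (z - x)) *\<^sub>R x + ((y - x) / (z - x)) *\<^sub>R z)"
  proof -
    have "u * f p + v * f q \<le> f (u *\<^sub>R p + v *\<^sub>R q)"
      if "0 \<le> p" "0 \<le> q" "0 \<le> u" "0 \<le> v" "u + v = 1" for p q u v
      using assms(1) that by (auto simp: concave_on_iff)
    from this[of x z "(z - y) / (z - x)" "(y - x) / (z - x)"] show ?thesis
      using assms by (simp add: add_divide_distrib[symmetric])
  qed
  also have "((z - y) / (z - x)) *\<^sub>R x + ((y - x) / (z - x)) *\<^sub>R z = y"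
  proof -
    have "(z - y) * x + (y - x) * z = y * (z - x)" by (simp add: algebra_simps)
    then show ?thesis using assms by (simp add: add_divide_distrib[symmetric])
  qed
  finally have "((z - y) * f x + (y - x) * f z) / (z - x) \<le> f y" by (simp add: add_divide_distrib)
  then have "(z - y) * f x + (y - x) * f z \<le> f y * (z - x)" using assms by (simp add: divide_le_eq)
  then have "(f z - f y) * (y - x) \<le> (f y - f x) * (z - y)" by (simp add: algebra_simps)
  then show ?thesis using assms by (simp add: divide_le_eq pos_le_divide_eq)
qed

lemma concave_on_ratio:
  fixes f :: "real \<Rightarrow> real"
  assumes "concave_on {0..} f" "0 \<le> f 0" "0 < x" "x \<le> y"
  shows "f y * x \<le> f x * y"
proof (cases "x = y")
  case False
  then have "(f y - f x) / (y - x) \<le> (f x - f 0) / (x - 0)"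
    using assms by (intro concave_on_increment) auto
  then have "(f y - f x) * x \<le> (f x - f 0) * (y - x)" using assms False by (simp add: divide_le_eq pos_le_divide_eq mult.commute)
  also have "\<dots> \<le> f x * (y - x)" using assms by (intro mult_right_mono) auto
  finally show ?thesis by (simp add: algebra_simps)
qed simp

text \<open>The value at index 0 is 0 instead of \<open>f 0 \<ge> 0\<close>. This only raises the
  first slope, so slopes stay nonnegative and decreasing.\<close>

lemma concave_difference_quotients:
  fixes f :: "real \<Rightarrow> real"
  assumes f: "concave_on {0..} f" "mono_on {0..} f" "\<And>x. 0 \<le> x \<Longrightarrow> 0 \<le> f x"
    and \<sigma>: "\<sigma> 0 = 0" "\<And>i. \<sigma> i < \<sigma> (Suc i)"
    and y: "y 0 = 0" "\<And>i. y (Suc i) = f (\<sigma> (Suc i))"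
  shows "0 \<le> difference_quotient \<sigma> y i"
    and "difference_quotient \<sigma> y (Suc i) \<le> difference_quotient \<sigma> y i"
proof -
  have pos: "0 \<le> \<sigma> i" for i using lift_Suc_mono_le[of \<sigma> 0 i] \<sigma> by (simp add: less_imp_le)
  have y_le: "y i \<le> f (\<sigma> i)" for i using y \<sigma>(1) f(3)[of 0] by (cases i) auto
  have "f (\<sigma> i) \<le> f (\<sigma> (Suc i))" using f(2) pos[of i] \<sigma>(2)[of i] by (auto simp: mono_on_def)
  then show "0 \<le> difference_quotient \<sigma> y i"
    using y_le[of i] y(2)[of i] \<sigma>(2)[of i] by (simp add: difference_quotient_def)
  have "difference_quotient \<sigma> y (Suc i) = (f (\<sigma> (Suc (Suc i))) - f (\<sigma> (Suc i))) / (\<sigma> (Suc (Suc i)) - \<sigma> (Suc i))"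
    by (simp add: difference_quotient_def y)
  also have "\<dots> \<le> (f (\<sigma> (Suc i)) - f (\<sigma> i)) / (\<sigma> (Suc i) - \<sigma> i)"
    by (rule concave_on_increment[OF f(1) pos \<sigma>(2) \<sigma>(2)])
  also have "\<dots> \<le> difference_quotient \<sigma> y i"
    unfolding difference_quotient_def y(2) using y_le[of i] \<sigma>(2)[of i] by (intro divide_right_mono) auto
  finally show "difference_quotient \<sigma> y (Suc i) \<le> difference_quotient \<sigma> y i" .
qed

text \<open>A nonnegative combination of the concave increasing functions
  \<open>min x (a k)\<close>. With \<open>f = Wh\<close> the function \<open>b f\<close> has this
  form in the variable \<open>s\<close>.\<close>

lemma sum_min_concave:
  fixes a \<eta> :: "nat \<Rightarrow> real"
  assumes a: "\<And>k. 1 \<le> k \<Longrightarrow> 0 < a k" and \<eta>: "\<And>k. 1 \<le> k \<Longrightarrow> 0 \<le> \<eta> k" and sum: "\<eta> summable_on {1..}"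
  defines "\<Phi> \<equiv> \<lambda>x. \<Sum>\<^sub>\<infinity>k\<in>{1..}. min x (a k) * \<eta> k"
  shows "concave_on {0..} \<Phi>" and "mono_on {0..} \<Phi>" and "0 \<le> x \<Longrightarrow> 0 \<le> \<Phi> x"
proof -
  have S: "(\<lambda>k. min x (a k) * \<eta> k) summable_on {1..}" if "0 \<le> x" for x
    by (rule summable_on_comparison_test[OF summable_on_cmult_right[OF sum, of x]])
      (use that a \<eta> in \<open>auto intro!: mult_right_mono mult_nonneg_nonneg simp: less_imp_le\<close>)
  show "0 \<le> x \<Longrightarrow> 0 \<le> \<Phi> x" unfolding \<Phi>_def
    using a \<eta> by (intro infsum_nonneg) (auto simp: less_imp_le)
  show "mono_on {0..} \<Phi>" unfolding \<Phi>_def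
    by (intro mono_onI infsum_mono S) (auto intro!: mult_right_mono \<eta>)
  show "concave_on {0..} \<Phi>"
    unfolding concave_on_iff
  proof (intro conjI ballI allI impI)
    fix x y u v :: real
    assume xy: "x \<in> {0..}" "y \<in> {0..}" and uv: "0 \<le> u" "0 \<le> v" "u + v = 1"
    have z: "0 \<le> u * x + v * y" using xy uv by simp
    have "u * \<Phi> x + v * \<Phi> y = (\<Sum>\<^sub>\<infinity>k\<in>{1..}. u * (min x (a k) * \<eta> k) + v * (min y (a k) * \<eta> k))"
      unfolding \<Phi>_def infsum_cmult_right'[symmetric]
      by (rule infsum_add[symmetric]; rule summable_on_cmult_right, rule S) (use xy in auto)
    also have "\<dots> \<le> \<Phi> (u * x + v * y)"
      unfolding \<Phi>_def
    proof (rule infsum_mono)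
      show "(\<lambda>k. u * (min x (a k) * \<eta> k) + v * (min y (a k) * \<eta> k)) summable_on {1..}"
        using xy by (intro summable_on_add summable_on_cmult_right S) auto
      show "(\<lambda>k. min (u * x + v * y) (a k) * \<eta> k) summable_on {1..}" by (rule S[OF z])
      fix k :: nat assume k: "k \<in> {1..}"
      have "u * min x (a k) + v * min y (a k) \<le> min (u * x + v * y) (a k)"
      proof (rule min.boundedI)
        show "u * min x (a k) + v * min y (a k) \<le> u * x + v * y"
          using uv by (intro add_mono mult_left_mono) auto
        have "u * min x (a k) + v * min y (a k) \<le> u * a k + v * a k"
          using uv by (intro add_mono mult_left_mono) auto
        also have "\<dots> = a k" using uv by (simp add: distrib_right[symmetric])
        finally show "u * min x (a k) + v * min y (a k) \<le> a k" .
      qed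
      then have "(u * min x (a k) + v * min y (a k)) * \<eta> k \<le> min (u * x + v * y) (a k) * \<eta> k"
        using \<eta> k by (intro mult_right_mono) auto
      then show "u * (min x (a k) * \<eta> k) + v * (min y (a k) * \<eta> k) \<le> min (u * x + v * y) (a k) * \<eta> k"
        by (simp add: algebra_simps)
    qed
    finally show "u * \<Phi> x + v * \<Phi> y \<le> \<Phi> (u *\<^sub>R x + v *\<^sub>R y)" by simp
  qed simp
qed

text \<open>Dominated convergence for series. Each coefficient of \<open>h k\<close> is at most 1:
  for \<open>s j \<le> s k\<close> by monotonicity of \<open>\<beta>\<close>, otherwise because
  \<open>\<beta> x / x\<close> decreases. For fixed \<open>k\<close> it is eventually a constant
  times \<open>\<beta> (s j) / s j\<close>, which tends to 0 by sublinearity.\<close>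

lemma sum_min_product_small:
  fixes s :: "nat \<Rightarrow> real" and \<beta> :: "real \<Rightarrow> real" and h :: "nat \<Rightarrow> real"
  assumes s_pos: "\<And>j. 1 \<le> j \<Longrightarrow> 0 < s j" and s_top: "filterlim s at_top sequentially"
    and \<beta>: "concave_on {0..} \<beta>" "mono_on {0..} \<beta>" "\<And>x. 0 \<le> x \<Longrightarrow> 0 \<le> \<beta> x"
    and \<beta>_pos: "\<And>j. 1 \<le> j \<Longrightarrow> 0 < \<beta> (s j)" and \<beta>_sub: "((\<lambda>x. \<beta> x / x) \<longlongrightarrow> 0) at_top"
    and h: "\<And>k. 1 \<le> k \<Longrightarrow> 0 \<le> h k" "h summable_on {1..}"
  shows "(\<lambda>j. \<beta> (s j) * (\<Sum>\<^sub>\<infinity>k\<in>{1..}. min (s j) (s k) * (h k / \<beta> (s k))) / s j) \<longlonglongrightarrow> 0"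
proof -
  define a where "a k j = (if 1 \<le> k then \<beta> (s j) * (min (s j) (s k) * (h k / \<beta> (s k))) / s j else 0)" for k j
  define H where "H k = (if 1 \<le> k then h k else 0)" for k
  have a_bound: "0 \<le> a k j \<and> a k j \<le> H k" if j: "1 \<le> j" for k j
  proof (cases "1 \<le> k")
    case True
    have p: "0 < s j" "0 < s k" "0 < \<beta> (s j)" "0 < \<beta> (s k)" using s_pos \<beta>_pos j True by auto
    have "\<beta> (s j) * min (s j) (s k) \<le> s j * \<beta> (s k)"
    proof (cases "s j \<le> s k")
      case True
      then have "\<beta> (s j) \<le> \<beta> (s k)" using \<beta>(2) p by (auto simp: mono_on_def)
      then show ?thesis using True p by (simp add: mult.commute)
    next
      case False
      then show ?thesis using concave_on_ratio[OF \<beta>(1) \<beta>(3)[of 0] p(2), of "s j"] by (simp add: mult.commute)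
    qed
    then have "\<beta> (s j) * min (s j) (s k) / (s j * \<beta> (s k)) \<le> 1" using p by (simp add: divide_le_eq)
    then have "\<beta> (s j) * min (s j) (s k) / (s j * \<beta> (s k)) * h k \<le> 1 * h k"
      using h(1)[OF True] by (rule mult_right_mono)
    then show ?thesis using True p h(1)[OF True] by (simp add: a_def H_def mult_ac)
  qed (simp add: a_def H_def)
  have a_lim: "(\<lambda>j. a k j) \<longlonglongrightarrow> 0" for k
  proof (cases "1 \<le> k")
    case True
    have lim: "(\<lambda>j. \<beta> (s j) / s j * (s k * (h k / \<beta> (s k)))) \<longlonglongrightarrow> 0"
      using tendsto_mult_right[OF filterlim_compose[OF \<beta>_sub s_top], of "s k * (h k / \<beta> (s k))"] by simp
    have "eventually (\<lambda>j. s k \<le> s j \<and> 1 \<le> j) sequentially"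
      using s_top eventually_ge_at_top[of 1] unfolding filterlim_at_top by (auto intro: eventually_conj)
    then have "eventually (\<lambda>j. \<beta> (s j) / s j * (s k * (h k / \<beta> (s k))) = a k j) sequentially"
      by eventually_elim (use True in \<open>simp add: a_def\<close>)
    then show ?thesis using lim by (rule Lim_transform_eventually[rotated])
  qed (simp add: a_def)
  have H_sum: "summable H"
  proof -
    have "H summable_on UNIV \<longleftrightarrow> h summable_on {1..}"
      by (rule summable_on_cong_neutral) (auto simp: H_def)
    then show ?thesis using h(2) summable_on_imp_summable by blast
  qed
  have "(\<lambda>j. \<Sum>k. a k j) \<longlonglongrightarrow> (\<Sum>k. 0 :: real)"
  proof (rule tannerys_theorem[THEN conjunct2, THEN conjunct2, OF a_lim _ H_sum])
    show "eventually (\<lambda>(k, j). norm (a k j) \<le> H k) (at_top \<times>\<^sub>F sequentially)"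
      unfolding eventually_prod_filter
      by (intro exI[of _ "\<lambda>_. True"] exI[of _ "\<lambda>j. 1 \<le> j"])
        (use a_bound eventually_ge_at_top[of "1 :: nat"] in auto)
  qed simp
  moreover have "eventually (\<lambda>j. (\<Sum>k. a k j) = \<beta> (s j) * (\<Sum>\<^sub>\<infinity>k\<in>{1..}. min (s j) (s k) * (h k / \<beta> (s k))) / s j) sequentially"
    using eventually_ge_at_top[of 1]
  proof eventually_elim
    case (elim j)
    have "summable (\<lambda>k. a k j)"
      by (rule summable_comparison_test[OF _ H_sum]) (use a_bound[OF elim] in auto)
    then have "(\<Sum>k. a k j) = (\<Sum>\<^sub>\<infinity>k. a k j)"
      using a_bound[OF elim] by (intro infsumI[symmetric] norm_summable_imp_has_sum summable_sums) auto
    also have "\<dots> = (\<Sum>\<^sub>\<infinity>k\<in>{1..}. (\<beta> (s j) / s j) * (min (s j) (s k) * (h k / \<beta> (s k))))"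
      by (rule infsum_cong_neutral) (auto simp: a_def)
    also have "\<dots> = (\<beta> (s j) / s j) * (\<Sum>\<^sub>\<infinity>k\<in>{1..}. min (s j) (s k) * (h k / \<beta> (s k)))"
      by (rule infsum_cmult_right')
    finally show ?case by simp
  qed
  ultimately show ?thesis by (simp add: filterlim_cong)
qed

text \<open>Constant factors become additive constants under the logarithm, so bounding
  \<open>\<tau>\<close> up to constants is enough to replace \<open>ln (\<tau> j)\<close> by the
  special normalisations.\<close>

lemma ln_equivalent:
  fixes x y :: "nat \<Rightarrow> real"
  assumes x: "filterlim x at_top sequentially" and c: "0 < c" "0 < C"
    and "eventually (\<lambda>j. c * x j \<le> y j \<and> y j \<le> C * x j) sequentially"
  shows "(\<lambda>j. ln (y j) / ln (x j)) \<longlonglongrightarrow> 1"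
proof (rule tendsto_sandwich)
  have lx: "filterlim (\<lambda>j. ln (x j)) at_top sequentially" by (rule filterlim_compose[OF ln_at_top x])
  have lim: "(\<lambda>j. ln a / ln (x j) + 1) \<longlonglongrightarrow> 1" for a
    using tendsto_add[OF tendsto_divide_0[OF tendsto_const filterlim_at_top_imp_at_infinity[OF lx], of "ln a"] tendsto_const[of 1]] by simp
  show "(\<lambda>j. ln c / ln (x j) + 1) \<longlonglongrightarrow> 1" "(\<lambda>j. ln C / ln (x j) + 1) \<longlonglongrightarrow> 1" by (rule lim)+
  have quot: "a + l \<le> b \<Longrightarrow> 0 < l \<Longrightarrow> a / l + 1 \<le> b / l" "b \<le> a + l \<Longrightarrow> 0 < l \<Longrightarrow> b / l \<le> a / l + 1"
    for a b l :: real
    using divide_right_mono[of "a + l" b l] divide_right_mono[of b "a + l" l] by (simp_all add: add_divide_distrib)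
  have ev: "eventually (\<lambda>j. 1 < x j) sequentially" using x unfolding filterlim_at_top_dense by auto
  show "eventually (\<lambda>j. ln c / ln (x j) + 1 \<le> ln (y j) / ln (x j)) sequentially"
    using ev assms(4)
  proof eventually_elim
    case (elim j)
    then have "ln (c * x j) \<le> ln (y j)" using c by (intro ln_mono) auto
    moreover have "ln (c * x j) = ln c + ln (x j)" using elim c by (simp add: ln_mult)
    ultimately show ?case using quot(1)[of "ln c" "ln (x j)" "ln (y j)"] elim(1) by simp
  qed
  show "eventually (\<lambda>j. ln (y j) / ln (x j) \<le> ln C / ln (x j) + 1) sequentially"
    using ev assms(4)
  proof eventually_elim
    case (elim j)
    then have "0 < c * x j" using c by simp
    then have "0 < y j" using elim(2) by linarith
    then have "ln (y j) \<le> ln (C * x j)" using elim by (intro ln_mono) auto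
    moreover have "ln (C * x j) = ln C + ln (x j)" using elim c by (simp add: ln_mult)
    ultimately show ?case using quot(2)[of "ln (y j)" "ln C" "ln (x j)"] elim(1) by simp
  qed
qed

text \<open>The tolerances \<open>1 / Suc k\<close> above and \<open>1 / Suc (Suc k)\<close> below
  match the ranges \<open>\<delta> \<le> 1\<close> of \<open>upper_bound\<close> and
  \<open>\<delta> < 1\<close> of \<open>lower_bound\<close>.\<close>

lemma limsup_eq_1I:
  fixes r :: "nat \<Rightarrow> real"
  assumes up: "\<And>k. eventually (\<lambda>j. r j \<le> 1 + 1 / real (Suc k)) sequentially"
    and low: "\<And>k m. \<exists>j\<ge>m. 1 - 1 / real (Suc (Suc k)) \<le> r j"
  shows "limsup (\<lambda>j. ereal (r j)) = 1"
proof (rule antisym)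
  have lim: "(\<lambda>k. ereal (1 + 1 / real (Suc k))) \<longlonglongrightarrow> ereal (1 + 0)"
    by (intro tendsto_ereal tendsto_add tendsto_const) (use LIMSEQ_inverse_real_of_nat in \<open>simp add: inverse_eq_divide\<close>)
  have "limsup (\<lambda>j. ereal (r j)) \<le> ereal (1 + 1 / real (Suc k))" for k
    by (rule Limsup_bounded) (use up[of k] in simp)
  then show "limsup (\<lambda>j. ereal (r j)) \<le> 1"
    using LIMSEQ_le_const[OF lim] by (auto simp: one_ereal_def)
  have "(\<lambda>k. 1 / real (Suc (Suc k))) \<longlonglongrightarrow> 0"
    using LIMSEQ_Suc[OF LIMSEQ_inverse_real_of_nat] by (simp add: inverse_eq_divide)
  then have lim': "(\<lambda>k. ereal (1 - 1 / real (Suc (Suc k)))) \<longlonglongrightarrow> ereal (1 - 0)"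
    by (intro tendsto_ereal tendsto_diff tendsto_const)
  have "ereal (1 - 1 / real (Suc (Suc k))) \<le> limsup (\<lambda>j. ereal (r j))" for k
    unfolding limsup_INF_SUP
  proof (rule INF_greatest)
    fix m
    obtain j where "m \<le> j" "1 - 1 / real (Suc (Suc k)) \<le> r j" using low by blast
    then show "ereal (1 - 1 / real (Suc (Suc k))) \<le> (SUP j\<in>{m..}. ereal (r j))"
      by (intro SUP_upper2[of j]) auto
  qed
  then show "1 \<le> limsup (\<lambda>j. ereal (r j))"
    using LIMSEQ_le_const2[OF lim'] by (auto simp: one_ereal_def)
qed

subsection \<open>Permanental sequences with a perturbed minimum kernel\<close>

lemma exp_moment_tail:
  fixes X :: "'w \<Rightarrow> real"
  assumes M: "prob_space M" and X: "X \<in> borel_measurable M"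
    and C: "(\<integral>\<^sup>+\<omega>. ennreal (exp (X \<omega>)) \<partial>M) \<le> ennreal C" "0 \<le> C"
  shows "measure M {\<omega> \<in> space M. y < X \<omega>} \<le> C * exp (- y)"
proof -
  interpret M: prob_space M by fact
  have m: "{\<omega> \<in> space M. y < X \<omega>} \<in> sets M" using X by measurable
  have "ennreal (exp y) * emeasure M {\<omega> \<in> space M. y < X \<omega>} =
      (\<integral>\<^sup>+\<omega>. ennreal (exp y) * indicator {\<omega> \<in> space M. y < X \<omega>} \<omega> \<partial>M)"
    using m by (simp add: nn_integral_cmult_indicator)
  also have "\<dots> \<le> (\<integral>\<^sup>+\<omega>. ennreal (exp (X \<omega>)) \<partial>M)"
    by (intro nn_integral_mono) (auto simp: indicator_def intro!: ennreal_leI)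
  also have "\<dots> \<le> ennreal C" by (rule C(1))
  finally have "ennreal (exp y * measure M {\<omega> \<in> space M. y < X \<omega>}) \<le> ennreal C"
    by (simp add: M.emeasure_eq_measure ennreal_mult')
  then have "exp y * measure M {\<omega> \<in> space M. y < X \<omega>} \<le> C" using C(2) by (simp add: ennreal_le_iff)
  then show ?thesis by (simp add: exp_minus field_simps)
qed

section \<open>Marginal Laplace transforms and rescaling\<close>

lemma permanental_sequenceD:
  assumes "permanental_sequence M \<alpha> K Y" "inj_on i {..<n}" "\<And>m. m < n \<Longrightarrow> 1 \<le> i m" "\<And>m. m < n \<Longrightarrow> 0 < t m"
  shows "(LINT \<omega>|M. exp (- (\<Sum>m<n. t m * Y (i m) \<omega>))) =
    Determinant.det (1\<^sub>m n + Matrix.mat n n (\<lambda>(p, q). K (i p) (i q)) * mat_diag n t) powr - \<alpha>"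
  using assms unfolding permanental_sequence_def by blast

lemma permanental_sequence_laplace1:
  assumes "permanental_sequence M \<alpha> K Y" "1 \<le> j" "0 < t"
  shows "(LINT \<omega>|M. exp (- (t * Y j \<omega>))) = (1 + K j j * t) powr - \<alpha>"
proof -
  have "(LINT \<omega>|M. exp (- (\<Sum>m<(1::nat). (\<lambda>_. t) m * Y ((\<lambda>_. j) m) \<omega>))) =
     Determinant.det (1\<^sub>m 1 + Matrix.mat 1 1 (\<lambda>(p, q). K ((\<lambda>_. j) p) ((\<lambda>_. j) q)) * mat_diag 1 (\<lambda>_. t)) powr - \<alpha>"
    using permanental_sequenceD[OF assms(1), where i = "\<lambda>_. j" and n = 1 and t = "\<lambda>_. t"] assms(2,3)
    by (auto simp: inj_on_def)
  also have "Determinant.det (1\<^sub>m 1 + Matrix.mat 1 1 (\<lambda>(p, q). K ((\<lambda>_. j) p) ((\<lambda>_. j) q)) * mat_diag 1 (\<lambda>_. t)) = 1 + K j j * t"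
    by (subst det_single) (auto simp: mat_diag_mult_right[of _ 1 1] mat_diag_mult_right[of _ "Suc 0" "Suc 0"])
  finally show ?thesis by simp
qed

lemma permanental_sequence_laplace2:
  assumes "permanental_sequence M \<alpha> K Y" "1 \<le> j" "1 \<le> k" "j \<noteq> k" "0 < t" "0 < u" and K: "0 \<le> K k k"
  shows "(LINT \<omega>|M. exp (- (t * Y j \<omega> + u * Y k \<omega>))) =
    ((1 + K j j * t) * (1 + K k k * u) - K j k * K k j * t * u) powr - \<alpha>"
proof -
  define i where "i m = (if m = 0 then j else k)" for m :: nat
  define v where "v m = (if m = 0 then t else u)" for m :: nat
  have "(LINT \<omega>|M. exp (- (\<Sum>m<2. v m * Y (i m) \<omega>))) =
     Determinant.det (1\<^sub>m 2 + Matrix.mat 2 2 (\<lambda>(p, q). K (i p) (i q)) * mat_diag 2 v) powr - \<alpha>"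
    by (rule permanental_sequenceD[OF assms(1)]) (use assms in \<open>auto simp: inj_on_def i_def v_def less_2_cases_iff\<close>)
  also have "1\<^sub>m 2 + Matrix.mat 2 2 (\<lambda>(p, q). K (i p) (i q)) * mat_diag 2 v =
      Matrix.mat (Suc 1) (Suc 1) (\<lambda>(p, q). of_bool (p = q) + K (i p) (i q) * v q)"
    by (rule eq_matI) (auto simp: mat_diag_mult_right[of _ 2 2])
  also have "Determinant.det \<dots> = (1 + K j j * t) * (1 + K k k * u) - K j k * K k j * t * u"
  proof -
    have one: "Determinant.det (Matrix.mat (Suc 0) (Suc 0) f) = f (0, 0)" for f :: "nat \<times> nat \<Rightarrow> real"
      by (subst det_single) auto
    have p: "0 < 1 + K k k * u" using K assms by (simp add: add_pos_nonneg)
    have "Determinant.det (Matrix.mat (Suc 1) (Suc 1) (\<lambda>(p, q). of_bool (p = q) + K (i p) (i q) * v q)) =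
      (1 + K k k * u) * (1 + K j j * t - K j k * u * (K k j * t) / (1 + K k k * u))"
      using p by (subst det_schur_complement) (auto simp: i_def v_def one)
    also have "\<dots> = (1 + K j j * t) * (1 + K k k * u) - K j k * K k j * t * u"
      using p by (simp add: right_diff_distrib mult_ac)
    finally show ?thesis .
  qed
  finally show ?thesis by (simp add: numeral_2_eq_2 i_def v_def)
qed

text \<open>Scaling coordinate \<open>k\<close> by \<open>(b k)\<^sup>2\<close> multiplies column
  \<open>k\<close> of the kernel by it. Conjugation with the diagonal matrix of \<open>b\<close>,
  invisible to determinants, distributes the factor as \<open>b j * b k\<close>.\<close>

lemma permanental_sequence_rescale:
  assumes "permanental_sequence M \<alpha> K Z" and b: "\<And>j. 1 \<le> j \<Longrightarrow> 0 < b j"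
    and K: "\<And>j k. 1 \<le> j \<Longrightarrow> 1 \<le> k \<Longrightarrow> K' j k = b j * b k * K j k"
  shows "permanental_sequence M \<alpha> K' (\<lambda>j \<omega>. (b j)\<^sup>2 * Z j \<omega>)"
  unfolding permanental_sequence_def
proof (intro conjI allI impI ballI)
  have Z: "1 \<le> j \<Longrightarrow> Z j \<in> borel_measurable M" "1 \<le> j \<Longrightarrow> \<omega> \<in> space M \<Longrightarrow> 0 \<le> Z j \<omega>" for j \<omega>
    using assms(1) by (auto simp: permanental_sequence_def)
  show "(\<lambda>\<omega>. (b j)\<^sup>2 * Z j \<omega>) \<in> borel_measurable M" if "1 \<le> j" for j using Z that by measurable
  show "0 \<le> (b j)\<^sup>2 * Z j \<omega>" if "1 \<le> j" "\<omega> \<in> space M" for j \<omega> using Z that by simp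
  fix n :: nat and i :: "nat \<Rightarrow> nat" and t :: "nat \<Rightarrow> real"
  assume it: "inj_on i {..<n} \<and> (\<forall>m<n. 1 \<le> i m) \<and> (\<forall>m<n. 0 < t m)"
  define r where "r m = b (i m)" for m
  have r: "0 < r m" if "m < n" for m using b it that by (simp add: r_def)
  have "(LINT \<omega>|M. exp (- (\<Sum>m<n. t m * ((b (i m))\<^sup>2 * Z (i m) \<omega>)))) =
      (LINT \<omega>|M. exp (- (\<Sum>m<n. (t m * (r m)\<^sup>2) * Z (i m) \<omega>)))"
    by (simp add: r_def mult.assoc)
  also have "\<dots> = Determinant.det (1\<^sub>m n + Matrix.mat n n (\<lambda>(p, q). K (i p) (i q)) * mat_diag n (\<lambda>m. t m * (r m)\<^sup>2)) powr - \<alpha>"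
  proof (rule permanental_sequenceD[OF assms(1)])
    show "0 < t m * (r m)\<^sup>2" if "m < n" for m using it r[OF that] that by simp
  qed (use it in auto)
  also have "1\<^sub>m n + Matrix.mat n n (\<lambda>(p, q). K (i p) (i q)) * mat_diag n (\<lambda>m. t m * (r m)\<^sup>2) =
      Matrix.mat n n (\<lambda>(p, q). r q / r p * (of_bool (p = q) + K' (i p) (i q) * t q))"
  proof (rule eq_matI)
    fix p q assume "p < dim_row (Matrix.mat n n (\<lambda>(p, q). r q / r p * (of_bool (p = q) + K' (i p) (i q) * t q)))"
      and "q < dim_col (Matrix.mat n n (\<lambda>(p, q). r q / r p * (of_bool (p = q) + K' (i p) (i q) * t q)))"
    then have pq: "p < n" "q < n" by simp_all
    have "of_bool (p = q) + K (i p) (i q) * (t q * (r q)\<^sup>2) = r q / r p * (of_bool (p = q) + K' (i p) (i q) * t q)"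
      using r[OF pq(1)] r[OF pq(2)] K[of "i p" "i q"] it pq by (auto simp: r_def[symmetric] field_simps power2_eq_square)
    then show "(1\<^sub>m n + Matrix.mat n n (\<lambda>(p, q). K (i p) (i q)) * mat_diag n (\<lambda>m. t m * (r m)\<^sup>2)) $$ (p, q) =
        Matrix.mat n n (\<lambda>(p, q). r q / r p * (of_bool (p = q) + K' (i p) (i q) * t q)) $$ (p, q)"
      using pq by (simp add: mat_diag_mult_right[of _ n n] of_bool_def)
  qed (simp_all add: mat_diag_def)
  also have "Determinant.det \<dots> = Determinant.det (Matrix.mat n n (\<lambda>(p, q). of_bool (p = q) + K' (i p) (i q) * t q))"
    by (rule det_conjugate_diag) (use r in fastforce)
  also have "Matrix.mat n n (\<lambda>(p, q). of_bool (p = q) + K' (i p) (i q) * t q) =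
      1\<^sub>m n + Matrix.mat n n (\<lambda>(p, q). K' (i p) (i q)) * mat_diag n t"
    by (rule eq_matI) (simp_all add: mat_diag_mult_right[of _ n n] of_bool_def)
  finally show "(LINT \<omega>|M. exp (- (\<Sum>m<n. t m * ((b (i m))\<^sup>2 * Z (i m) \<omega>)))) =
      Determinant.det (1\<^sub>m n + Matrix.mat n n (\<lambda>(p, q). K' (i p) (i q)) * mat_diag n t) powr - \<alpha>" .
qed

text \<open>The setting after rescaling. \<open>\<beta>\<close> and \<open>\<Phi>\<close> are
  functions of the position \<open>s j\<close> and not of the index, so that every subsequence of
  \<open>s\<close> inherits their concavity.\<close>

locale perturbed_min_kernel = prob_space M for M :: "'w measure" +
  fixes s :: "nat \<Rightarrow> real" and \<beta> \<Phi> :: "real \<Rightarrow> real" and \<alpha> :: real and Y :: "nat \<Rightarrow> 'w \<Rightarrow> real"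
  assumes s_strict: "strict_mono_on {1..} s" and s_1: "0 < s 1" and s_top: "filterlim s at_top sequentially"
    and \<beta>_concave: "concave_on {0..} \<beta>" and \<beta>_mono: "mono_on {0..} \<beta>" and \<beta>_nonneg: "\<And>x. 0 \<le> x \<Longrightarrow> 0 \<le> \<beta> x"
    and \<Phi>_concave: "concave_on {0..} \<Phi>" and \<Phi>_mono: "mono_on {0..} \<Phi>" and \<Phi>_nonneg: "\<And>x. 0 \<le> x \<Longrightarrow> 0 \<le> \<Phi> x"
    and small: "(\<lambda>j. \<beta> (s j) * \<Phi> (s j) / s j) \<longlonglongrightarrow> 0"
    and \<alpha>: "0 < \<alpha>"
    and permanental: "permanental_sequence M \<alpha> (\<lambda>j k. min (s j) (s k) + \<beta> (s j) * \<Phi> (s k)) Y"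
begin

definition E :: "nat \<Rightarrow> real" where "E j = \<beta> (s j) * \<Phi> (s j)"

definition \<tau> :: "nat \<Rightarrow> real" where "\<tau> j = (\<Sum>i\<in>{1..<j}. min 1 (ln (s (i + 1) / s i)))"

lemma s_less: "1 \<le> i \<Longrightarrow> i < j \<Longrightarrow> s i < s j"
  using s_strict by (auto simp: strict_mono_on_def)

lemma s_pos: "1 \<le> j \<Longrightarrow> 0 < s j"
  using s_1 s_less[of 1 j] by (cases "j = 1") auto

lemma s_le: "1 \<le> i \<Longrightarrow> i \<le> j \<Longrightarrow> s i \<le> s j"
  using s_less[of i j] by (cases "i = j") auto

lemma Y_measurable: "1 \<le> j \<Longrightarrow> Y j \<in> borel_measurable M"
  and Y_nonneg: "1 \<le> j \<Longrightarrow> \<omega> \<in> space M \<Longrightarrow> 0 \<le> Y j \<omega>"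
  using permanental by (auto simp: permanental_sequence_def)

lemma \<beta>_le: "0 \<le> x \<Longrightarrow> x \<le> y \<Longrightarrow> \<beta> x \<le> \<beta> y"
  and \<Phi>_le: "0 \<le> x \<Longrightarrow> x \<le> y \<Longrightarrow> \<Phi> x \<le> \<Phi> y"
  using \<beta>_mono \<Phi>_mono by (auto simp: mono_on_def)

lemma \<beta>_s_nonneg: "1 \<le> j \<Longrightarrow> 0 \<le> \<beta> (s j)" and \<Phi>_s_nonneg: "1 \<le> j \<Longrightarrow> 0 \<le> \<Phi> (s j)"
  using \<beta>_nonneg \<Phi>_nonneg s_pos less_imp_le by blast+

lemma E_nonneg: "1 \<le> j \<Longrightarrow> 0 \<le> E j"
  using \<beta>_s_nonneg \<Phi>_s_nonneg by (simp add: E_def)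

lemma laplace1:
  assumes "1 \<le> j" "0 < t"
  shows "(LINT \<omega>|M. exp (- (t * Y j \<omega>))) = (1 + (s j + E j) * t) powr - \<alpha>"
  using permanental_sequence_laplace1[OF permanental assms] by (simp add: E_def)

lemma Y_tail:
  assumes j: "1 \<le> j" and \<theta>: "(s j + E j) * \<theta> < 1" "0 < \<theta>"
  shows "measure M {\<omega> \<in> space M. y < Y j \<omega>} \<le> (1 - (s j + E j) * \<theta>) powr - \<alpha> * exp (- (\<theta> * y))"
proof -
  have "(\<integral>\<^sup>+\<omega>. ennreal (exp (\<theta> * Y j \<omega>)) \<partial>M) \<le> ennreal ((1 - (s j + E j) * \<theta>) powr - \<alpha>)"
    by (rule gamma_exp_moment[OF prob_space_axioms Y_measurable[OF j] Y_nonneg[OF j] \<alpha> _ laplace1[OF j] \<theta>(1)])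
      (use s_pos[OF j] E_nonneg[OF j] in auto)
  then have "measure M {\<omega> \<in> space M. \<theta> * y < \<theta> * Y j \<omega>} \<le> (1 - (s j + E j) * \<theta>) powr - \<alpha> * exp (- (\<theta> * y))"
    by (intro exp_moment_tail[OF prob_space_axioms]) (use Y_measurable[OF j] in auto)
  then show ?thesis using \<theta> by simp
qed

text \<open>Both \<open>\<beta> x / x\<close> and \<open>\<Phi> x / x\<close> decrease, so
  \<open>E\<close> grows at most like the square of \<open>s\<close>. The factor 3 is
  \<open>s j + s i \<le> 3 * s i\<close>. The perturbation thus changes no faster than
  \<open>s\<close> itself, up to a constant.\<close>

lemma E_increment:
  assumes "1 \<le> i" "i < j" "s j \<le> 2 * s i"
  shows "E i \<le> E j" "E j - E i \<le> 3 * (E i / s i) * (s j - s i)"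
proof -
  have si: "0 < s i" "s i < s j" using s_pos s_less assms by auto
  have \<beta>: "0 \<le> \<beta> (s i)" "\<beta> (s i) \<le> \<beta> (s j)" and \<Phi>: "0 \<le> \<Phi> (s i)" "\<Phi> (s i) \<le> \<Phi> (s j)"
    using si \<beta>_le[of "s i" "s j"] \<Phi>_le[of "s i" "s j"] \<beta>_nonneg \<Phi>_nonneg by auto
  then show "E i \<le> E j" unfolding E_def by (intro mult_mono) auto
  have "\<beta> (s j) * s i \<le> \<beta> (s i) * s j" "\<Phi> (s j) * s i \<le> \<Phi> (s i) * s j"
    using si concave_on_ratio[OF \<beta>_concave] concave_on_ratio[OF \<Phi>_concave] \<beta>_nonneg[of 0] \<Phi>_nonneg[of 0] by auto
  then have "(\<beta> (s j) * s i) * (\<Phi> (s j) * s i) \<le> (\<beta> (s i) * s j) * (\<Phi> (s i) * s j)"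
    by (rule mult_mono) (use \<beta> \<Phi> si order_trans[OF \<beta>] order_trans[OF \<Phi>] in auto)
  then have "E j * (s i * s i) \<le> E i * (s j * s j)" by (simp add: E_def mult_ac)
  then have "(E j - E i) * (s i * s i) \<le> E i * ((s j + s i) * (s j - s i))" by (simp add: algebra_simps)
  also have "\<dots> \<le> E i * ((3 * s i) * (s j - s i))"
    using assms si E_nonneg[of i] by (intro mult_left_mono mult_right_mono) auto
  also have "\<dots> = 3 * (E i / s i) * (s j - s i) * (s i * s i)" using si by (simp add: field_simps)
  finally show "E j - E i \<le> 3 * (E i / s i) * (s j - s i)" using si by (simp add: mult_le_cancel_right pos_le_divide_eq)
qed

text \<open>With \<open>r = sqrt (s i * (s j - s i))\<close>, the polynomial in
  \<open>bivariate_gamma_exp_moment\<close> has linear coefficient of order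
  \<open>s j - s i \<le> r\<close> and quadratic coefficient of order \<open>r\<^sup>2\<close>, so
  exponents of order \<open>1 / r\<close> are admissible. The restriction
  \<open>s j \<le> 2 * s i\<close> is what makes \<open>s j - s i \<le> r\<close>.\<close>

lemma increment_tail:
  "\<exists>C\<ge>1. \<forall>i j y. 1 \<le> i \<longrightarrow> i < j \<longrightarrow> s j \<le> 2 * s i \<longrightarrow>
    measure M {\<omega> \<in> space M. y < \<bar>Y j \<omega> - Y i \<omega>\<bar>} \<le> 2 * 2 powr \<alpha> * exp (- (y / (C * sqrt (s i * (s j - s i)))))"
proof -
  have "Bseq (\<lambda>j. \<beta> (s j) * \<Phi> (s j) / s j)" using small by (intro convergent_imp_Bseq convergentI)
  then obtain H where H: "0 < H" "\<And>j. \<bar>\<beta> (s j) * \<Phi> (s j) / s j\<bar> \<le> H"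
    unfolding Bseq_def by auto
  have EH: "E j / s j \<le> H" for j using order_trans[OF abs_ge_self H(2)[of j]] by (simp add: E_def)
  define C where "C = (1 + 3 * H)\<^sup>2"
  have C1: "1 + 3 * H \<le> C" "1 \<le> C" "(1 + H) * (1 + 3 * H) \<le> C"
    using H(1) by (auto simp: C_def power2_eq_square algebra_simps)
  have main: "measure M {\<omega> \<in> space M. y < \<bar>Y j \<omega> - Y i \<omega>\<bar>} \<le> 2 * 2 powr \<alpha> * exp (- (y / (4 * C * sqrt (s i * (s j - s i)))))"
    if ij: "1 \<le> i" "i < j" "s j \<le> 2 * s i" for i j y
  proof -
    have j1: "1 \<le> j" using ij by simp
    have si: "0 < s i" "s i < s j" using s_pos s_less ij by auto
    define \<Delta> where "\<Delta> = s j - s i"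
    have \<Delta>: "0 < \<Delta>" "\<Delta> \<le> s i" using si ij by (auto simp: \<Delta>_def)
    define r where "r = sqrt (s i * \<Delta>)"
    have r: "0 < r" "r\<^sup>2 = s i * \<Delta>" using si \<Delta> by (auto simp: r_def)
    have \<Delta>r: "\<Delta> \<le> r" unfolding r_def using \<Delta> by (intro real_le_rsqrt) (simp add: power2_eq_square)
    define a where "a = s i + E i"
    define b where "b = s j + E j"
    define \<rho> where "\<rho> = (s i + \<beta> (s i) * \<Phi> (s j)) * (s i + \<beta> (s j) * \<Phi> (s i))"
    have \<beta>: "0 \<le> \<beta> (s i)" "\<beta> (s i) \<le> \<beta> (s j)" and \<Phi>: "0 \<le> \<Phi> (s i)" "\<Phi> (s i) \<le> \<Phi> (s j)"
      using si \<beta>_le[of "s i" "s j"] \<Phi>_le[of "s i" "s j"] \<beta>_nonneg \<Phi>_nonneg by auto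
    have E0: "0 \<le> E i" "0 \<le> E j" using E_nonneg ij j1 by auto
    have a: "0 < a" "a \<le> (1 + H) * s i"
      using si E0 EH[of i] by (auto simp: a_def field_simps)
    have b: "0 < b" using si E0 by (simp add: b_def)
    have ba: "0 \<le> b - a" "b - a \<le> (1 + 3 * H) * \<Delta>"
    proof -
      show "0 \<le> b - a" using E_increment(1)[OF ij] si by (simp add: a_def b_def)
      have "b - a = \<Delta> + (E j - E i)" by (simp add: a_def b_def \<Delta>_def)
      also have "E j - E i \<le> 3 * (E i / s i) * \<Delta>" using E_increment(2)[OF ij] by (simp add: \<Delta>_def)
      also have "\<dots> \<le> 3 * H * \<Delta>" using EH[of i] \<Delta> by (intro mult_right_mono mult_left_mono) auto
      finally show "b - a \<le> (1 + 3 * H) * \<Delta>" by (simp add: algebra_simps)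
    qed
    have \<rho>0: "0 \<le> \<rho>" unfolding \<rho>_def using si \<beta> \<Phi> by (intro mult_nonneg_nonneg add_nonneg_nonneg) auto
    have \<rho>a: "a * a \<le> \<rho>" unfolding \<rho>_def a_def E_def
      using si \<beta> \<Phi> by (intro mult_mono add_mono mult_mono) auto
    have \<rho>ab: "\<rho> < a * b"
    proof -
      \<comment> \<open>The fourfold products cancel. The middle term is nonnegative because
        \<open>\<beta>\<close> and \<open>\<Phi>\<close> increase together.\<close>
      have "a * b - \<rho> = s i * \<Delta> + s i * ((\<beta> (s j) - \<beta> (s i)) * (\<Phi> (s j) - \<Phi> (s i))) + \<Delta> * E i"
        by (simp add: a_def b_def \<rho>_def E_def \<Delta>_def algebra_simps)
      moreover have "0 < s i * \<Delta>" using si \<Delta> by simp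
      moreover have "0 \<le> s i * ((\<beta> (s j) - \<beta> (s i)) * (\<Phi> (s j) - \<Phi> (s i)))" using si \<beta> \<Phi> by simp
      moreover have "0 \<le> \<Delta> * E i" using \<Delta> E0 by simp
      ultimately show ?thesis by linarith
    qed
    have D: "a * b - \<rho> \<le> C * r\<^sup>2"
    proof -
      have "a * b - \<rho> \<le> a * (b - a)" using \<rho>a by (simp add: algebra_simps)
      also have "\<dots> \<le> ((1 + H) * s i) * ((1 + 3 * H) * \<Delta>)" using a ba si H by (intro mult_mono) auto
      also have "\<dots> = (1 + H) * (1 + 3 * H) * r\<^sup>2" by (simp add: r(2) mult_ac)
      also have "\<dots> \<le> C * r\<^sup>2" using C1 by (intro mult_right_mono) auto
      finally show ?thesis .
    qed
    \<comment> \<open>\<open>e\<close> is the sign of the increment. For this \<open>c\<close> the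
      linear term is at most \<open>1 / 4\<close> and the quadratic one at most
      \<open>1 / 16\<close>, whence \<open>Q \<ge> 1 / 2\<close> and the constant
      \<open>2 powr \<alpha>\<close>.\<close>
    have tail: "measure M {\<omega> \<in> space M. c * y < c * (e * (Y i \<omega> - Y j \<omega>))} \<le> 2 powr \<alpha> * exp (- (c * y))"
      if e: "\<bar>e\<bar> = 1" and c: "c = 1 / (4 * C * r)" for e c
    proof -
      define Q where "Q = 1 - (a - b) * (c * e) - (a * b - \<rho>) * (c * e)\<^sup>2"
      have c0: "0 < c" using C1 r by (simp add: c)
      have "\<bar>(a - b) * (c * e)\<bar> = (b - a) * c" using ba c0 e by (simp add: abs_mult)
      also have "\<dots> \<le> (C * r) * c" using ba \<Delta>r C1 \<Delta> c0
        by (intro mult_right_mono) (auto intro: order_trans[OF _ mult_mono[of "1 + 3 * H" C \<Delta> r]])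
      also have "\<dots> = 1 / 4" using C1 r by (simp add: c)
      finally have 1: "\<bar>(a - b) * (c * e)\<bar> \<le> 1 / 4" .
      have "e\<^sup>2 = 1" using e by (metis power2_abs power_one)
      then have "(a * b - \<rho>) * (c * e)\<^sup>2 = (a * b - \<rho>) * c\<^sup>2" by (simp add: power_mult_distrib)
      also have "\<dots> \<le> (C * r\<^sup>2) * c\<^sup>2" by (intro mult_right_mono D) simp
      also have "\<dots> = 1 / (16 * C)" using C1 r(1) by (simp add: c power2_eq_square)
      also have "\<dots> \<le> 1 / 16" using C1 by (simp add: field_simps)
      finally have Q: "1 / 2 \<le> Q" using 1 unfolding Q_def by linarith
      have "(\<integral>\<^sup>+\<omega>. ennreal (exp ((c * e) * (Y i \<omega> - Y j \<omega>))) \<partial>M) \<le> ennreal (Q powr - \<alpha>)"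
        unfolding Q_def
      proof (rule bivariate_gamma_exp_moment[OF prob_space_axioms Y_measurable[OF ij(1)] Y_nonneg[OF ij(1)]
            Y_measurable[OF j1] Y_nonneg[OF j1] \<alpha> a(1) b \<rho>0 \<rho>ab])
        show "0 < 1 - (a - b) * (c * e) - (a * b - \<rho>) * (c * e)\<^sup>2" using Q by (simp add: Q_def)
        show "(LINT \<omega>|M. exp (- (t * Y i \<omega> + u * Y j \<omega>))) = ((1 + a * t) * (1 + b * u) - \<rho> * t * u) powr - \<alpha>"
          if "0 < t" "0 < u" for t u
          using permanental_sequence_laplace2[OF permanental ij(1) j1 _ that] ij si b
          by (simp add: a_def b_def \<rho>_def E_def less_imp_le)
      qed
      also have "Q powr - \<alpha> \<le> (1 / 2) powr - \<alpha>" using Q \<alpha> by (intro powr_mono2') auto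
      also have "(1 / 2) powr - \<alpha> = 2 powr \<alpha>" by (simp add: powr_divide powr_minus)
      finally have "(\<integral>\<^sup>+\<omega>. ennreal (exp (c * (e * (Y i \<omega> - Y j \<omega>)))) \<partial>M) \<le> ennreal (2 powr \<alpha>)"
        by (simp add: ennreal_leI mult.assoc)
      then show ?thesis
        by (intro exp_moment_tail[OF prob_space_axioms])
          (use Y_measurable[OF ij(1)] Y_measurable[OF j1] in auto)
    qed
    define c where "c = 1 / (4 * C * r)"
    have c0: "0 < c" using C1 r by (simp add: c_def)
    have meas: "{\<omega> \<in> space M. c * y < c * (e * (Y i \<omega> - Y j \<omega>))} \<in> sets M" for e
      using Y_measurable[OF ij(1)] Y_measurable[OF j1] by measurable
    have "{\<omega> \<in> space M. y < \<bar>Y j \<omega> - Y i \<omega>\<bar>} =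
        {\<omega> \<in> space M. c * y < c * (1 * (Y i \<omega> - Y j \<omega>))} \<union> {\<omega> \<in> space M. c * y < c * ((- 1) * (Y i \<omega> - Y j \<omega>))}"
      using c0 by auto
    then have "measure M {\<omega> \<in> space M. y < \<bar>Y j \<omega> - Y i \<omega>\<bar>} \<le>
        measure M {\<omega> \<in> space M. c * y < c * (1 * (Y i \<omega> - Y j \<omega>))} + measure M {\<omega> \<in> space M. c * y < c * ((- 1) * (Y i \<omega> - Y j \<omega>))}"
      using measure_Un_le[OF meas[of 1] meas[of "- 1"]] by simp
    also have "\<dots> \<le> 2 powr \<alpha> * exp (- (c * y)) + 2 powr \<alpha> * exp (- (c * y))"
      by (intro add_mono tail) (auto simp: c_def)
    finally show ?thesis by (simp add: c_def r_def \<Delta>_def)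
  qed
  show ?thesis by (rule exI[of _ "4 * C"]) (use C1 main in auto)
qed

text \<open>Increments over a block of relative length \<open>\<kappa>\<close> have scale
  \<open>sqrt \<kappa> * s\<close>, so a small \<open>\<kappa>\<close> makes the oscillation cheaper
  than any prescribed fraction of the maximum. The rate 2 in \<open>exp (- 2 * X)\<close> is chosen
  to be no worse than that of the one-point tail in \<open>upper_bound\<close>.\<close>

lemma block_maximal_inequality:
  assumes \<epsilon>: "0 < \<epsilon>"
  shows "\<exists>\<kappa>>0. \<kappa> \<le> 1 \<and> (\<forall>J X. finite J \<longrightarrow> J \<noteq> {} \<longrightarrow> J \<subseteq> {1..} \<longrightarrow>
    (\<forall>j\<in>J. s j < (1 + \<kappa>) * s (Min J)) \<longrightarrow> 1 \<le> X \<longrightarrow>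
    measure M {\<omega> \<in> space M. \<exists>j\<in>J. \<epsilon> * s (Min J) * X < \<bar>Y j \<omega> - Y (Min J) \<omega>\<bar>} \<le> 4 * 2 powr \<alpha> * exp (- 2 * X))"
proof -
  obtain C where C: "1 \<le> C" and inc: "\<And>i j y. 1 \<le> i \<Longrightarrow> i < j \<Longrightarrow> s j \<le> 2 * s i \<Longrightarrow>
    measure M {\<omega> \<in> space M. y < \<bar>Y j \<omega> - Y i \<omega>\<bar>} \<le> 2 * 2 powr \<alpha> * exp (- (y / (C * sqrt (s i * (s j - s i)))))"
    using increment_tail by blast
  \<comment> \<open>\<open>320 = 4 * 2 * 40\<close>: 4 from the leading factor of \<open>e\<close>,
    2 as a bound for \<open>sqrt 2\<close>, and 40 so that \<open>40 * X * (1 + l / 20)\<close>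
    exceeds \<open>2 * X + 2 * l\<close>.\<close>
  define \<kappa> where "\<kappa> = min 1 ((\<epsilon> / (320 * C))\<^sup>2)"
  have \<kappa>: "0 < \<kappa>" "\<kappa> \<le> 1" using \<epsilon> C by (auto simp: \<kappa>_def)
  have sq: "sqrt \<kappa> \<le> \<epsilon> / (320 * C)"
    using \<epsilon> C by (intro real_le_lsqrt) (auto simp: \<kappa>_def)
  have main: "measure M {\<omega> \<in> space M. \<exists>j\<in>J. \<epsilon> * s (Min J) * X < \<bar>Y j \<omega> - Y (Min J) \<omega>\<bar>} \<le> 4 * 2 powr \<alpha> * exp (- 2 * X)"
    if J: "finite J" "J \<noteq> {}" "J \<subseteq> {1..}" and near: "\<forall>j\<in>J. s j < (1 + \<kappa>) * s (Min J)" and X: "1 \<le> X" for J X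
  proof -
    define S where "S = s (Min J)"
    have minJ: "1 \<le> Min J" using J Min_in[OF J(1,2)] by auto
    have S: "0 < S" unfolding S_def by (rule s_pos[OF minJ])
    have J1: "1 \<le> j" "S \<le> s j" if "j \<in> J" for j
      using that J s_le[OF minJ Min_le[OF J(1) that]] by (auto simp: S_def)
    have J2: "s j < S + \<kappa> * S" if "j \<in> J" for j
      using near that by (auto simp: S_def algebra_simps)
    \<comment> \<open>Increments at level \<open>l\<close> shrink like
      \<open>(1 / sqrt 2) ^ l\<close>. Thresholds shrinking by \<open>3 / 4\<close> are still
      summable, with sum 4, but shrink more slowly, so the tails improve with
      \<open>l\<close>.\<close>
    define e where "e l = \<epsilon> * S * X / 4 * (3 / 4) ^ l" for l :: nat
    define p where "p l = 2 * 2 powr \<alpha> * (exp (- 2 * X) * (1 / 4) ^ l)" for l :: nat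
    show ?thesis unfolding S_def[symmetric]
    proof (rule dyadic_chaining[OF prob_space_axioms, where L = "\<kappa> * S" and x = s and a = S and \<epsilon> = e and p = p])
      show "Y i \<in> borel_measurable M" if "i \<in> J" for i using Y_measurable J1 that by blast
      show "s i < s j" if "i \<in> J" "j \<in> J" "i < j" for i j using s_less J1 that by blast
      show "0 \<le> p l" for l by (simp add: p_def)
      show "0 \<le> e l" for l using \<epsilon> S X by (simp add: e_def)
      show "0 < \<kappa> * S" using \<kappa> S by simp
      show "S \<le> s j \<and> s j < S + \<kappa> * S" if "j \<in> J" for j using J1 J2 that by blast
      show "(\<Sum>k<m. e k) \<le> \<epsilon> * S * X" for m
      proof -
        have "(\<Sum>k<m. (3 / 4 :: real) ^ k) \<le> 4" by (simp add: sum_gp_strict)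
        then have "\<epsilon> * S * X / 4 * (\<Sum>k<m. (3 / 4) ^ k) \<le> \<epsilon> * S * X / 4 * 4"
          using \<epsilon> S X by (intro mult_left_mono) auto
        then show ?thesis by (simp add: e_def sum_distrib_left)
      qed
      show "(\<Sum>k<m. 2 ^ k * p k) \<le> 4 * 2 powr \<alpha> * exp (- 2 * X)" for m
      proof -
        have "2 ^ k * p k = 2 * 2 powr \<alpha> * exp (- 2 * X) * (1 / 2) ^ k" for k
        proof -
          have "(2 :: real) ^ k * (1 / 4) ^ k = (1 / 2) ^ k" by (simp add: power_mult_distrib[symmetric])
          then show ?thesis by (simp add: p_def)
        qed
        then have "(\<Sum>k<m. 2 ^ k * p k) = 2 * 2 powr \<alpha> * exp (- 2 * X) * (\<Sum>k<m. (1 / 2) ^ k)"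
          by (simp add: sum_distrib_left)
        also have "\<dots> \<le> 2 * 2 powr \<alpha> * exp (- 2 * X) * 2"
          by (intro mult_left_mono) (auto simp: sum_gp_strict)
        finally show ?thesis by simp
      qed
      fix l i j assume ij: "i \<in> J" "j \<in> J" "i < j" and d: "s j - s i \<le> \<kappa> * S / 2 ^ l"
      have i1: "1 \<le> i" using J1 ij by blast
      have si: "S \<le> s i" "s i \<le> 2 * S" "s i < s j" "s j \<le> 2 * s i"
      proof -
        show "S \<le> s i" "s i < s j" using J1 ij s_less by auto
        have "\<kappa> * S \<le> 1 * S" using \<kappa> S by (intro mult_right_mono) auto
        then show "s i \<le> 2 * S" "s j \<le> 2 * s i" using J1(2)[OF ij(1)] J2[OF ij(1)] J2[OF ij(2)] by linarith+
      qed
      have "s i * (s j - s i) \<le> (2 * S) * (\<kappa> * S / 2 ^ l)"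
        using si d S by (intro mult_mono) auto
      also have "\<dots> = (S\<^sup>2) * (2 * \<kappa>) / 2 ^ l" by (simp add: power2_eq_square)
      finally have "sqrt (s i * (s j - s i)) \<le> sqrt ((S\<^sup>2) * (2 * \<kappa>) / 2 ^ l)" by (rule real_sqrt_le_mono)
      also have "\<dots> = S * (sqrt 2 * sqrt \<kappa>) / sqrt 2 ^ l"
        using S by (simp add: real_sqrt_mult real_sqrt_divide real_sqrt_power)
      also have "\<dots> \<le> S * (2 * (\<epsilon> / (320 * C))) / sqrt 2 ^ l"
        using S sq \<kappa> by (intro divide_right_mono mult_left_mono mult_mono) (auto intro: real_le_lsqrt)
      finally have r: "sqrt (s i * (s j - s i)) \<le> S * \<epsilon> / (160 * C) / sqrt 2 ^ l" by simp
      have r0: "0 < sqrt (s i * (s j - s i))" using si S by simp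
      \<comment> \<open>\<open>3 / 4 * sqrt 2 \<ge> 21 / 20\<close>. Bernoulli turns this geometric
        gain into a linear one, enough for a factor \<open>exp (- 2 * l) \<le> (1 / 4) ^ l\<close>
        against the \<open>2 ^ l\<close> links.\<close>
      have "(1 + real l * (1 / 20)) \<le> (1 + 1 / 20) ^ l" using Bernoulli_inequality[of "1 / 20" l] by simp
      also have "\<dots> \<le> (3 / 4 * sqrt 2) ^ l"
      proof (rule power_mono)
        have "7 / 5 \<le> sqrt 2" by (rule real_le_rsqrt) (simp add: power2_eq_square)
        then show "1 + 1 / 20 \<le> 3 / 4 * sqrt 2" by simp
      qed simp
      finally have g: "1 + real l * (1 / 20) \<le> (3 / 4 * sqrt 2) ^ l" .
      have "2 * X + 2 * real l \<le> 40 * X * (1 + real l * (1 / 20))"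
      proof -
        have "2 * real l \<le> 2 * real l * X" using X mult_left_mono[of 1 X "2 * real l"] by simp
        moreover have "2 * X \<le> 40 * X" using X by simp
        ultimately show ?thesis by (simp add: algebra_simps)
      qed
      also have "\<dots> \<le> 40 * X * (3 / 4 * sqrt 2) ^ l" using g X by (intro mult_left_mono) auto
      also have "\<dots> = e l / (C * (S * \<epsilon> / (160 * C) / sqrt 2 ^ l))"
        unfolding power_mult_distrib using C S \<epsilon> by (simp add: e_def)
      also have "\<dots> \<le> e l / (C * sqrt (s i * (s j - s i)))"
        using C r r0 \<epsilon> S X by (intro divide_left_mono mult_left_mono mult_pos_pos) (auto simp: e_def)
      finally have ex: "2 * X + 2 * real l \<le> e l / (C * sqrt (s i * (s j - s i)))" .
      have "measure M {\<omega> \<in> space M. e l < \<bar>Y j \<omega> - Y i \<omega>\<bar>} \<le> 2 * 2 powr \<alpha> * exp (- (e l / (C * sqrt (s i * (s j - s i)))))"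
        by (rule inc[OF i1 ij(3) si(4)])
      also have "\<dots> \<le> 2 * 2 powr \<alpha> * exp (- (2 * X + 2 * real l))"
        using ex by (intro mult_left_mono) auto
      also have "exp (- (2 * X + 2 * real l)) = exp (- 2 * X) * exp (- 2) ^ l"
      proof -
        have "- (2 * X + 2 * real l) = - 2 * X + real l * (- 2)" by simp
        then show ?thesis by (simp only: exp_add exp_of_nat_mult)
      qed
      also have "exp (- 2) ^ l \<le> (1 / 4 :: real) ^ l"
      proof (rule power_mono)
        have "(4 :: real) \<le> exp 1 * exp 1" using mult_mono[of 2 "exp 1" 2 "exp 1 :: real"] exp_ge_add_one_self[of 1] by simp
        then have "4 \<le> exp (2 :: real)" by (simp add: exp_add[symmetric])
        then show "exp (- 2) \<le> (1 / 4 :: real)" by (simp add: exp_minus field_simps)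
      qed simp
      finally show "measure M {\<omega> \<in> space M. e l < \<bar>Y j \<omega> - Y i \<omega>\<bar>} \<le> p l"
        by (simp add: p_def mult_left_mono)
    qed (use J in auto)
  qed
  then show ?thesis using \<kappa> by blast
qed

section \<open>The clock of the sequence\<close>

lemma \<tau>_Suc: "1 \<le> j \<Longrightarrow> \<tau> (Suc j) = \<tau> j + min 1 (ln (s (Suc j) / s j))"
  by (simp add: \<tau>_def)

lemma \<tau>_1: "\<tau> 1 = 0"
  by (simp add: \<tau>_def)

lemma ln_ratio_nonneg: "1 \<le> i \<Longrightarrow> i \<le> j \<Longrightarrow> 0 \<le> ln (s j / s i)"
  using s_le s_pos by (simp add: ln_ge_zero_iff le_divide_eq)

text \<open>The first bound makes blocks of small \<open>\<tau>\<close>-length close in ratio, the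
  second controls geometric subsequences and gives \<open>ln (s j)\<close> as an upper estimate, the
  third does so for \<open>j\<close>. The first holds because either some step is truncated and
  contributes 1, or the logarithms telescope.\<close>

lemma \<tau>_increment:
  assumes "1 \<le> i" "i \<le> j"
  shows "min 1 (ln (s j / s i)) \<le> \<tau> j - \<tau> i" "\<tau> j - \<tau> i \<le> ln (s j / s i)" "\<tau> j - \<tau> i \<le> real (j - i)"
proof -
  have "min 1 (ln (s j / s i)) \<le> \<tau> j - \<tau> i \<and> \<tau> j - \<tau> i \<le> ln (s j / s i) \<and> \<tau> j - \<tau> i \<le> real (j - i)"
    using assms(2)
  proof (induction j rule: dec_induct)
    case base
    then show ?case using s_pos[OF assms(1)] by simp
  next
    case (step k)
    have k: "1 \<le> k" using step assms by simp
    have p: "0 < s i" "0 < s k" "0 < s (Suc k)" using s_pos assms k by auto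
    have l: "ln (s (Suc k) / s i) = ln (s (Suc k) / s k) + ln (s k / s i)"
      using p by (simp add: ln_div)
    have "0 \<le> ln (s (Suc k) / s k)" "0 \<le> ln (s k / s i)" using ln_ratio_nonneg k assms step by auto
    then show ?case using step \<tau>_Suc[OF k] unfolding l by (auto simp: Suc_diff_le min_def split: if_splits)
  qed
  then show "min 1 (ln (s j / s i)) \<le> \<tau> j - \<tau> i" "\<tau> j - \<tau> i \<le> ln (s j / s i)" "\<tau> j - \<tau> i \<le> real (j - i)" by auto
qed

lemma \<tau>_mono: "1 \<le> i \<Longrightarrow> i \<le> j \<Longrightarrow> \<tau> i \<le> \<tau> j"
  using \<tau>_increment(1)[of i j] ln_ratio_nonneg[of i j] by (simp add: min_def split: if_splits)

text \<open>Whenever \<open>s\<close> has grown by the factor \<open>exp 1\<close>, the clock has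
  gained at least 1.\<close>

lemma \<tau>_at_top: "filterlim \<tau> at_top sequentially"
proof -
  have "\<exists>j\<ge>1. real n \<le> \<tau> j" for n
  proof (induction n)
    case 0
    then show ?case using \<tau>_1 by (intro exI[of _ 1]) simp
  next
    case (Suc n)
    then obtain i where i: "1 \<le> i" "real n \<le> \<tau> i" by blast
    have "eventually (\<lambda>j. exp 1 * s i \<le> s j) sequentially"
      using s_top by (simp add: filterlim_at_top)
    then have "eventually (\<lambda>j. exp 1 * s i \<le> s j \<and> i \<le> j) sequentially"
      using eventually_ge_at_top[of i] by eventually_elim simp
    then obtain j where j: "exp 1 * s i \<le> s j" "i \<le> j" by (auto simp: eventually_sequentially)
    have "exp 1 \<le> s j / s i" using j s_pos[OF i(1)] by (simp add: le_divide_eq)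
    then have "1 \<le> ln (s j / s i)" using s_pos[OF i(1)] s_pos[of j] i j by (simp add: ln_ge_iff)
    then have "\<tau> i + 1 \<le> \<tau> j" using \<tau>_increment(1)[OF i(1) j(2)] by simp
    then show ?case using i j by (intro exI[of _ j]) auto
  qed
  then have "\<exists>N. \<forall>j\<ge>N. z \<le> \<tau> j" for z
    using real_arch_simple[of z] \<tau>_mono by (meson order_trans)
  then show ?thesis by (simp add: filterlim_at_top eventually_sequentially)
qed

text \<open>Each block is controlled through its first index \<open>i\<close>: a one-point tail at
  \<open>i\<close> and the oscillation of the block around it. Both cost at most a power
  \<open>(n * \<eta>) powr - q\<close> with \<open>q > 1\<close>, hence are summable. A jump of the
  clock may skip blocks; those are empty.\<close>

lemma upper_bound:
  assumes \<delta>: "0 < \<delta>" "\<delta> \<le> 1"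
  shows "AE \<omega> in M. eventually (\<lambda>j. Y j \<omega> \<le> (1 + \<delta>) * s j * ln (\<tau> j)) sequentially"
proof -
  obtain \<kappa> where \<kappa>: "0 < \<kappa>" "\<kappa> \<le> 1" and block: "\<And>J X. finite J \<Longrightarrow> J \<noteq> {} \<Longrightarrow> J \<subseteq> {1..} \<Longrightarrow>
    (\<forall>j\<in>J. s j < (1 + \<kappa>) * s (Min J)) \<Longrightarrow> 1 \<le> X \<Longrightarrow>
    measure M {\<omega> \<in> space M. \<exists>j\<in>J. \<delta> / 2 * s (Min J) * X < \<bar>Y j \<omega> - Y (Min J) \<omega>\<bar>} \<le> 4 * 2 powr \<alpha> * exp (- 2 * X)"
    using block_maximal_inequality[of "\<delta> / 2"] \<delta> by auto
  \<comment> \<open>With \<open>\<eta> < 1\<close> the truncation in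
    \<open>min 1 (ln (s j / s i)) < \<eta>\<close> is inactive, so a block of clock length
    \<open>\<eta>\<close> has ratio below \<open>1 + \<kappa>\<close>.\<close>
  define \<eta> where "\<eta> = ln (1 + \<kappa>)"
  have \<eta>: "0 < \<eta>" "\<eta> < 1"
  proof -
    show "0 < \<eta>" using \<kappa> by (simp add: \<eta>_def)
    have "\<eta> \<le> \<kappa>" unfolding \<eta>_def using \<kappa> by (intro ln_add_one_self_le_self) simp
    moreover have "\<eta> \<noteq> \<kappa>"
      using ln_eq_minus_one[of "1 + \<kappa>"] \<kappa> by (auto simp: \<eta>_def)
    ultimately show "\<eta> < 1" using \<kappa> by linarith
  qed
  define B where "B n = {j. 1 \<le> j \<and> real n * \<eta> \<le> \<tau> j \<and> \<tau> j < (real n + 1) * \<eta>}" for n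
  have B_finite: "finite (B n)" for n
  proof -
    have "eventually (\<lambda>j. (real n + 1) * \<eta> \<le> \<tau> j) sequentially" using \<tau>_at_top by (simp add: filterlim_at_top)
    then obtain N where "\<And>j. N \<le> j \<Longrightarrow> (real n + 1) * \<eta> \<le> \<tau> j" by (auto simp: eventually_sequentially)
    then have "j < N" if "j \<in> B n" for j using that by (fastforce simp: B_def not_le[symmetric])
    then have "B n \<subseteq> {..N}" by (auto intro: less_imp_le)
    then show ?thesis by (rule finite_subset) simp
  qed
  have B_near: "s j < (1 + \<kappa>) * s i" if "i \<in> B n" "j \<in> B n" "i \<le> j" for n i j
  proof -
    have i: "1 \<le> i" "0 < s i" using that s_pos by (auto simp: B_def)
    have "min 1 (ln (s j / s i)) < \<eta>"
      using \<tau>_increment(1)[OF i(1) that(3)] that by (simp add: B_def algebra_simps)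
    then have "ln (s j / s i) < ln (1 + \<kappa>)" using \<eta> by (simp add: \<eta>_def min_def split: if_splits)
    then have "s j / s i < 1 + \<kappa>" using i s_pos[of j] that \<kappa> by (simp add: ln_less_cancel_iff)
    then show ?thesis using i by (simp add: divide_less_eq)
  qed
  \<comment> \<open>The logarithm of the clock at the left end of the block, a lower bound for
    \<open>ln (\<tau> j)\<close> throughout it.\<close>
  define X where "X n = ln (real n * \<eta>)" for n
  define A where "A n = {\<omega> \<in> space M. \<exists>j\<in>B n. (1 + \<delta>) * s j * X n < Y j \<omega>}" for n
  have A_meas: "A n \<in> sets M" for n
  proof -
    have "(\<Union>j\<in>B n. {\<omega> \<in> space M. (1 + \<delta>) * s j * X n < Y j \<omega>}) \<in> sets M"
      by (intro sets.finite_UN B_finite borel_measurable_less borel_measurable_const Y_measurable) (simp add: B_def)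
    also have "(\<Union>j\<in>B n. {\<omega> \<in> space M. (1 + \<delta>) * s j * X n < Y j \<omega>}) = A n" by (auto simp: A_def)
    finally show ?thesis .
  qed
  \<comment> \<open>The threshold factor \<open>1 + \<delta> / 2\<close> over the scale factor
    \<open>1 + \<delta> / 4\<close> used in the exponential moment. A perturbation below
    \<open>\<delta> / 8\<close> keeps that moment finite uniformly.\<close>
  define q where "q = (1 + \<delta> / 2) / (1 + \<delta> / 4)"
  have q: "1 < q" "q \<le> 2" using \<delta> by (auto simp: q_def field_simps)
  define c where "c = ((\<delta> / 8) / (1 + \<delta> / 4)) powr - \<alpha> + 4 * 2 powr \<alpha>"
  have "eventually (\<lambda>j. E j / s j < \<delta> / 8) sequentially"
    using order_tendstoD(2)[OF small, of "\<delta> / 8"] \<delta> by (simp add: E_def)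
  then obtain N where N: "\<And>j. N \<le> j \<Longrightarrow> E j / s j < \<delta> / 8" by (auto simp: eventually_sequentially)
  \<comment> \<open>From \<open>n0\<close> on, \<open>X n \<ge> 1\<close> as the block inequality
    demands, and all indices of the block are at least \<open>N\<close>, where the perturbation is
    small.\<close>
  define n0 where "n0 = nat \<lceil>(exp 1 + \<tau> (Suc N)) / \<eta>\<rceil> + 1"
  have n0: "exp 1 < real n * \<eta>" "\<tau> (Suc N) < real n * \<eta>" if "n0 \<le> n" for n
  proof -
    have t0: "0 \<le> \<tau> (Suc N)" using \<tau>_mono[of 1 "Suc N"] \<tau>_1 by simp
    have "(exp 1 + \<tau> (Suc N)) / \<eta> < real n" using that unfolding n0_def by linarith
    then have "exp 1 + \<tau> (Suc N) < real n * \<eta>" using \<eta> by (simp add: divide_less_eq)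
    then show "exp 1 < real n * \<eta>" "\<tau> (Suc N) < real n * \<eta>" using t0 exp_gt_zero[of "1 :: real"] by linarith+
  qed
  have A_bound: "measure M (A n) \<le> c * (real n * \<eta>) powr - q" if n: "n0 \<le> n" for n
  proof (cases "B n = {}")
    case True
    then have "A n = {}" by (simp add: A_def)
    then show ?thesis by (simp add: c_def)
  next
    case False
    define i where "i = Min (B n)"
    have iB: "i \<in> B n" unfolding i_def by (rule Min_in[OF B_finite False])
    have i1: "1 \<le> i" and i\<tau>: "real n * \<eta> \<le> \<tau> i" using iB by (auto simp: B_def)
    have "N \<le> i"
    proof (rule ccontr)
      assume "\<not> N \<le> i"
      then have "\<tau> i \<le> \<tau> (Suc N)" using i1 by (intro \<tau>_mono) auto
      then show False using n0(2)[OF n] i\<tau> by linarith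
    qed
    have S: "0 < s i" by (rule s_pos[OF i1])
    have Xn: "1 \<le> X n" unfolding X_def using n0(1)[OF n] by (subst ln_ge_iff) (auto intro: less_trans[OF exp_gt_zero])
    have eX: "exp (- z * X n) = (real n * \<eta>) powr - z" for z
    proof -
      have "n \<noteq> 0" using less_trans[OF exp_gt_zero n0(1)[OF n]] by (cases n) auto
      then show ?thesis using \<eta> by (simp add: X_def powr_def)
    qed
    have K: "s i + E i \<le> (1 + \<delta> / 8) * s i"
      using N[OF \<open>N \<le> i\<close>] S by (simp add: divide_less_eq algebra_simps)
    define \<theta> where "\<theta> = 1 / ((1 + \<delta> / 4) * s i)"
    have \<theta>: "0 < \<theta>" using S \<delta> by (simp add: \<theta>_def)
    have "(s i + E i) * \<theta> \<le> ((1 + \<delta> / 8) * s i) * \<theta>" using K \<theta> by (intro mult_right_mono) auto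
    also have "\<dots> = (1 + \<delta> / 8) / (1 + \<delta> / 4)" using S by (simp add: \<theta>_def)
    also have "\<dots> = 1 - (\<delta> / 8) / (1 + \<delta> / 4)" using \<delta> by (simp add: field_simps)
    finally have K\<theta>: "(\<delta> / 8) / (1 + \<delta> / 4) \<le> 1 - (s i + E i) * \<theta>" by simp
    have d0: "0 < (\<delta> / 8) / (1 + \<delta> / 4)" using \<delta> by simp
    define y where "y = (1 + \<delta> / 2) * s i * X n"
    have "measure M {\<omega> \<in> space M. y < Y i \<omega>} \<le> (1 - (s i + E i) * \<theta>) powr - \<alpha> * exp (- (\<theta> * y))"
      by (rule Y_tail[OF i1]) (use K\<theta> d0 \<theta> in linarith)+
    also have "\<dots> \<le> ((\<delta> / 8) / (1 + \<delta> / 4)) powr - \<alpha> * exp (- (\<theta> * y))"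
      using K\<theta> d0 \<alpha> by (intro mult_right_mono powr_mono2') auto
    also have "\<theta> * y = q * X n" using S by (simp add: \<theta>_def y_def q_def)
    finally have 1: "measure M {\<omega> \<in> space M. y < Y i \<omega>} \<le> ((\<delta> / 8) / (1 + \<delta> / 4)) powr - \<alpha> * (real n * \<eta>) powr - q"
      using eX[of q] by simp
    define D where "D = {\<omega> \<in> space M. \<exists>j\<in>B n. \<delta> / 2 * s i * X n < \<bar>Y j \<omega> - Y i \<omega>\<bar>}"
    have D_meas: "D \<in> sets M"
    proof -
      have "(\<Union>j\<in>B n. {\<omega> \<in> space M. \<delta> / 2 * s i * X n < \<bar>Y j \<omega> - Y i \<omega>\<bar>}) \<in> sets M"
        by (intro sets.finite_UN B_finite borel_measurable_less borel_measurable_const borel_measurable_abs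
            borel_measurable_diff Y_measurable i1) (simp add: B_def)
      also have "(\<Union>j\<in>B n. {\<omega> \<in> space M. \<delta> / 2 * s i * X n < \<bar>Y j \<omega> - Y i \<omega>\<bar>}) = D" by (auto simp: D_def)
      finally show ?thesis .
    qed
    have "measure M D \<le> 4 * 2 powr \<alpha> * exp (- 2 * X n)"
      unfolding D_def i_def
    proof (rule block[OF B_finite False _ _ Xn])
      show "\<forall>j\<in>B n. s j < (1 + \<kappa>) * s (Min (B n))"
        using B_near[OF iB] Min_le[OF B_finite] by (auto simp: i_def)
    qed (auto simp: B_def)
    also have "\<dots> \<le> 4 * 2 powr \<alpha> * (real n * \<eta>) powr - q"
      unfolding eX using q n0(1)[OF n] exp_ge_add_one_self[of 1] by (intro mult_left_mono powr_mono) auto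
    finally have 2: "measure M D \<le> 4 * 2 powr \<alpha> * (real n * \<eta>) powr - q" .
    \<comment> \<open>The excess \<open>\<delta>\<close> is split: one half for the first index, one
      half for the oscillation.\<close>
    have sub: "A n \<subseteq> {\<omega> \<in> space M. y < Y i \<omega>} \<union> D"
    proof
      fix \<omega> assume "\<omega> \<in> A n"
      then obtain j where j: "\<omega> \<in> space M" "j \<in> B n" "(1 + \<delta>) * s j * X n < Y j \<omega>" by (auto simp: A_def)
      have "s i \<le> s j" using s_le[OF i1] Min_le[OF B_finite j(2)] by (simp add: i_def)
      then have "(1 + \<delta>) * s i * X n \<le> (1 + \<delta>) * s j * X n" using \<delta> Xn by (intro mult_right_mono mult_left_mono) auto
      then have "y + \<delta> / 2 * s i * X n < Y j \<omega>" using j(3) by (simp add: y_def algebra_simps)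
      then show "\<omega> \<in> {\<omega> \<in> space M. y < Y i \<omega>} \<union> D"
      proof (cases "y < Y i \<omega>")
        case False
        then have "\<delta> / 2 * s i * X n < \<bar>Y j \<omega> - Y i \<omega>\<bar>"
          using \<open>y + \<delta> / 2 * s i * X n < Y j \<omega>\<close> by linarith
        then show ?thesis using j by (auto simp: D_def)
      qed (use j in simp)
    qed
    have m1: "{\<omega> \<in> space M. y < Y i \<omega>} \<in> sets M" using Y_measurable[OF i1] by measurable
    have "measure M (A n) \<le> measure M ({\<omega> \<in> space M. y < Y i \<omega>} \<union> D)"
      using m1 D_meas by (intro finite_measure_mono sub) auto
    also have "\<dots> \<le> measure M {\<omega> \<in> space M. y < Y i \<omega>} + measure M D"
      by (rule measure_Un_le[OF m1 D_meas])
    finally show ?thesis using 1 2 by (simp add: c_def distrib_right)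
  qed
  have "summable (\<lambda>n. measure M (A n))"
  proof (rule summable_comparison_test_ev)
    have "summable (\<lambda>n. real n powr - q)" using q by (subst summable_real_powr_iff) simp
    then show "summable (\<lambda>n. c * \<eta> powr - q * real n powr - q)" by (rule summable_mult)
    show "eventually (\<lambda>n. norm (measure M (A n)) \<le> c * \<eta> powr - q * real n powr - q) sequentially"
      using eventually_ge_at_top[of n0]
      by eventually_elim (use A_bound in \<open>simp add: powr_mult mult_ac\<close>)
  qed
  then have "AE \<omega> in M. eventually (\<lambda>n. \<omega> \<in> space M - A n) sequentially"
    by (intro borel_cantelli_AE1 A_meas) (simp_all add: emeasure_eq_measure)
  then show ?thesis
  proof eventually_elim
    case (elim \<omega>)
    then obtain n1 where n1: "\<And>n. n1 \<le> n \<Longrightarrow> \<omega> \<in> space M - A n" by (auto simp: eventually_sequentially)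
    define m where "m = max n0 n1"
    have "eventually (\<lambda>j. (real m + 1) * \<eta> \<le> \<tau> j) sequentially" using \<tau>_at_top by (simp add: filterlim_at_top)
    then show ?case using eventually_ge_at_top[of 1]
    proof eventually_elim
      case (elim j)
      define n where "n = nat \<lfloor>\<tau> j / \<eta>\<rfloor>"
      have "real m + 1 \<le> \<tau> j / \<eta>" using elim(1) \<eta> by (simp add: le_divide_eq)
      then have n: "m \<le> n" "real n \<le> \<tau> j / \<eta>" "\<tau> j / \<eta> < real n + 1" unfolding n_def by linarith+
      then have "j \<in> B n" using elim(2) \<eta> by (simp add: B_def le_divide_eq divide_less_eq)
      then have "Y j \<omega> \<le> (1 + \<delta>) * s j * X n"
        using n1[of n] n(1) by (force simp: m_def A_def)
      also have "\<dots> \<le> (1 + \<delta>) * s j * ln (\<tau> j)"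
      proof (intro mult_left_mono)
        have "0 < real n * \<eta>" using n0(1)[of n] n(1) less_trans[OF exp_gt_zero] by (auto simp: m_def)
        then show "X n \<le> ln (\<tau> j)" unfolding X_def using \<open>j \<in> B n\<close> by (intro ln_mono) (auto simp: B_def)
        show "0 \<le> (1 + \<delta>) * s j" using \<delta> s_pos[OF elim(2)] by simp
      qed
      finally show ?case .
    qed
  qed
qed

text \<open>Greedy choice: the next index is the first at which \<open>s\<close> has grown by
  \<open>\<theta>\<close>. Minimality keeps the clock from running ahead, so \<open>\<tau>\<close>
  is at most linear in \<open>k\<close> and \<open>ln (\<tau> (\<kappa> k))\<close> is at most
  \<open>ln k\<close> up to a constant.\<close>

lemma geometric_subsequence:
  assumes \<theta>: "1 < \<theta>"
  shows "\<exists>\<kappa>. strict_mono \<kappa> \<and> (\<forall>k. 1 \<le> \<kappa> k \<and> \<theta> * s (\<kappa> k) \<le> s (\<kappa> (Suc k)) \<and> \<tau> (\<kappa> k) \<le> real k * (ln \<theta> + 1))"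
proof -
  have "\<exists>\<kappa>. \<forall>k. (1 \<le> \<kappa> k \<and> \<tau> (\<kappa> k) \<le> real k * (ln \<theta> + 1)) \<and> (\<kappa> k < \<kappa> (Suc k) \<and> \<theta> * s (\<kappa> k) \<le> s (\<kappa> (Suc k)))"
  proof (rule dependent_nat_choice)
    show "\<exists>x. 1 \<le> x \<and> \<tau> x \<le> real 0 * (ln \<theta> + 1)" using \<tau>_1 by (intro exI[of _ 1]) simp
    fix x k assume x: "1 \<le> x \<and> \<tau> x \<le> real k * (ln \<theta> + 1)"
    then have x1: "1 \<le> x" by simp
    define P where "P j \<longleftrightarrow> x < j \<and> \<theta> * s x \<le> s j" for j
    have "eventually (\<lambda>j. \<theta> * s x \<le> s j) sequentially" using s_top by (simp add: filterlim_at_top)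
    then have "eventually P sequentially" using eventually_gt_at_top[of x] by eventually_elim (simp add: P_def)
    then have "\<exists>j. P j" by (auto simp: eventually_sequentially)
    then have y: "P (LEAST j. P j)" by (rule LeastI_ex)
    define y where "y = (LEAST j. P j)"
    have Py: "x < y" "\<theta> * s x \<le> s y" using y by (auto simp: y_def P_def)
    \<comment> \<open>Up to the predecessor \<open>z\<close> the ratio is at most
      \<open>\<theta>\<close>, so the clock gains at most \<open>ln \<theta>\<close>; the final step
      may be a huge jump but counts at most 1.\<close>
    define z where "z = y - 1"
    have z: "x \<le> z" "y = Suc z" using Py by (auto simp: z_def)
    have "\<not> P z" using z not_less_Least[of z P] by (simp add: y_def)
    have "s z \<le> \<theta> * s x"
    proof (cases "x = z")
      case True
      then show ?thesis using \<theta> s_pos[OF x1] by simp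
    next
      case False
      then show ?thesis using \<open>\<not> P z\<close> z by (auto simp: P_def)
    qed
    then have "s z / s x \<le> \<theta>" using s_pos[OF x1] by (simp add: divide_le_eq)
    moreover have "0 < s z / s x" using s_pos x1 z by simp
    ultimately have "ln (s z / s x) \<le> ln \<theta>" by simp
    then have "\<tau> z - \<tau> x \<le> ln \<theta>" using \<tau>_increment(2)[OF x1 z(1)] by simp
    moreover have "\<tau> y \<le> \<tau> z + 1" using \<tau>_Suc[of z] x1 z by simp
    ultimately have "\<tau> y \<le> real (Suc k) * (ln \<theta> + 1)" using x by (simp add: algebra_simps)
    then show "\<exists>y. (1 \<le> y \<and> \<tau> y \<le> real (Suc k) * (ln \<theta> + 1)) \<and> x < y \<and> \<theta> * s x \<le> s y"
      using Py by (intro exI[of _ y]) auto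
  qed
  then obtain \<kappa> where "\<And>k. 1 \<le> \<kappa> k" "\<And>k. \<tau> (\<kappa> k) \<le> real k * (ln \<theta> + 1)" "\<And>k. \<kappa> k < \<kappa> (Suc k)"
    "\<And>k. \<theta> * s (\<kappa> k) \<le> s (\<kappa> (Suc k))" by blast
  then show ?thesis by (intro exI[of _ \<kappa>]) (auto simp: strict_mono_Suc_iff)
qed

text \<open>Along the subsequence every gap of \<open>s\<close> is comparable with \<open>s\<close>
  itself, so the diagonal of the inverse kernel is at most
  \<open>(\<theta> + 1) / (\<theta> - 1)\<close> times \<open>1 / s (\<kappa> i)\<close>. For large
  \<open>\<theta>\<close> this is almost the rate of an independent gamma variable of scale
  \<open>s (\<kappa> i)\<close>.\<close>

lemma geometric_domination:
  assumes \<theta>: "1 < \<theta>" and \<kappa>: "strict_mono \<kappa>" "\<And>k. 1 \<le> \<kappa> k" "\<And>k. \<theta> * s (\<kappa> k) \<le> s (\<kappa> (Suc k))"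
    and uv: "\<And>i. i < n \<Longrightarrow> u i < v i"
  shows "measure M {\<omega> \<in> space M. \<forall>i<n. Y (\<kappa> i) \<omega> \<le> u i} \<le>
    (\<Prod>i<n. 1 - measure (gamma_law \<alpha>) {(\<theta> + 1) / ((\<theta> - 1) * s (\<kappa> i)) * v i..})"
proof -
  \<comment> \<open>Index 0 carries the boundary value 0 in all three sequences; entry
    \<open>Suc k\<close> belongs to \<open>\<kappa> k\<close>.\<close>
  define \<sigma> where "\<sigma> i = (case i of 0 \<Rightarrow> 0 | Suc k \<Rightarrow> s (\<kappa> k))" for i
  define b where "b i = (case i of 0 \<Rightarrow> 0 | Suc k \<Rightarrow> \<beta> (s (\<kappa> k)))" for i
  define \<phi> where "\<phi> i = (case i of 0 \<Rightarrow> 0 | Suc k \<Rightarrow> \<Phi> (s (\<kappa> k)))" for i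
  define K where "K i j = min (\<sigma> (Suc i)) (\<sigma> (Suc j)) + b (Suc i) * \<phi> (Suc j)" for i j
  have sp: "0 < s (\<kappa> k)" for k by (rule s_pos[OF \<kappa>(2)])
  have \<sigma>0: "\<sigma> 0 = 0" and b0: "b 0 = 0" and \<phi>0: "\<phi> 0 = 0" by (simp_all add: \<sigma>_def b_def \<phi>_def)
  have \<sigma>_less: "\<sigma> i < \<sigma> (Suc i)" for i
  proof (cases i)
    case (Suc k)
    have "\<kappa> k < \<kappa> (Suc k)" using \<kappa>(1) by (simp add: strict_mono_Suc_iff)
    then show ?thesis using s_less[OF \<kappa>(2)] Suc by (simp add: \<sigma>_def)
  qed (simp add: \<sigma>_def sp)
  have d: "1 / (\<sigma> (Suc i) - \<sigma> i) + 1 / (\<sigma> (Suc (Suc i)) - \<sigma> (Suc i)) \<le> (\<theta> + 1) / ((\<theta> - 1) * s (\<kappa> i))" for i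
  proof -
    have "1 / (\<sigma> (Suc i) - \<sigma> i) \<le> \<theta> / ((\<theta> - 1) * s (\<kappa> i))"
    proof (cases i)
      case 0
      then show ?thesis using \<theta> sp[of 0] by (simp add: \<sigma>_def field_simps)
    next
      case (Suc k)
      have "(\<theta> - 1) * s (\<kappa> i) \<le> \<theta> * (s (\<kappa> i) - s (\<kappa> k))"
        using \<kappa>(3)[of k] Suc by (simp add: algebra_simps)
      moreover have "0 < s (\<kappa> i) - s (\<kappa> k)" using \<sigma>_less[of i] Suc by (simp add: \<sigma>_def)
      moreover have "0 < (\<theta> - 1) * s (\<kappa> i)" using \<theta> sp by simp
      ultimately show ?thesis using Suc by (simp add: \<sigma>_def divide_le_eq pos_le_divide_eq mult.commute)
    qed
    moreover have "1 / (\<sigma> (Suc (Suc i)) - \<sigma> (Suc i)) \<le> 1 / ((\<theta> - 1) * s (\<kappa> i))"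
      using \<kappa>(3)[of i] \<theta> sp[of i] \<sigma>_less[of "Suc i"]
      by (intro divide_left_mono mult_pos_pos) (auto simp: \<sigma>_def algebra_simps)
    ultimately show ?thesis by (simp add: add_divide_distrib)
  qed
  have dq: "0 \<le> difference_quotient \<sigma> b i" "difference_quotient \<sigma> b (Suc i) \<le> difference_quotient \<sigma> b i"
    "0 \<le> difference_quotient \<sigma> \<phi> i" "difference_quotient \<sigma> \<phi> (Suc i) \<le> difference_quotient \<sigma> \<phi> i" for i
    by (rule concave_difference_quotients[OF \<beta>_concave \<beta>_mono \<beta>_nonneg \<sigma>0 \<sigma>_less]
          concave_difference_quotients[OF \<Phi>_concave \<Phi>_mono \<Phi>_nonneg \<sigma>0 \<sigma>_less];
        simp add: b_def \<phi>_def \<sigma>_def)+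
  obtain A where "\<exists>x. (\<forall>i<n. \<forall>j<n. i \<noteq> j \<longrightarrow> A i j \<le> 0) \<and>
    (\<forall>i<n. A i i \<le> 1 / (\<sigma> (Suc i) - \<sigma> i) + 1 / (\<sigma> (Suc (Suc i)) - \<sigma> (Suc i))) \<and>
    (\<forall>i<n. \<forall>k<n. (\<Sum>j<n. A i j * K j k) = of_bool (i = k)) \<and>
    (\<forall>i<n. 0 < x i) \<and> (\<forall>i<n. 0 < (\<Sum>j<n. A i j * x j))"
    using perturbed_min_kernel_M_matrix[of \<sigma> b \<phi> n, OF \<sigma>0 \<sigma>_less b0 dq(1,2) \<phi>0 dq(3,4)]
    unfolding K_def by (rule exE)
  then obtain x where *: "(\<forall>i<n. \<forall>j<n. i \<noteq> j \<longrightarrow> A i j \<le> 0) \<and>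
    (\<forall>i<n. A i i \<le> 1 / (\<sigma> (Suc i) - \<sigma> i) + 1 / (\<sigma> (Suc (Suc i)) - \<sigma> (Suc i))) \<and>
    (\<forall>i<n. \<forall>k<n. (\<Sum>j<n. A i j * K j k) = of_bool (i = k)) \<and>
    (\<forall>i<n. 0 < x i) \<and> (\<forall>i<n. 0 < (\<Sum>j<n. A i j * x j))"
    by (rule exE)
  have A: "i < n \<Longrightarrow> j < n \<Longrightarrow> i \<noteq> j \<Longrightarrow> A i j \<le> 0"
    "i < n \<Longrightarrow> A i i \<le> 1 / (\<sigma> (Suc i) - \<sigma> i) + 1 / (\<sigma> (Suc (Suc i)) - \<sigma> (Suc i))"
    "i < n \<Longrightarrow> k < n \<Longrightarrow> (\<Sum>j<n. A i j * K j k) = of_bool (i = k)"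
    "i < n \<Longrightarrow> 0 < x i" "i < n \<Longrightarrow> 0 < (\<Sum>j<n. A i j * x j)" for i j k
    using * by blast+
  show ?thesis
  proof (rule M_matrix_gamma_domination[OF prob_space_axioms _ _ \<alpha> _ A(1) order_trans[OF A(2) d] A(3) A(4) A(5) _ uv])
    show "Y (\<kappa> i) \<in> borel_measurable M" for i by (rule Y_measurable[OF \<kappa>(2)])
    show "0 \<le> Y (\<kappa> i) \<omega>" if "\<omega> \<in> space M" for i \<omega> by (rule Y_nonneg[OF \<kappa>(2) that])
    show "0 < (\<theta> + 1) / ((\<theta> - 1) * s (\<kappa> i))" for i using \<theta> sp[of i] by simp
    show "(LINT \<omega>|M. exp (- (\<Sum>i<n. t i * Y (\<kappa> i) \<omega>))) =
        Determinant.det (1\<^sub>m n + Matrix.mat n n (\<lambda>(p, q). K p q) * mat_diag n t) powr - \<alpha>"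
      if "\<And>i. i < n \<Longrightarrow> 0 < t i" for t
    proof -
      have K: "K = (\<lambda>p q. min (s (\<kappa> p)) (s (\<kappa> q)) + \<beta> (s (\<kappa> p)) * \<Phi> (s (\<kappa> q)))"
        by (intro ext) (simp add: K_def \<sigma>_def b_def \<phi>_def)
      show ?thesis unfolding K
        by (rule permanental_sequenceD[OF permanental strict_mono_imp_inj_on[OF \<kappa>(1)] \<kappa>(2) that])
    qed
  qed
qed

text \<open>The variables are not independent, so the second Borel-Cantelli lemma is replaced by the
  product bound of \<open>geometric_domination\<close>, applied to every tail
  \<open>k \<ge> m\<close> of the subsequence. Excluding \<open>F\<close> for each \<open>m\<close>
  gives infinitely many exceedances.\<close>

lemma lower_bound:
  assumes \<delta>: "0 < \<delta>" "\<delta> < 1"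
  shows "AE \<omega> in M. \<forall>m. \<exists>j\<ge>m. (1 - \<delta>) * s j * ln (\<tau> j) < Y j \<omega>"
proof -
  \<comment> \<open>Solves \<open>(\<theta> + 1) / (\<theta> - 1) = 1 + \<delta> / 4\<close>, so
    that the loss in the rate is covered by part of \<open>\<delta>\<close>.\<close>
  define \<theta> where "\<theta> = 1 + 8 / \<delta>"
  have \<theta>: "1 < \<theta>" using \<delta> by (simp add: \<theta>_def)
  have \<theta>\<delta>: "(\<theta> + 1) / (\<theta> - 1) * (1 - \<delta> / 2) \<le> 1 - \<delta> / 4"
  proof -
    have "(\<theta> + 1) / (\<theta> - 1) = 1 + \<delta> / 4" using \<delta> by (simp add: \<theta>_def field_simps)
    moreover have "(1 + \<delta> / 4) * (1 - \<delta> / 2) = 1 - \<delta> / 4 - \<delta> * \<delta> / 8" by (simp add: field_simps)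
    ultimately show ?thesis by simp
  qed
  define T where "T = ln \<theta> + 1"
  have T: "1 < T" using \<theta> by (simp add: T_def)
  obtain \<kappa> where \<kappa>: "strict_mono \<kappa>" "\<And>k. 1 \<le> \<kappa> k" "\<And>k. \<theta> * s (\<kappa> k) \<le> s (\<kappa> (Suc k))" "\<And>k. \<tau> (\<kappa> k) \<le> real k * T"
    using geometric_subsequence[OF \<theta>] unfolding T_def by blast
  obtain c where c: "0 < c" and tail: "\<And>X. 2 \<le> X \<Longrightarrow>
      c * exp (- X) \<le> measure (gamma_law \<alpha>) {(1 - \<delta> / 4) * X..} \<or> (1 - \<delta> / 4) * X < 1"
    using gamma_law_tail_exp[OF \<alpha>, of "\<delta> / 4"] \<delta> by auto
  \<comment> \<open>Makes \<open>exp (- X k)\<close> a harmonic term, and dominates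
    \<open>ln (\<tau> (\<kappa> k))\<close> because
    \<open>\<tau> (\<kappa> k) \<le> real k * T\<close>.\<close>
  define X where "X k = ln (T * real (Suc k))" for k
  have expX: "exp (X k) = T * real (Suc k)" for k using T by (simp add: X_def)
  define k0 where "k0 = nat \<lceil>exp 2 :: real\<rceil>"
  have X2: "2 \<le> X k" if "k0 \<le> k" for k
  proof -
    have "exp 2 \<le> real (Suc k)" using that unfolding k0_def by linarith
    also have "\<dots> \<le> T * real (Suc k)" using T by simp
    finally show ?thesis unfolding X_def using T by (subst ln_ge_iff) auto
  qed
  define u where "u k = (1 - \<delta>) * s (\<kappa> k) * X k" for k
  have sp: "0 < s (\<kappa> k)" for k by (rule s_pos[OF \<kappa>(2)])
  have ae: "AE \<omega> in M. \<exists>k\<ge>m. u k < Y (\<kappa> k) \<omega>" if m: "k0 \<le> m" for m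
  proof -
    define F where "F = {\<omega> \<in> space M. \<forall>k. Y (\<kappa> (m + k)) \<omega> \<le> u (m + k)}"
    have F_meas: "F \<in> sets M"
    proof -
      have "(\<Inter>k. {\<omega> \<in> space M. Y (\<kappa> (m + k)) \<omega> \<le> u (m + k)}) \<in> sets M"
        by (intro sets.countable_INT' borel_measurable_le borel_measurable_const Y_measurable[OF \<kappa>(2)]
            image_subsetI) auto
      also have "(\<Inter>k. {\<omega> \<in> space M. Y (\<kappa> (m + k)) \<omega> \<le> u (m + k)}) = F" by (auto simp: F_def)
      finally show ?thesis .
    qed
    have F_le: "measure M F \<le> exp (- (\<Sum>i<n. c / (T * real (Suc (m + i)))))" for n
    proof -
      \<comment> \<open>Slightly above \<open>u\<close>, the room required by
        \<open>M_matrix_gamma_domination\<close>; after the rate loss the threshold is still below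
        \<open>(1 - \<delta> / 4) * X\<close>.\<close>
      define v where "v i = (1 - \<delta> / 2) * s (\<kappa> (m + i)) * X (m + i)" for i
      have Fn_meas: "{\<omega> \<in> space M. \<forall>i<n. Y (\<kappa> (m + i)) \<omega> \<le> u (m + i)} \<in> sets M"
      proof -
        have "{\<omega> \<in> space M. \<forall>i\<in>{..<n}. Y (\<kappa> (m + i)) \<omega> \<le> u (m + i)} \<in> sets M"
          by (intro sets.sets_Collect_finite_All borel_measurable_le borel_measurable_const Y_measurable[OF \<kappa>(2)]) simp
        also have "{\<omega> \<in> space M. \<forall>i\<in>{..<n}. Y (\<kappa> (m + i)) \<omega> \<le> u (m + i)} =
          {\<omega> \<in> space M. \<forall>i<n. Y (\<kappa> (m + i)) \<omega> \<le> u (m + i)}" by auto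
        finally show ?thesis .
      qed
      have "measure M F \<le> measure M {\<omega> \<in> space M. \<forall>i<n. Y (\<kappa> (m + i)) \<omega> \<le> u (m + i)}"
        by (intro finite_measure_mono Fn_meas) (auto simp: F_def)
      also have "\<dots> \<le> (\<Prod>i<n. 1 - measure (gamma_law \<alpha>) {(\<theta> + 1) / ((\<theta> - 1) * s (\<kappa> (m + i))) * v i..})"
      proof (rule geometric_domination[OF \<theta>, of "\<lambda>i. \<kappa> (m + i)" n "\<lambda>i. u (m + i)" v])
        show "strict_mono (\<lambda>i. \<kappa> (m + i))" using \<kappa>(1) by (simp add: strict_mono_def)
        show "u (m + i) < v i" for i
          using \<delta> sp[of "m + i"] X2[of "m + i"] m by (simp add: u_def v_def)
      qed (use \<kappa> in auto)
      also have "\<dots> \<le> (\<Prod>i<n. exp (- (c / (T * real (Suc (m + i))))))"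
      proof (intro prod_mono conjI)
        fix i
        interpret G: prob_space "gamma_law \<alpha>" by (rule prob_space_gamma_law[OF \<alpha>])
        show "0 \<le> 1 - measure (gamma_law \<alpha>) {(\<theta> + 1) / ((\<theta> - 1) * s (\<kappa> (m + i))) * v i..}" by simp
        have Xi: "2 \<le> X (m + i)" using X2 m by simp
        have "(\<theta> + 1) / ((\<theta> - 1) * s (\<kappa> (m + i))) * v i = ((\<theta> + 1) / (\<theta> - 1) * (1 - \<delta> / 2)) * X (m + i)"
          using sp[of "m + i"] by (simp add: v_def)
        also have "\<dots> \<le> (1 - \<delta> / 4) * X (m + i)" using \<theta>\<delta> Xi by (intro mult_right_mono) auto
        finally have "{(1 - \<delta> / 4) * X (m + i)..} \<subseteq> {(\<theta> + 1) / ((\<theta> - 1) * s (\<kappa> (m + i))) * v i..}" by auto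
        then have "measure (gamma_law \<alpha>) {(1 - \<delta> / 4) * X (m + i)..} \<le> measure (gamma_law \<alpha>) {(\<theta> + 1) / ((\<theta> - 1) * s (\<kappa> (m + i))) * v i..}"
          by (rule G.finite_measure_mono) simp
        moreover have "c * exp (- X (m + i)) \<le> measure (gamma_law \<alpha>) {(1 - \<delta> / 4) * X (m + i)..}"
        proof -
          \<comment> \<open>This rules out the second alternative of \<open>tail\<close>, since the
            threshold is at least \<open>3 / 2\<close>.\<close>
          have "(3 / 4) * 2 \<le> (1 - \<delta> / 4) * X (m + i)" using \<delta> Xi by (intro mult_mono) auto
          then show ?thesis using tail[OF Xi] by linarith
        qed
        moreover have "c * exp (- X (m + i)) = c / (T * real (Suc (m + i)))"
          by (simp only: exp_minus expX divide_inverse)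
        ultimately have "1 - measure (gamma_law \<alpha>) {(\<theta> + 1) / ((\<theta> - 1) * s (\<kappa> (m + i))) * v i..} \<le> 1 - c / (T * real (Suc (m + i)))"
          by linarith
        also have "\<dots> \<le> exp (- (c / (T * real (Suc (m + i)))))"
          using exp_ge_add_one_self[of "- (c / (T * real (Suc (m + i))))"] by simp
        finally show "1 - measure (gamma_law \<alpha>) {(\<theta> + 1) / ((\<theta> - 1) * s (\<kappa> (m + i))) * v i..} \<le> exp (- (c / (T * real (Suc (m + i)))))" .
      qed
      also have "\<dots> = exp (- (\<Sum>i<n. c / (T * real (Suc (m + i)))))"
        by (simp add: exp_sum[symmetric] sum_negf)
      finally show ?thesis .
    qed
    have "measure M F = 0"
    proof (rule ccontr)
      assume "measure M F \<noteq> 0"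
      then have F0: "0 < measure M F" by (simp add: zero_less_measure_iff)
      have "summable (\<lambda>i. c / (T * real (Suc (m + i))))"
      proof (rule summableI_nonneg_bounded)
        show "0 \<le> c / (T * real (Suc (m + i)))" for i using c T by simp
        show "(\<Sum>i<n. c / (T * real (Suc (m + i)))) \<le> - ln (measure M F)" for n
          using ln_mono[OF F_le[of n] F0] by simp
      qed
      from summable_mult[OF this, of "T / c"] have "summable (\<lambda>i. inverse (real (Suc (i + m))))"
        using c T by (simp add: divide_inverse add.commute)
      then have "summable (\<lambda>i. inverse (real (Suc i)))"
        using summable_iff_shift[of "\<lambda>i. inverse (real (Suc i))" m] by simp
      then have "summable (\<lambda>i. inverse (real i))"
        by (subst (asm) summable_Suc_iff)
      then show False using not_summable_harmonic[where ?'a = real] by (simp add: inverse_eq_divide)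
    qed
    then have "AE \<omega> in M. \<omega> \<notin> F" using F_meas by (intro AE_not_in) (auto simp: null_sets_def emeasure_eq_measure)
    then show ?thesis
    proof (rule AE_mp, intro AE_I2 impI)
      fix \<omega> assume "\<omega> \<in> space M" "\<omega> \<notin> F"
      then obtain k where "u (m + k) < Y (\<kappa> (m + k)) \<omega>" by (auto simp: F_def not_le)
      then show "\<exists>k\<ge>m. u k < Y (\<kappa> k) \<omega>" by (intro exI[of _ "m + k"]) simp
    qed
  qed
  have "AE \<omega> in M. \<forall>m. \<exists>k\<ge>max k0 m. u k < Y (\<kappa> k) \<omega>"
    unfolding AE_all_countable by (intro allI ae) simp
  then show ?thesis
  proof eventually_elim
    case (elim \<omega>)
    show ?case
    proof
      fix m
      obtain k where k: "k0 \<le> k" "m \<le> k" "u k < Y (\<kappa> k) \<omega>" using elim[rule_format, of m] by auto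
      have "ln (\<tau> (\<kappa> k)) \<le> X k"
      proof (cases "0 < \<tau> (\<kappa> k)")
        case True
        have "\<tau> (\<kappa> k) \<le> T * real (Suc k)" using \<kappa>(4)[of k] T by (simp add: algebra_simps)
        then show ?thesis unfolding X_def using True by (intro ln_mono) auto
      next
        case False
        \<comment> \<open>Here \<open>ln 0 = 0\<close> by convention, which is below
          \<open>X k \<ge> 2\<close>.\<close>
        then have "\<tau> (\<kappa> k) = 0" using \<tau>_mono[of 1 "\<kappa> k"] \<kappa>(2)[of k] \<tau>_1 by simp
        then show ?thesis using X2[OF k(1)] by simp
      qed
      then have "(1 - \<delta>) * s (\<kappa> k) * ln (\<tau> (\<kappa> k)) \<le> u k"
        unfolding u_def using \<delta> sp[of k] by (intro mult_left_mono) auto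
      moreover have "m \<le> \<kappa> k" using strict_mono_imp_increasing[OF \<kappa>(1), of k] k(2) by linarith
      ultimately show "\<exists>j\<ge>m. (1 - \<delta>) * s j * ln (\<tau> j) < Y j \<omega>"
        using k(3) by (intro exI[of _ "\<kappa> k"]) auto
    qed
  qed
qed

section \<open>The limsup and its three normalisations\<close>

lemma \<tau>_K_seq: "ln (\<tau> j) = K_seq s j"
  by (simp add: \<tau>_def K_seq_def)

lemma ln_\<tau>_at_top: "filterlim (\<lambda>j. ln (\<tau> j)) at_top sequentially"
  by (rule filterlim_compose[OF ln_at_top \<tau>_at_top])

lemma limsup_K_seq: "AE \<omega> in M. limsup (\<lambda>j. ereal (Y j \<omega> / (s j * ln (\<tau> j)))) = 1"
proof -
  have pos: "eventually (\<lambda>j. 0 < ln (\<tau> j) \<and> 1 \<le> j) sequentially"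
    using ln_\<tau>_at_top eventually_ge_at_top[of 1] unfolding filterlim_at_top_dense
    by (auto intro: eventually_conj)
  have "AE \<omega> in M. \<forall>k. eventually (\<lambda>j. Y j \<omega> \<le> (1 + 1 / real (Suc k)) * s j * ln (\<tau> j)) sequentially"
    unfolding AE_all_countable by (intro allI upper_bound) auto
  moreover have "AE \<omega> in M. \<forall>k m. \<exists>j\<ge>m. (1 - 1 / real (Suc (Suc k))) * s j * ln (\<tau> j) < Y j \<omega>"
    unfolding AE_all_countable[where P = "\<lambda>k \<omega>. \<forall>m. \<exists>j\<ge>m. (1 - 1 / real (Suc (Suc k))) * s j * ln (\<tau> j) < Y j \<omega>"]
    by (intro allI lower_bound) auto
  ultimately show ?thesis
  proof eventually_elim
    case (elim \<omega>)
    show ?case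
    proof (rule limsup_eq_1I)
      show "eventually (\<lambda>j. Y j \<omega> / (s j * ln (\<tau> j)) \<le> 1 + 1 / real (Suc k)) sequentially" for k
        using elim(1)[rule_format, of k] pos
      proof eventually_elim
        case (elim j)
        then have "0 < s j * ln (\<tau> j)" using s_pos[of j] by simp
        then show ?case using elim(1) by (simp add: divide_le_eq mult.assoc)
      qed
      show "\<exists>j\<ge>m. 1 - 1 / real (Suc (Suc k)) \<le> Y j \<omega> / (s j * ln (\<tau> j))" for k m
      proof -
        obtain N where N: "\<And>j. N \<le> j \<Longrightarrow> 0 < ln (\<tau> j) \<and> 1 \<le> j" using pos by (auto simp: eventually_sequentially)
        obtain j where j: "max m N \<le> j" "(1 - 1 / real (Suc (Suc k))) * s j * ln (\<tau> j) < Y j \<omega>"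
          using elim(2) by blast
        then have "0 < s j * ln (\<tau> j)" using N[of j] s_pos[of j] by simp
        then show ?thesis using j by (intro exI[of _ j]) (simp add: le_divide_eq mult.assoc less_imp_le)
      qed
    qed
  qed
qed

lemma limsup_equivalent:
  assumes L: "(\<lambda>j. ln (\<tau> j) / L j) \<longlonglongrightarrow> 1"
  shows "AE \<omega> in M. limsup (\<lambda>j. ereal (Y j \<omega> / (s j * L j))) = 1"
  using limsup_K_seq
proof eventually_elim
  case (elim \<omega>)
  have "(\<lambda>j. ereal (ln (\<tau> j) / L j)) \<longlonglongrightarrow> 1" using L by (simp add: one_ereal_def)
  then have "limsup (\<lambda>j. ereal (ln (\<tau> j) / L j) * ereal (Y j \<omega> / (s j * ln (\<tau> j)))) = 1 * 1"
    by (subst ereal_limsup_lim_mult[of _ 1]) (auto simp: elim)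
  moreover have ev: "eventually (\<lambda>j. ereal (ln (\<tau> j) / L j) * ereal (Y j \<omega> / (s j * ln (\<tau> j))) = ereal (Y j \<omega> / (s j * L j))) sequentially"
  proof -
    have "eventually (\<lambda>j. 0 < ln (\<tau> j)) sequentially" using ln_\<tau>_at_top unfolding filterlim_at_top_dense by auto
    then show ?thesis by eventually_elim simp
  qed
  ultimately show ?case using Limsup_eq[OF ev] by simp
qed

text \<open>If steps have logarithm at most \<open>ln R\<close>, truncation at 1 loses only a
  constant factor, and the sum telescopes: \<open>\<tau> j\<close> is of the order of
  \<open>ln (s j)\<close>.\<close>

lemma limsup_bounded_ratio:
  assumes "limsup (\<lambda>j. ereal (s j / s (j - 1))) < \<infinity>"
  shows "AE \<omega> in M. limsup (\<lambda>j. ereal (Y j \<omega> / (s j * ln (ln (s j))))) = 1"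
proof -
  have x: "filterlim (\<lambda>j. ln (s j)) at_top sequentially" by (rule filterlim_compose[OF ln_at_top s_top])
  obtain R where R: "limsup (\<lambda>j. ereal (s j / s (j - 1))) < ereal R" "1 < R"
  proof -
    obtain R where R: "limsup (\<lambda>j. ereal (s j / s (j - 1))) < ereal R"
      using assms less_PInf_Ex_of_nat by (metis ereal_dense2)
    \<comment> \<open>Raising the bound to at least 2 makes \<open>ln R\<close> positive, so that
      \<open>1 / ln R\<close> in \<open>c\<close> makes sense.\<close>
    have "ereal R \<le> ereal (max R 2)" by (subst ereal_less_eq) simp
    then show ?thesis using less_le_trans[OF R] by (intro that[of "max R 2"]) auto
  qed
  define c where "c = min 1 (1 / ln R)"
  have lnR: "0 < ln R" using R by simp
  then have c: "0 < c" by (simp add: c_def)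
  have "eventually (\<lambda>j. ereal (s j / s (j - 1)) < ereal R) sequentially"
    by (rule Limsup_lessD[OF R(1)])
  then have "eventually (\<lambda>j. s j / s (j - 1) < R \<and> 2 \<le> j) sequentially"
    using eventually_ge_at_top[of 2] by eventually_elim simp
  then obtain N where N: "\<And>j. N \<le> j \<Longrightarrow> s j / s (j - 1) < R \<and> 2 \<le> j" by (auto simp: eventually_sequentially)
  have N1: "1 \<le> N" using N[of N] by simp
  have low: "c * ln (s j / s N) \<le> \<tau> j" if "N \<le> j" for j
    using that
  proof (induction j rule: dec_induct)
    case base
    then show ?case using s_pos[OF N1] \<tau>_mono[of 1 N] \<tau>_1 N1 by simp
  next
    case (step k)
    have k: "1 \<le> k" using step N1 by simp
    have p: "0 < s N" "0 < s k" "0 < s (Suc k)" using s_pos N1 k by auto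
    define l where "l = ln (s (Suc k) / s k)"
    have l: "ln (s (Suc k) / s N) = l + ln (s k / s N)"
      using p by (simp add: ln_div l_def)
    have "0 \<le> l" unfolding l_def using ln_ratio_nonneg k by auto
    moreover have "l \<le> ln R" unfolding l_def using N[of "Suc k"] step p by (intro ln_mono) auto
    ultimately have "c * l \<le> min 1 l"
    proof -
      have "c * l \<le> (1 / ln R) * l" using \<open>0 \<le> l\<close> by (intro mult_right_mono) (auto simp: c_def)
      also have "\<dots> \<le> 1" using \<open>l \<le> ln R\<close> lnR by (simp add: divide_le_eq)
      finally have "c * l \<le> 1" .
      moreover have "c * l \<le> 1 * l" using \<open>0 \<le> l\<close> by (intro mult_right_mono) (auto simp: c_def)
      ultimately show ?thesis by simp
    qed
    moreover have "\<tau> (Suc k) = \<tau> k + min 1 l" using \<tau>_Suc[OF k] by (simp add: l_def)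
    ultimately show ?case using step unfolding l distrib_left by linarith
  qed
  have up: "\<tau> j \<le> ln (s j / s 1)" if "1 \<le> j" for j using \<tau>_increment(2)[of 1 j] \<tau>_1 that by simp
  have ev: "eventually (\<lambda>j. 2 * \<bar>ln (s N)\<bar> \<le> ln (s j) \<and> \<bar>ln (s 1)\<bar> \<le> ln (s j)) sequentially"
    using x unfolding filterlim_at_top by (auto intro: eventually_conj)
  have "eventually (\<lambda>j. c / 2 * ln (s j) \<le> \<tau> j \<and> \<tau> j \<le> 2 * ln (s j)) sequentially"
    using ev eventually_ge_at_top[of N]
  proof eventually_elim
    case (elim j)
    have j1: "1 \<le> j" using elim N1 by simp
    have p: "0 < s N" "0 < s 1" "0 < s j" using s_pos N1 j1 by auto
    have "c / 2 * ln (s j) = c * (ln (s j) / 2)" by simp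
    also have "\<dots> \<le> c * ln (s j / s N)"
      using elim c p by (intro mult_left_mono) (auto simp: ln_div)
    also have "\<dots> \<le> \<tau> j" by (rule low[OF elim(2)])
    finally have "c / 2 * ln (s j) \<le> \<tau> j" .
    moreover have "\<tau> j \<le> ln (s j) - ln (s 1)" using up[OF j1] p by (simp add: ln_div)
    ultimately show ?case using elim(1) abs_ge_minus_self[of "ln (s 1)"] by linarith
  qed
  then show ?thesis
    by (intro limsup_equivalent ln_equivalent[OF x, of "c / 2" 2]) (use c in auto)
qed

text \<open>Eventually every step contributes between \<open>min 1 (ln R) > 0\<close> and 1, so
  \<open>\<tau> j\<close> is of the order of \<open>j\<close>.\<close>

lemma limsup_separated:
  assumes "1 < liminf (\<lambda>j. ereal (s j / s (j - 1)))"
  shows "AE \<omega> in M. limsup (\<lambda>j. ereal (Y j \<omega> / (s j * ln (real j)))) = 1"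
proof -
  obtain R where R: "1 < R" "ereal R < liminf (\<lambda>j. ereal (s j / s (j - 1)))"
    using ereal_dense2[OF assms] by (auto simp: one_ereal_def)
  define c where "c = min 1 (ln R)"
  have c: "0 < c" using R by (simp add: c_def)
  have "eventually (\<lambda>j. ereal R < ereal (s j / s (j - 1))) sequentially"
    by (rule less_LiminfD[OF R(2)])
  then have "eventually (\<lambda>j. R < s j / s (j - 1) \<and> 2 \<le> j) sequentially"
    using eventually_ge_at_top[of 2] by eventually_elim simp
  then obtain N where N: "\<And>j. N \<le> j \<Longrightarrow> R < s j / s (j - 1) \<and> 2 \<le> j" by (auto simp: eventually_sequentially)
  have N1: "1 \<le> N" using N[of N] by simp
  have low: "c * (real j - real N) \<le> \<tau> j" if "N \<le> j" for j
    using that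
  proof (induction j rule: dec_induct)
    case base
    then show ?case using \<tau>_mono[of 1 N] \<tau>_1 N1 by simp
  next
    case (step k)
    have k: "1 \<le> k" using step N1 by simp
    have p: "0 < s k" "0 < s (Suc k)" using s_pos k by auto
    have "ln R \<le> ln (s (Suc k) / s k)" using N[of "Suc k"] step R by (intro ln_mono) auto
    then have "c \<le> min 1 (ln (s (Suc k) / s k))" by (auto simp: c_def)
    moreover have "c * (real (Suc k) - real N) = c * (real k - real N) + c" by (simp add: algebra_simps)
    ultimately show ?case using step \<tau>_Suc[OF k] by linarith
  qed
  have "eventually (\<lambda>j. c / 2 * real j \<le> \<tau> j \<and> \<tau> j \<le> 1 * real j) sequentially"
    using eventually_ge_at_top[of "2 * N"]
  proof eventually_elim
    case (elim j)
    have "c / 2 * real j = c * (real j / 2)" by simp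
    also have "\<dots> \<le> c * (real j - real N)" using elim c by (intro mult_left_mono) auto
    also have "\<dots> \<le> \<tau> j" by (rule low) (use elim in simp)
    finally show ?case using \<tau>_increment(3)[of 1 j] \<tau>_1 elim N1 by simp
  qed
  then show ?thesis
    by (intro limsup_equivalent ln_equivalent[OF filterlim_real_sequentially, of "c / 2" 1]) (use c in auto)
qed

end

section \<open>Reduction of the original sequence to the rescaled one\<close>

theorem theorem1p7:
  fixes s b h f :: "nat \<Rightarrow> real" and g :: "real \<Rightarrow> real" and W :: "nat \<Rightarrow> nat \<Rightarrow> real"
    and M :: "'w measure" and \<alpha> :: real and Z :: "nat \<Rightarrow> 'w \<Rightarrow> real"
  assumes "strict_mono_on {1..} s" and "0 < s 1" and "filterlim s at_top sequentially"
    and "\<And>x. 0 \<le> x \<Longrightarrow> 0 \<le> g x" and "mono_on {0..} g" and "sublinear_concave g"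
    and "\<And>j. 1 \<le> j \<Longrightarrow> 0 < b j" and "\<And>j. 1 \<le> j \<Longrightarrow> b j = g (s j)"
    and "W = W_kernel s b"
    and "\<And>j. 1 \<le> j \<Longrightarrow> 0 \<le> h j" and "h summable_on {1..}"
    and "f = kernel_apply W h"
    and "0 < \<alpha>" and "prob_space M"
    and "permanental_sequence M \<alpha> (\<lambda>j k. W j k + f k) Z"
  shows "(AE \<omega> in M. limsup (\<lambda>j. ereal (Z j \<omega> / (W j j * K_seq s j))) = 1) \<and>
    (limsup (\<lambda>j. ereal (s j / s (j - 1))) < \<infinity> \<longrightarrow>
      (AE \<omega> in M. limsup (\<lambda>j. ereal (Z j \<omega> / (W j j * ln (ln (s j))))) = 1)) \<and>
    (1 < liminf (\<lambda>j. ereal (s j / s (j - 1))) \<longrightarrow>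
      (AE \<omega> in M. limsup (\<lambda>j. ereal (Z j \<omega> / (W j j * ln (real j)))) = 1))"
proof -
  have b: "0 < b j" "b j = g (s j)" if "1 \<le> j" for j using assms(7,8) that by auto
  have s_pos: "0 < s j" if "1 \<le> j" for j
    using assms(1,2) that by (cases "j = 1") (auto simp: strict_mono_on_def intro: less_trans)
  have g_conc: "concave_on {0..} g" and g_sub: "((\<lambda>x. g x / x) \<longlongrightarrow> 0) at_top"
    using assms(6) by (auto simp: sublinear_concave_def)
  define \<eta> where "\<eta> k = h k / g (s k)" for k
  \<comment> \<open>Chosen so that \<open>b k * f k = \<Phi> (s k)\<close>: the outer factor
    \<open>1 / b k\<close> of \<open>W\<close> cancels, the inner \<open>1 / b l\<close> goes into
    \<open>\<eta>\<close>.\<close>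
  define \<Phi> where "\<Phi> x = (\<Sum>\<^sub>\<infinity>k\<in>{1..}. min x (s k) * \<eta> k)" for x
  have g1: "0 < g (s k)" if "1 \<le> k" for k using b[OF that] by simp
  have s_le: "s 1 \<le> s k" if "1 \<le> k" for k
    using assms(1) that by (cases "k = 1") (auto simp: strict_mono_on_def less_imp_le)
  have \<eta>: "0 \<le> \<eta> k" if "1 \<le> k" for k using assms(10)[OF that] g1[OF that] by (simp add: \<eta>_def)
  have \<eta>_sum: "\<eta> summable_on {1..}"
  proof (rule summable_on_comparison_test[OF summable_on_cmult_right[OF assms(11), of "1 / g (s 1)"]])
    fix k :: nat assume "k \<in> {1..}"
    then have k: "1 \<le> k" by simp
    \<comment> \<open>Monotonicity keeps the divisors away from 0, so dividing \<open>h\<close> by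
      \<open>b\<close> preserves summability.\<close>
    have "g (s 1) \<le> g (s k)" using assms(5) s_le[OF k] assms(2) by (auto simp: mono_on_def)
    then show "\<eta> k \<le> 1 / g (s 1) * h k"
      using g1[of 1] assms(10)[OF k] by (simp add: \<eta>_def divide_left_mono frac_le)
    show "0 \<le> \<eta> k" by (rule \<eta>[OF k])
  qed
  have \<Phi>: "concave_on {0..} \<Phi>" "mono_on {0..} \<Phi>" "0 \<le> x \<Longrightarrow> 0 \<le> \<Phi> x" for x
    using sum_min_concave[of s \<eta>, OF s_pos \<eta> \<eta>_sum] unfolding \<Phi>_def[abs_def] by auto
  have kernel: "min (s j) (s k) + g (s j) * \<Phi> (s k) = b j * b k * (W j k + f k)" if "1 \<le> j" "1 \<le> k" for j k
  proof -
    have "b k * f k = (\<Sum>\<^sub>\<infinity>l\<in>{1..}. b k * (W k l * h l))"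
      unfolding assms(12) kernel_apply_def by (rule infsum_cmult_right'[symmetric])
    also have "\<dots> = \<Phi> (s k)"
      unfolding \<Phi>_def
      by (rule infsum_cong) (use b[OF that(2)] b in \<open>auto simp: assms(9) W_kernel_def \<eta>_def\<close>)
    finally have "b k * f k = \<Phi> (s k)" .
    moreover have "b j * b k * W j k = min (s j) (s k)" using b[OF that(1)] b[OF that(2)] by (simp add: assms(9) W_kernel_def)
    ultimately show ?thesis using b(2)[OF that(1)] by (simp add: distrib_left mult.assoc)
  qed
  interpret perturbed_min_kernel M s g \<Phi> \<alpha> "\<lambda>j \<omega>. (b j)\<^sup>2 * Z j \<omega>"
  proof (intro perturbed_min_kernel.intro perturbed_min_kernel_axioms.intro)
    show "(\<lambda>j. g (s j) * \<Phi> (s j) / s j) \<longlonglongrightarrow> 0"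
      unfolding \<Phi>_def \<eta>_def
      by (rule sum_min_product_small[OF s_pos assms(3) g_conc assms(5,4) g1 g_sub assms(10,11)])
    show "permanental_sequence M \<alpha> (\<lambda>j k. min (s j) (s k) + g (s j) * \<Phi> (s k)) (\<lambda>j \<omega>. (b j)\<^sup>2 * Z j \<omega>)"
      by (rule permanental_sequence_rescale[OF assms(15) b(1) kernel])
  qed (fact assms g_conc \<Phi> | rule assms(4) \<Phi>(3))+
  have quot: "limsup (\<lambda>j. ereal (Z j \<omega> / (W j j * L j))) = limsup (\<lambda>j. ereal ((b j)\<^sup>2 * Z j \<omega> / (s j * L j)))" for \<omega> L
  proof (rule Limsup_eq)
    show "eventually (\<lambda>j. ereal (Z j \<omega> / (W j j * L j)) = ereal ((b j)\<^sup>2 * Z j \<omega> / (s j * L j))) sequentially"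
      using eventually_ge_at_top[of 1]
      by eventually_elim (simp add: assms(9) W_kernel_def power2_eq_square mult_ac)
  qed
  show ?thesis
    unfolding quot using limsup_K_seq limsup_bounded_ratio limsup_separated by (simp add: \<tau>_K_seq)
qed

end
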